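(* Let $(X,d,\sigma)$ be a compatible metric-topological space with $(X,d)$ complete, and let $\phi:X\to(-\infty,\infty]$ be proper and satisfy the LSCC assumptions, with coercivity constant $\mathsf B$. Let $(\bar u_\varepsilon)_\varepsilon\subset D(\phi)$ and $\bar u\in D(\phi)$ fulfill, as $\varepsilon\downarrow0$, $$\bar u_\varepsilon\to\bar u\ \text{ in }\sigma,\qquad \sup_\varepsilon d(\bar u_\varepsilon,\bar u)<\infty,\qquad \phi(\bar u_\varepsilon)\to\phi(\bar u).$$ For every $\varepsilon>0$ (with $\frac1{16\varepsilon}\ge\mathsf B$) let $u_\varepsilon\in\mathcal M_\varepsilon(\bar u_\varepsilon)$. Then, for any sequence $(\varepsilon_k)_k$ with $\varepsilon_k\downarrow0$, there exist a (not relabeled) subsequence and $u\in AC^2_{\rm loc}([0,\infty);X)$ with $u(0)=\bar u$ such that $u_{\varepsilon_k}(t)\to u(t)$ in $\sigma$ for every $t\in[0,\infty)$, and $$\int_0^t\Big(\frac12|u'|^2(s)+\frac12|\partial^-\phi|^2(u(s))\Big)\,ds+\phi(u(t))\le\phi(\bar u)\qquad\text{for all }t\ge0 .$$ Therefore, if in addition $|\partial^-\phi|$ is an ($L^\infty$-moderated) upper gradient for $\phi$, then $u$ is a curve of maximal slope for $\phi$ with respect to $|\partial^-\phi|$.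
   Context: **Setting.** $(X,d)$ is a complete metric space and $\sigma$ is a Hausdorff topology on $X$; $(X,d,\sigma)$ is called compatible if (MT1) $u_n\to u$ and $v_n\to v$ in $\sigma$ imply $\liminf_n d(u_n,v_n)\ge d(u,v)$; (MT2) for every $\sigma$-open set $U$ and $x\in U$ there exist a $\sigma$-open neighborhood $V$ of $x$ and $\delta>0$ such that $d(y,V)<\delta$ implies $y\in U$, where $d(y,V)=\inf_{v\in V}d(y,v)$. For an interval $I\subset\mathbb R$ and $p\in[1,\infty]$, $AC^p(I;X)$ is the set of curves $u:I\to X$ for which there is $m\in L^p(I)$ with $d(u(s),u(t))\le\int_s^t m(r)\,dr$ for all $s\le t$ in $I$; $AC=AC^1$; $AC^p_{\rm loc}(I;X)$ is the set of curves belonging to $AC^p(J;X)$ for every compact interval $J\subset I$. The metric derivative $|u'|(t)=\lim_{s\to t}\frac{d(u(s),u(t))}{|t-s|}$ exists for a.e. $t\in I$. **LSCC assumptions.** $\phi:X\to(-\infty,\infty]$ is proper, $D(\phi)=\{\phi<\infty\}$, and: (Lower semicontinuity) if $\sup_{n,m}d(u_n,u_m)<\infty$ and $u_n\to u$ in $\sigma$, then $\liminf_n\phi(u_n)\ge\phi(u)$; (Compactness) every sequence with $\sup_n\phi(u_n)<\infty$ and $\sup_{n,m}d(u_n,u_m)<\infty$ has a $\sigma$-convergent subsequence; (Coercivity) there are $u_*\in X$ and constants $\mathsf A,\mathsf B\ge0$ such that $\phi(u)\ge-\mathsf B\,d^2(u,v)-\mathsf Q(v)$ for all $u,v\in X$,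 where $\mathsf Q(v)=\mathsf B\,d^2(v,u_* )+\mathsf A$. **WED functional.** $\mu_\varepsilon$ is the probability measure on $(0,\infty)$ with density $\frac1\varepsilon e^{-t/\varepsilon}$; $\mathcal I_\varepsilon[u]=\int_0^\infty\big(\frac\varepsilon2|u'|^2+\phi(u)\big)\,d\mu_\varepsilon$, well defined in $(-\infty,\infty]$ for $\frac1{16\varepsilon}\ge\mathsf B$ and $u\in\mathscr C_\varepsilon(x)=\{u\in AC^2_{\rm loc}([0,\infty);X): u(0)=x,\ \int_0^\infty|u'|^2\,d\mu_\varepsilon<\infty\}$; $\mathcal M_\varepsilon(x)$ is the set of minimizers of $\mathcal I_\varepsilon$ in $\mathscr C_\varepsilon(x)$ (nonempty for $x\in D(\phi)$). **Slopes, upper gradients, curves of maximal slope.** The local slope is $|\partial\phi|(u)=\limsup_{v\to u}\frac{(\phi(u)-\phi(v))^+}{d(u,v)}$ for $u\in D(\phi)$ (limit in $d$), and $|\partial\phi|=\infty$ off $D(\phi)$. The relaxed slope is $|\partial^-\phi|(u)=\inf\{\liminf_n|\partial\phi|(u_n): u_n\to u\text{ in }\sigma,\ \sup_n d(u_n,u)<\infty,\ \sup_n\phi(u_n)<\infty\}$. For $p\in[1,\infty]$, $g:X\to[0,\infty]$ is an $L^p$-moderated upper gradient for $\phi$ if for every curve $u\in AC(I;X)$ with $\phi\circ u\in L^p(I;|u'|\mathscr L^1)$ and $g\circ u\in L^1(I;|u'|\mathscr L^1)$ one has $|\phi(u(t))-\phi(u(s))|\le\int_s^t g(u(r))|u'|(r)\,dr$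 for all $s\le t$ in $I$ ($\mathscr L^1$ is Lebesgue measure). A curve $u\in AC^2_{\rm loc}([0,\infty);X)$ is a curve of maximal slope for $\phi$ with respect to $g$ if $\phi\circ u$ is locally bounded and $-(\phi\circ u)'(t)=|u'|^2(t)=g^2(u(t))$ for a.e. $t\in(0,\infty)$.
   Formalization: The relaxed slope along a curve may be nonmeasurable: integrals of it are then lower integrals, and the upper gradient inequality is required also on curves where g∘u is nonmeasurable but has finite lower integral; this agrees with the text when g is measurable along AC curves. *)

theory Defs
  imports "HOL-Analysis.Analysis"
begin

text \<open>
  The metric space \<open>(X, d)\<close> is a type of class \<open>metric_space\<close> (in the theorem: \<open>complete_space\<close>)
  with its \<open>dist\<close>; the second topology is an abstract topology \<open>\<sigma>\<close> whose carrier is the whole type.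
  A curve on an interval \<open>I\<close> is a total function of which only the values on \<open>I\<close> are used.
\<close>

definition compatible :: "'a::metric_space topology \<Rightarrow> bool" where
  "compatible \<sigma> \<longleftrightarrow>
     topspace \<sigma> = UNIV \<and> Hausdorff_space \<sigma> \<and>
     (\<forall>w z u v. limitin \<sigma> w u sequentially \<and> limitin \<sigma> z v sequentially \<longrightarrow>
        ereal (dist u v) \<le> liminf (\<lambda>n. ereal (dist (w n) (z n)))) \<and>
     (\<forall>U x. openin \<sigma> U \<and> x \<in> U \<longrightarrow>
        (\<exists>V \<delta>. openin \<sigma> V \<and> x \<in> V \<and> 0 < \<delta> \<and> (\<forall>y. infdist y V < \<delta> \<longrightarrow> y \<in> U)))"

definition in_Lp :: "ereal \<Rightarrow> 'b measure \<Rightarrow> ('b \<Rightarrow> ereal) \<Rightarrow> bool" where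
  "in_Lp p M f \<longleftrightarrow> f \<in> borel_measurable M \<and>
     (if p = \<infinity> then \<exists>C::real. AE x in M. \<bar>f x\<bar> \<le> ereal C
      else (AE x in M. \<bar>f x\<bar> \<noteq> \<infinity>) \<and>
           (\<integral>\<^sup>+ x. ennreal (\<bar>real_of_ereal (f x)\<bar> powr real_of_ereal p) \<partial>M) < \<infinity>)"

definition AC :: "ereal \<Rightarrow> real set \<Rightarrow> (real \<Rightarrow> 'a::metric_space) \<Rightarrow> bool" where
  "AC p I u \<longleftrightarrow> (\<exists>m :: real \<Rightarrow> real. in_Lp p (lebesgue_on I) (\<lambda>r. ereal (m r)) \<and>
     (\<forall>s\<in>I. \<forall>t\<in>I. s \<le> t \<longrightarrow> dist (u s) (u t) \<le> (LINT r:{s..t}|lebesgue. m r)))"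

definition AC_loc :: "ereal \<Rightarrow> real set \<Rightarrow> (real \<Rightarrow> 'a::metric_space) \<Rightarrow> bool" where
  "AC_loc p I u \<longleftrightarrow> (\<forall>a b. {a..b} \<subseteq> I \<longrightarrow> AC p {a..b} u)"

text \<open>
  For absolutely continuous \<open>u\<close> the limit exists for almost every \<open>t \<in> I\<close>; the unspecified value
  elsewhere only enters below through Lebesgue integrals and almost-everywhere statements.
\<close>

definition metric_deriv :: "real set \<Rightarrow> (real \<Rightarrow> 'a::metric_space) \<Rightarrow> real \<Rightarrow> real" where
  "metric_deriv I u t = Lim (at t within I) (\<lambda>s. dist (u s) (u t) / \<bar>t - s\<bar>)"

definition proper :: "('a \<Rightarrow> ereal) \<Rightarrow> bool" where
  "proper \<phi> \<longleftrightarrow> (\<forall>u. \<phi> u \<noteq> - \<infinity>) \<and> (\<exists>u. \<phi> u < \<infinity>)"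

definition edom :: "('a \<Rightarrow> ereal) \<Rightarrow> 'a set" where
  "edom \<phi> = {u. \<phi> u < \<infinity>}"

definition quad_bound :: "real \<Rightarrow> real \<Rightarrow> 'a::metric_space \<Rightarrow> 'a \<Rightarrow> real" where
  "quad_bound A B ustar v = B * (dist v ustar)\<^sup>2 + A"

definition LSCC ::
  "'a::metric_space topology \<Rightarrow> ('a \<Rightarrow> ereal) \<Rightarrow> 'a \<Rightarrow> real \<Rightarrow> real \<Rightarrow> bool" where
  "LSCC \<sigma> \<phi> ustar A B \<longleftrightarrow>
     (\<forall>w u. bounded (range w) \<and> limitin \<sigma> w u sequentially \<longrightarrow>
        \<phi> u \<le> liminf (\<lambda>n. \<phi> (w n))) \<and>
     (\<forall>w. (SUP n. \<phi> (w n)) < \<infinity> \<and> bounded (range w) \<longrightarrow>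
        (\<exists>r u. strict_mono (r :: nat \<Rightarrow> nat) \<and> limitin \<sigma> (w \<circ> r) u sequentially)) \<and>
     0 \<le> A \<and> 0 \<le> B \<and>
     (\<forall>u v. ereal (- B * (dist u v)\<^sup>2 - quad_bound A B ustar v) \<le> \<phi> u)"

definition wed_measure :: "real \<Rightarrow> real measure" where
  "wed_measure \<epsilon> = density (lebesgue_on {0<..}) (\<lambda>t. ennreal (exp (- t / \<epsilon>) / \<epsilon>))"

text \<open>
  Integral of an extended real function whose negative part is integrable; \<open>e2ennreal\<close> sends
  negative numbers to \<open>0\<close>, so the two integrals are those of the positive and negative parts.
\<close>

definition ereal_integral :: "'b measure \<Rightarrow> ('b \<Rightarrow> ereal) \<Rightarrow> ereal" where
  "ereal_integral M f =
     enn2ereal (\<integral>\<^sup>+ x. e2ennreal (f x) \<partial>M) - enn2ereal (\<integral>\<^sup>+ x. e2ennreal (- f x) \<partial>M)"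

definition wed :: "('a::metric_space \<Rightarrow> ereal) \<Rightarrow> real \<Rightarrow> (real \<Rightarrow> 'a) \<Rightarrow> ereal" where
  "wed \<phi> \<epsilon> u = ereal_integral (wed_measure \<epsilon>)
     (\<lambda>t. ereal (\<epsilon> / 2 * (metric_deriv {0..} u t)\<^sup>2) + \<phi> (u t))"

definition wed_curves :: "real \<Rightarrow> 'a::metric_space \<Rightarrow> (real \<Rightarrow> 'a) set" where
  "wed_curves \<epsilon> x = {u. AC_loc 2 {0..} u \<and> u 0 = x \<and>
     (\<integral>\<^sup>+ t. ennreal ((metric_deriv {0..} u t)\<^sup>2) \<partial>wed_measure \<epsilon>) < \<infinity>}"

definition wed_minimizers ::
  "('a::metric_space \<Rightarrow> ereal) \<Rightarrow> real \<Rightarrow> 'a \<Rightarrow> (real \<Rightarrow> 'a) set" where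
  "wed_minimizers \<phi> \<epsilon> x =
     {u \<in> wed_curves \<epsilon> x. \<forall>v \<in> wed_curves \<epsilon> x. wed \<phi> \<epsilon> u \<le> wed \<phi> \<epsilon> v}"

text \<open>The parameters for which \<open>wed\<close> is well defined, given the coercivity constant \<open>B\<close>.\<close>

definition wed_params :: "real \<Rightarrow> real set" where
  "wed_params B = {\<epsilon>. 0 < \<epsilon> \<and> B \<le> 1 / (16 * \<epsilon>)}"

text \<open>The upper limit is \<open>0\<close> at isolated points, where the filter \<open>at u\<close> is trivial.\<close>

definition local_slope :: "('a::metric_space \<Rightarrow> ereal) \<Rightarrow> 'a \<Rightarrow> ennreal" where
  "local_slope \<phi> u =
     (if u \<in> edom \<phi>
      then Limsup (at u) (\<lambda>v. e2ennreal (max 0 (\<phi> u - \<phi> v)) / ennreal (dist u v))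
      else \<infinity>)"

definition relaxed_slope ::
  "'a::metric_space topology \<Rightarrow> ('a \<Rightarrow> ereal) \<Rightarrow> 'a \<Rightarrow> ennreal" where
  "relaxed_slope \<sigma> \<phi> u =
     Inf {liminf (\<lambda>n. local_slope \<phi> (w n)) | w.
       limitin \<sigma> w u sequentially \<and> bdd_above (range (\<lambda>n. dist (w n) u)) \<and>
       (SUP n. \<phi> (w n)) < \<infinity>}"

text \<open>
  Two conventions matter here.

  The bound on \<open>\<bar>\<phi> (u t) - \<phi> (u s)\<bar>\<close> is written as two inequalities, since \<open>\<infinity> - \<infinity> = \<infinity>\<close> in
  \<open>ereal\<close>: a constant curve at a point with \<open>\<phi> = \<infinity>\<close> satisfies the integrability conditions and
  would otherwise violate the bound.

  Integrability of \<open>g \<circ> u\<close> with respect to the metric speed is finiteness of the nonnegative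
  integral. No measurability of \<open>g \<circ> u\<close> is demanded in this premise: curves along which \<open>g \<circ> u\<close>
  is not measurable are not exempted from the bound, the integrals then being lower integrals.
  This agrees with the usual notion when \<open>g\<close> is measurable along absolutely continuous curves.
\<close>

definition moderated_upper_gradient ::
  "ereal \<Rightarrow> ('a::metric_space \<Rightarrow> ereal) \<Rightarrow> ('a \<Rightarrow> ennreal) \<Rightarrow> bool" where
  "moderated_upper_gradient p \<phi> g \<longleftrightarrow>
     (\<forall>I u. is_interval I \<and> AC 1 I u \<and>
        in_Lp p (completion (density (lebesgue_on I) (\<lambda>t. ennreal (metric_deriv I u t))))
          (\<lambda>t. \<phi> (u t)) \<and>
        (\<integral>\<^sup>+ t\<in>I. g (u t) * ennreal (metric_deriv I u t) \<partial>lebesgue) < \<infinity> \<longrightarrow>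
        (\<forall>s\<in>I. \<forall>t\<in>I. s \<le> t \<longrightarrow>
           (let G = enn2ereal
                  (\<integral>\<^sup>+ r\<in>{s..t}. g (u r) * ennreal (metric_deriv I u r) \<partial>lebesgue)
            in \<phi> (u t) \<le> \<phi> (u s) + G \<and> \<phi> (u s) \<le> \<phi> (u t) + G)))"

text \<open>Local boundedness makes \<open>\<phi> \<circ> u\<close> finite, so \<open>real_of_ereal\<close> loses no information.\<close>

definition curve_of_maximal_slope ::
  "('a::metric_space \<Rightarrow> ereal) \<Rightarrow> ('a \<Rightarrow> ennreal) \<Rightarrow> (real \<Rightarrow> 'a) \<Rightarrow> bool" where
  "curve_of_maximal_slope \<phi> g u \<longleftrightarrow>
     AC_loc 2 {0..} u \<and>
     (\<forall>T\<ge>0. \<exists>C::real. \<forall>t\<in>{0..T}. \<bar>\<phi> (u t)\<bar> \<le> ereal C) \<and>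
     (AE t in lebesgue_on {0<..}.
        ((\<lambda>s. real_of_ereal (\<phi> (u s))) has_real_derivative - (metric_deriv {0..} u t)\<^sup>2) (at t) \<and>
        ennreal ((metric_deriv {0..} u t)\<^sup>2) = (g (u t))\<^sup>2)"

end

theory Submission
  imports Defs "HOL-Probability.Helly_Selection" "HOL-Library.Diagonal_Subsequence"
begin

text \<open>
  Let \<open>W t\<close> be the WED energy of the tail of the minimizer \<open>u\<close> after time \<open>t\<close>. An exchange of
  integrations gives \<open>W t + \<integral> (\<bar>u'\<bar>\<^sup>2 / 2 + (\<phi> u - W) / \<epsilon>) = W 0 \<le> \<phi> (u 0)\<close>, the integral being over
  \<open>{0..t}\<close>, and minimality gives \<open>W \<le> \<phi> u\<close>. If the slope exceeds \<open>s\<close> on the part of the ball of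
  radius \<open>r\<close> around \<open>u t\<close> where \<open>\<phi> \<le> \<phi> (u t)\<close>, then \<open>\<phi>\<close> decreases at rate \<open>s\<^sup>2\<close> along some curve of
  speed \<open>s\<close> starting at \<open>u t\<close>, and using this curve as a competitor yields
  \<open>(\<phi> (u t) - W t) / \<epsilon> \<ge> s\<^sup>2 / 2 * (1 - exp (- (r / s) / \<epsilon>))\<close>. So \<open>(\<phi> u - W) / \<epsilon>\<close> controls the
  squared slope at points near \<open>u t\<close>, without any regularity of the value function.

  As \<open>\<epsilon>\<close> tends to \<open>0\<close>, the dissipation is bounded, so the curves converge pointwise along a
  subsequence. Since the integral of \<open>\<phi> u - W\<close> is \<open>O(\<epsilon>)\<close>, this difference vanishes almost everywhere
  along a further subsequence, and \<open>W\<close> passes to the limit through \<open>\<phi>\<close>. By Fatou's lemma and the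
  definition of the relaxed slope the energy identity becomes the claimed inequality. The upper
  gradient property gives the opposite inequality, so that equality holds in Young's inequality
  almost everywhere.
\<close>

section \<open>Densities of dominated increasing functions\<close>

text \<open>Two analytic obstacles shape the proof. First, limits of curves are controlled only
  through distances, so limits of speeds are taken on the level of primitives. The family of
  inequalities G t - G s \<le> l (t - s) + (H t - H s) / l, for all l > 0, encodes that G has a
  density whose square is controlled by H. It is linear in G and H, hence stable under the pointwise
  limits of Helly's theorem, which takes the place of weak compactness in L2. Second, coercivity
  lets the energy tend to minus infinity quadratically, so bounding the dissipation is circular: the
  lower bound on \<open>W\<close> contains the distance travelled, which the dissipation controls.
  The circle is broken on short time steps.

  In the slope estimate the radius is chosen as the square root of \<epsilon>: it tends to 0, so the
  nearby points have the same limit, but it is long on the scale \<epsilon>, so the exponential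
  factor disappears. The relaxed slope along the limit curve is not shown to be measurable; a
  measurable majorant \<open>\<Lambda>\<close> of half its square is carried along instead.\<close>

lemma interval_measure_unique:
  fixes F :: "real \<Rightarrow> real"
  assumes "mono F" "\<And>x. continuous (at_right x) F" "sets M = sets borel"
    and eq: "\<And>a b. a \<le> b \<Longrightarrow> emeasure M {a<..b} = ennreal (F b - F a)"
  shows "M = interval_measure F"
proof (rule measure_eqI_generator_eq[where E = "range (\<lambda>(a, b). {a<..b::real})" and \<Omega> = UNIV
      and A = "\<lambda>i. {- real i<..real i}"])
  show "Int_stable (range (\<lambda>(a, b). {a<..b::real}))"
    by (auto simp: Int_stable_def)
  show "sets M = sigma_sets UNIV (range (\<lambda>(a, b). {a<..b::real}))"
    "sets (interval_measure F) = sigma_sets UNIV (range (\<lambda>(a, b). {a<..b::real}))"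
    using assms(3) by (simp_all add: borel_sigma_sets_Ioc)
  show "(\<Union>i. {- real i<..real i}) = UNIV"
  proof (intro equalityI subsetI UNIV_I)
    fix x :: real
    obtain n :: nat where "\<bar>x\<bar> < real n"
      using reals_Archimedean2 by blast
    then show "x \<in> (\<Union>i. {- real i<..real i})"
      by (intro UN_I[of n]) auto
  qed
  show "emeasure M X = emeasure (interval_measure F) X"
    if XE: "X \<in> range (\<lambda>(a, b). {a<..b::real})" for X
  proof -
    obtain a b where X: "X = {a<..b}"
      using XE by (metis (mono_tags, lifting) case_prod_unfold rangeE)
    show ?thesis
    proof (cases "a \<le> b")
      case True
      then show ?thesis
        unfolding X using assms eq by (subst emeasure_interval_measure_Ioc) (auto dest: monoD)
    qed (simp add: X)
  qed
  show "emeasure M {- real i<..real i} \<noteq> \<infinity>" for i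
    using eq[of "- real i" "real i"] by simp
qed auto

text \<open>The sum of the two measures is itself a measure and is additive on half-open intervals,
  so uniqueness identifies it. This turns a monotonicity statement on increments into an inequality
  between Stieltjes measures on all Borel sets.\<close>

lemma emeasure_interval_measure_add:
  fixes F G :: "real \<Rightarrow> real"
  assumes F: "mono F" "\<And>x. continuous (at_right x) F" and G: "mono G" "\<And>x. continuous (at_right x) G"
    and A: "A \<in> sets borel"
  shows "emeasure (interval_measure (\<lambda>x. F x + G x)) A
    = emeasure (interval_measure F) A + emeasure (interval_measure G) A"
proof -
  let ?\<mu> = "\<lambda>A. emeasure (interval_measure F) A + emeasure (interval_measure G) A"
  define M where "M = measure_of UNIV (sets borel) ?\<mu>"
  have sM: "sets M = sets borel"
    unfolding M_def by (metis sets.sets_measure_of_eq space_borel)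
  have eM: "emeasure M A = ?\<mu> A" if "A \<in> sets borel" for A
    unfolding M_def
  proof (rule emeasure_measure_of_sigma[OF _ _ _ that])
    show "sigma_algebra UNIV (sets (borel :: real measure))"
      by (metis sets.sigma_algebra_axioms space_borel)
    show "positive (sets borel) ?\<mu>"
      by (simp add: positive_def)
    show "countably_additive (sets borel) ?\<mu>"
      unfolding countably_additive_def
      by (auto simp: suminf_add[symmetric] suminf_emeasure)
  qed
  have "M = interval_measure (\<lambda>x. F x + G x)"
  proof (rule interval_measure_unique)
    show "mono (\<lambda>x. F x + G x)"
      using F G by (auto simp: mono_def intro: add_mono)
    show "continuous (at_right x) (\<lambda>x. F x + G x)" for x
      using F G by (intro continuous_intros)
    show "emeasure M {a<..b} = ennreal (F b + G b - (F a + G a))" if "a \<le> b" for a b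
      using that F G
      by (simp add: eM emeasure_interval_measure_Ioc monoD algebra_simps flip: ennreal_plus)
  qed (fact sM)
  with eM[OF A] show ?thesis by simp
qed

lemma emeasure_interval_measure_scale:
  fixes F :: "real \<Rightarrow> real"
  assumes F: "mono F" "\<And>x. continuous (at_right x) F" and "0 \<le> c"
  shows "emeasure (interval_measure (\<lambda>x. c * F x)) A = ennreal c * emeasure (interval_measure F) A"
proof -
  have "scale_measure (ennreal c) (interval_measure F) = interval_measure (\<lambda>x. c * F x)"
  proof (rule interval_measure_unique)
    show "mono (\<lambda>x. c * F x)"
      using F \<open>0 \<le> c\<close> by (auto simp: mono_def intro: mult_left_mono)
    show "continuous (at_right x) (\<lambda>x. c * F x)" for x
      using F by (intro continuous_intros)
    show "emeasure (scale_measure (ennreal c) (interval_measure F)) {a<..b} = ennreal (c * F b - c * F a)"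
      if "a \<le> b" for a b
      using that F \<open>0 \<le> c\<close>
      by (simp add: emeasure_interval_measure_Ioc monoD right_diff_distrib flip: ennreal_mult)
  qed simp
  then show ?thesis
    by (metis emeasure_scale_measure)
qed

lemma finite_interval_measure_bounded:
  fixes F :: "real \<Rightarrow> real"
  assumes F: "mono F" "\<And>x. continuous (at_right x) F" and K: "\<And>x. \<bar>F x\<bar> \<le> K"
  shows "emeasure (interval_measure F) A \<le> ennreal (2 * K)"
proof -
  have "emeasure (interval_measure F) (\<Union>i. {- real i<..real i}) = (SUP i. emeasure (interval_measure F) {- real i<..real i})"
    by (intro SUP_emeasure_incseq[symmetric]) (auto simp: incseq_def)
  also have "\<dots> \<le> ennreal (2 * K)"
  proof (rule SUP_least)
    fix i :: nat
    show "emeasure (interval_measure F) {- real i<..real i} \<le> ennreal (2 * K)"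
      using F K[of "real i"] K[of "- real i"] 
      by (subst emeasure_interval_measure_Ioc) (auto dest: monoD intro!: ennreal_leI)
  qed
  finally have *: "emeasure (interval_measure F) (\<Union>i. {- real i<..real i}) \<le> ennreal (2 * K)" .
  have "(\<Union>i. {- real i<..real i}) = UNIV"
  proof (intro equalityI subsetI UNIV_I)
    fix x :: real
    obtain n :: nat where "\<bar>x\<bar> < real n"
      using reals_Archimedean2 by blast
    then show "x \<in> (\<Union>i. {- real i<..real i})"
      by (intro UN_I[of n]) auto
  qed
  with * have "emeasure (interval_measure F) UNIV \<le> ennreal (2 * K)" by simp
  moreover have "emeasure (interval_measure F) A \<le> emeasure (interval_measure F) UNIV"
    using emeasure_space[of "interval_measure F" A] by simp
  ultimately show ?thesis by simp
qed

lemma AE_has_real_derivative_indefinite_integral: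
  fixes f F :: "real \<Rightarrow> real"
  assumes int: "\<And>a b. set_integrable lborel {a..b} f"
    and F: "\<And>s t. s \<le> t \<Longrightarrow> F t - F s = (LINT r:{s..t}|lborel. f r)"
  shows "AE t in lborel. (F has_real_derivative f t) (at t)"
proof -
  have fint: "f integrable_on {a..b}" for a b
    using set_borel_integral_eq_integral(1)[OF int] .
  have Fi: "F t - F s = integral {s..t} f" if "s \<le> t" for s t
    using set_borel_integral_eq_integral(2)[OF int[of s t]] F[OF that] by simp
  have fint': "(\<lambda>x. f (- x)) integrable_on {a..b}" for a b
    using Henstock_Kurzweil_Integration.integrable_reflect_real[of f "-a" "-b"] fint by simp
  obtain N1 where N1: "negligible N1"
    "\<And>x e. \<lbrakk>x \<notin> N1; 0 < e\<rbrakk> \<Longrightarrow> \<exists>d>0. \<forall>h. 0 < h \<and> h < d \<longrightarrow>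
                         norm (integral (cbox x (x + h *\<^sub>R One)) f /\<^sub>R h ^ DIM(real) - f x) < e"
    using integrable_ccontinuous_explicit[of f] fint by (metis cbox_interval)
  obtain N2 where N2: "negligible N2"
    "\<And>x e. \<lbrakk>x \<notin> N2; 0 < e\<rbrakk> \<Longrightarrow> \<exists>d>0. \<forall>h. 0 < h \<and> h < d \<longrightarrow>
                         norm (integral (cbox x (x + h *\<^sub>R One)) (\<lambda>x. f (- x)) /\<^sub>R h ^ DIM(real) - f (- x)) < e"
    using integrable_ccontinuous_explicit[of "\<lambda>x. f (- x)"] fint' by (metis cbox_interval)
  have "(F has_real_derivative f t) (at t)" if "t \<notin> N1" "t \<notin> uminus ` N2" for t
  proof -
    have "- t \<notin> N2"
      using that(2) by (metis image_eqI minus_minus)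
    have "\<exists>d>0. \<forall>s. s \<noteq> t \<and> norm (s - t) < d \<longrightarrow> norm ((F s - F t) / (s - t) - f t) < e" if "0 < e" for e
    proof -
      obtain d1 where d1: "d1 > 0" "\<And>h. 0 < h \<Longrightarrow> h < d1 \<Longrightarrow> \<bar>integral {t..t+h} f / h - f t\<bar> < e"
        using N1(2)[OF \<open>t \<notin> N1\<close> \<open>0 < e\<close>] by (auto simp: field_simps)
      obtain d2 where d2: "d2 > 0" "\<And>h. 0 < h \<Longrightarrow> h < d2 \<Longrightarrow> \<bar>integral {-t..-t+h} (\<lambda>x. f (- x)) / h - f t\<bar> < e"
        using N2(2)[OF \<open>- t \<notin> N2\<close> \<open>0 < e\<close>] by (auto simp: field_simps)
      have "norm ((F s - F t) / (s - t) - f t) < e" if s: "s \<noteq> t" "norm (s - t) < min d1 d2" for s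
      proof (cases "s > t")
        case True
        then show ?thesis
          using d1(2)[of "s - t"] s Fi[of t s] by simp
      next
        case False
        have "integral {-t..-s} (\<lambda>x. f (- x)) = integral {s..t} f"
          by (rule Henstock_Kurzweil_Integration.integral_reflect_real)
        moreover have "(F s - F t) / (s - t) = (F t - F s) / (t - s)"
          by (metis minus_diff_eq minus_divide_divide)
        ultimately show ?thesis
          using False d2(2)[of "t - s"] s Fi[of s t] by simp
      qed
      then show ?thesis
        using d1(1) d2(1) by (intro exI[of _ "min d1 d2"]) auto
    qed
    then show ?thesis
      unfolding has_field_derivative_iff by (simp add: LIM_def dist_norm)
  qed
  moreover have "negligible (N1 \<union> uminus ` N2)"
    using N1(1) N2(1)
    by (intro negligible_Un negligible_differentiable_image_negligible) (auto intro!: derivative_intros)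
  then have "N1 \<union> uminus ` N2 \<in> null_sets lebesgue"
    by (simp only: negligible_iff_null_sets)
  then have "AE t in lebesgue. t \<notin> N1 \<union> uminus ` N2"
    by (rule AE_not_in)
  ultimately have "AE t in lebesgue. (F has_real_derivative f t) (at t)"
    by (auto elim: eventually_mono)
  then show ?thesis
    by (simp add: AE_completion_iff)
qed

lemma nn_integral_Icc_imp_LINT:
  fixes g :: "real \<Rightarrow> real"
  assumes [measurable]: "g \<in> borel_measurable borel" and "\<And>r. 0 \<le> g r" "0 \<le> c"
    and eq: "(\<integral>\<^sup>+r\<in>A. ennreal (g r) \<partial>lborel) = ennreal c" and [measurable]: "A \<in> sets borel"
  shows "set_integrable lborel A g" "(LINT r:A|lborel. g r) = c"
proof -
  have *: "(\<integral>\<^sup>+r. ennreal (indicator A r *\<^sub>R g r) \<partial>lborel) = ennreal c"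
    unfolding eq[symmetric] by (intro nn_integral_cong) (auto simp: indicator_def)
  show int: "set_integrable lborel A g"
    unfolding set_integrable_def
    by (rule integrableI_nn_integral_finite[OF _ _ *]) (auto simp: assms)
  show "(LINT r:A|lborel. g r) = c"
    unfolding set_lebesgue_integral_def
    by (subst integral_eq_nn_integral) (use * assms in \<open>auto\<close>)
qed

text \<open>Optimizing \<open>dom\<close> over \<open>l\<close> gives the Cauchy-Schwarz condition
  (G t - G s)^2 \<le> 4 (t - s) (H t - H s). The linear form is kept because for each
  \<open>l\<close> it is a domination of Stieltjes measures: a Lebesgue null set has
  \<open>G\<close>-measure at most 2 K / l, and \<open>l\<close> is arbitrary, so a density exists.
  Its square is bounded by Fatou's lemma for the difference quotients of \<open>G\<close>, which the
  quadratic form controls.\<close>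

lemma ex_density_of_dominated:
  fixes G H :: "real \<Rightarrow> real"
  assumes G: "mono G" "\<And>x. continuous (at_right x) G" "\<And>x. \<bar>G x\<bar> \<le> K"
    and H: "mono H" "\<And>x. continuous (at_right x) H" "\<And>x. \<bar>H x\<bar> \<le> K"
    and dom: "\<And>l s t. 0 < l \<Longrightarrow> s \<le> t \<Longrightarrow> G t - G s \<le> l * (t - s) + (H t - H s) / l"
  obtains g where "g \<in> borel_measurable borel" "\<And>t. 0 \<le> g t"
    "\<And>s t. s \<le> t \<Longrightarrow> (\<integral>\<^sup>+r\<in>{s..t}. ennreal (g r) \<partial>lborel) = ennreal (G t - G s)"
    "(\<integral>\<^sup>+r. ennreal ((g r)\<^sup>2) \<partial>lborel) < \<infinity>"
proof -
  let ?G = "interval_measure G" and ?H = "interval_measure H"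
  have K: "0 \<le> K"
    using G(3)[of 0] by simp
  have null: "emeasure ?G N = 0" if N: "N \<in> null_sets lborel" for N
  proof -
    have Nb: "N \<in> sets borel"
      using N by auto
    have le: "emeasure ?G N \<le> ennreal (2 * K / l)" if "0 < l" for l
    proof -
      \<comment> \<open>By \<open>dom\<close> the remainder \<open>R\<close> is nondecreasing.
        Dropping its nonnegative measure bounds the measure of \<open>G\<close> by that of the
        right-hand side.\<close>
      define R where "R x = (l * x + (1 / l) * H x) - G x" for x
      have R: "mono R"
      proof (rule monoI)
        fix x y :: real
        assume "x \<le> y"
        from dom[OF \<open>0 < l\<close> this] show "R x \<le> R y"
          by (simp add: R_def right_diff_distrib diff_divide_distrib)
      qed
      have R2: "continuous (at_right x) R" for x
        unfolding R_def using G H by (intro continuous_intros)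
      have lin: "mono (\<lambda>x. l * x)" "\<And>x. continuous (at_right x) (\<lambda>x. l * x)"
        using \<open>0 < l\<close> by (auto simp: mono_def intro!: continuous_intros)
      have lH: "mono (\<lambda>x. (1 / l) * H x)" "\<And>x. continuous (at_right x) (\<lambda>x. (1 / l) * H x)"
        using \<open>0 < l\<close> H by (auto simp: mono_def divide_right_mono intro!: continuous_intros)
      have "emeasure ?G N \<le> emeasure ?G N + emeasure (interval_measure R) N"
        by simp
      also have "\<dots> = emeasure (interval_measure (\<lambda>x. G x + R x)) N"
        using G R R2 Nb by (subst emeasure_interval_measure_add) auto
      also have "(\<lambda>x. G x + R x) = (\<lambda>x. l * x + (1 / l) * H x)"
        by (auto simp: R_def)
      also have "emeasure (interval_measure \<dots>) N
          = emeasure (interval_measure (\<lambda>x. l * x)) N + emeasure (interval_measure (\<lambda>x. (1 / l) * H x)) N"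
        by (rule emeasure_interval_measure_add[OF lin lH Nb])
      also have "emeasure (interval_measure (\<lambda>x. l * x)) N = ennreal l * emeasure (interval_measure (\<lambda>x. x)) N"
        using \<open>0 < l\<close> by (intro emeasure_interval_measure_scale) (auto simp: mono_def)
      also have "emeasure (interval_measure (\<lambda>x. x)) N = 0"
        using N by (auto simp: lborel_eq_real)
      also have "emeasure (interval_measure (\<lambda>x. (1 / l) * H x)) N = ennreal (1 / l) * emeasure ?H N"
        using \<open>0 < l\<close> H by (intro emeasure_interval_measure_scale) auto
      also have "ennreal l * 0 + ennreal (1 / l) * emeasure ?H N \<le> ennreal (1 / l) * ennreal (2 * K)"
        using finite_interval_measure_bounded[OF H] by (simp add: mult_left_mono)
      also have "\<dots> = ennreal (2 * K / l)"
        using \<open>0 < l\<close> K by (simp flip: ennreal_mult)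
      finally show ?thesis .
    qed
    have "emeasure ?G N \<le> ennreal e" if "0 < e" for e
    proof -
      have "2 * K / ((2 * K + 1) / e) \<le> e"
        using that K by (simp add: field_simps)
      then show ?thesis
        using le[of "(2 * K + 1) / e"] that K by (force intro: order_trans ennreal_leI)
    qed
    then have "emeasure ?G N \<le> 0 + ennreal e" if "0 < e" for e
      using that by simp
    then have "emeasure ?G N \<le> 0"
      by (rule ennreal_le_epsilon)
    then show ?thesis by simp
  qed
  interpret fG: finite_measure ?G
    using finite_interval_measure_bounded[OF G, of UNIV] by (intro finite_measureI) (auto simp: top_unique)
  have ac: "absolutely_continuous lborel ?G"
    unfolding absolutely_continuous_def using null by (auto simp: null_sets_def)
  obtain g where g: "g \<in> borel_measurable lborel" "AE x in lborel. RN_deriv lborel ?G x = ennreal (g x)"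
      "\<And>x. 0 \<le> g x"
    using sigma_finite_measure.real_RN_deriv[OF sigma_finite_lborel fG.finite_measure_axioms ac] by auto
  have gb [measurable]: "g \<in> borel_measurable borel"
    using g(1) by simp
  have nn: "(\<integral>\<^sup>+r\<in>{s..t}. ennreal (g r) \<partial>lborel) = ennreal (G t - G s)" if "s \<le> t" for s t
  proof -
    have "(\<integral>\<^sup>+r\<in>{s..t}. ennreal (g r) \<partial>lborel) = (\<integral>\<^sup>+r\<in>{s<..t}. RN_deriv lborel ?G r \<partial>lborel)"
      using g(2) AE_lborel_singleton[of s]
      by (intro nn_integral_cong_AE) (auto simp: indicator_def)
    also have "\<dots> = emeasure (density lborel (RN_deriv lborel ?G)) {s<..t}"
      by (simp add: emeasure_density)
    also have "density lborel (RN_deriv lborel ?G) = ?G"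
      using ac by (intro sigma_finite_measure.density_RN_deriv[OF sigma_finite_lborel]) auto
    also have "emeasure ?G {s<..t} = ennreal (G t - G s)"
      using that G by (intro emeasure_interval_measure_Ioc) (auto dest: monoD)
    finally show ?thesis .
  qed
  have LI: "set_integrable lborel {s..t} g" "s \<le> t \<Longrightarrow> G t - G s = (LINT r:{s..t}|lborel. g r)" for s t
  proof -
    show *: "s \<le> t \<Longrightarrow> G t - G s = (LINT r:{s..t}|lborel. g r)"
      using nn_integral_Icc_imp_LINT(2)[OF gb g(3) _ nn, of t s] monoD[OF G(1), of s t] by simp
    show "set_integrable lborel {s..t} g"
    proof (cases "s \<le> t")
      case True
      then show ?thesis
        using nn_integral_Icc_imp_LINT(1)[OF gb g(3) _ nn, of t s] monoD[OF G(1), of s t] by simp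
    qed (simp add: set_integrable_def)
  qed
  have der: "AE t in lborel. (G has_real_derivative g t) (at t)"
    by (rule AE_has_real_derivative_indefinite_integral[OF LI(1) LI(2)])
  define h where "h n = 1 / real (Suc n)" for n
  have h: "0 < h n" "h \<longlonglongrightarrow> 0" for n
    unfolding h_def using LIMSEQ_inverse_real_of_nat by (auto simp: inverse_eq_divide)
  have [measurable]: "G \<in> borel_measurable borel" "H \<in> borel_measurable borel"
    using G H by (auto intro: borel_measurable_mono)
  \<comment> \<open>With l = a / (2 h) the first term of \<open>dom\<close> is a / 2 and is absorbed
    into the left-hand side, where a is the increment of \<open>G\<close>.\<close>
  have sq: "(G (t + h n) - G t)\<^sup>2 \<le> 4 * h n * (H (t + h n) - H t)" for t n
  proof (cases "G (t + h n) - G t = 0")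
    case True
    then show ?thesis
      using h(1)[of n] monoD[OF H(1), of t "t + h n"] by simp
  next
    case False
    define a where "a = G (t + h n) - G t"
    have a: "a > 0"
      using False h(1)[of n] monoD[OF G(1), of t "t + h n"] by (simp add: a_def)
    have "a \<le> a / (2 * h n) * h n + (H (t + h n) - H t) / (a / (2 * h n))"
      using dom[of "a / (2 * h n)" t "t + h n"] a h(1)[of n] by (simp add: a_def)
    then have "a * a \<le> a * (a / 2 + (H (t + h n) - H t) * (2 * h n) / a)"
      using a h(1)[of n] by (intro mult_left_mono) auto
    also have "\<dots> = a * a / 2 + (H (t + h n) - H t) * (2 * h n)"
      using a by (simp add: distrib_left)
    finally have "a * a \<le> 2 * ((H (t + h n) - H t) * (2 * h n))"
      by simp
    also have "\<dots> = 4 * h n * (H (t + h n) - H t)"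
      by (simp only: mult.assoc mult.commute mult.left_commute)
    finally show ?thesis
      by (simp add: a_def[symmetric] power2_eq_square)
  qed
  interpret sH: sigma_finite_measure ?H
    by (rule sigma_finite_interval_measure[OF monoD[OF H(1)] H(2)])
  interpret P: pair_sigma_finite lborel ?H ..
  \<comment> \<open>Each point r of the measure of \<open>H\<close> lies in the window from t to t +
    h for a set of t of length h, and the total mass is at most 2 K.\<close>
  have tonelli: "(\<integral>\<^sup>+t. ennreal (H (t + h n) - H t) \<partial>lborel) \<le> ennreal (h n * (2 * K))" for n
  proof -
    have m: "(\<lambda>(t, r). indicator {x::real \<times> real. fst x < snd x \<and> snd x \<le> fst x + h n} (t, r) :: ennreal)
        \<in> borel_measurable (lborel \<Otimes>\<^sub>M ?H)"
    proof -
      have "sets (lborel \<Otimes>\<^sub>M ?H) = sets (borel \<Otimes>\<^sub>M borel)"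
        by (intro sets_pair_measure_cong) auto
      moreover have "(\<lambda>(t, r). indicator {x::real \<times> real. fst x < snd x \<and> snd x \<le> fst x + h n} (t, r) :: ennreal)
        \<in> borel_measurable (borel \<Otimes>\<^sub>M borel)"
        by measurable
      ultimately show ?thesis
        by (simp cong: measurable_cong_sets)
    qed
    have "(\<integral>\<^sup>+t. ennreal (H (t + h n) - H t) \<partial>lborel) = (\<integral>\<^sup>+t. emeasure ?H {t<..t + h n} \<partial>lborel)"
      using h(1)[of n] H by (subst emeasure_interval_measure_Ioc) (auto dest: monoD)
    also have "\<dots> = (\<integral>\<^sup>+t. \<integral>\<^sup>+r. indicator {x. fst x < snd x \<and> snd x \<le> fst x + h n} (t, r) \<partial>?H \<partial>lborel)"
    proof (intro nn_integral_cong)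
      fix t
      have "(\<integral>\<^sup>+r. indicator {x. fst x < snd x \<and> snd x \<le> fst x + h n} (t, r) \<partial>?H)
          = (\<integral>\<^sup>+r. indicator {t<..t + h n} r \<partial>?H)"
        by (intro nn_integral_cong) (auto simp: indicator_def)
      then show "emeasure ?H {t<..t + h n}
          = (\<integral>\<^sup>+r. indicator {x. fst x < snd x \<and> snd x \<le> fst x + h n} (t, r) \<partial>?H)"
        by simp
    qed
    also have "\<dots> = (\<integral>\<^sup>+r. \<integral>\<^sup>+t. indicator {x. fst x < snd x \<and> snd x \<le> fst x + h n} (t, r) \<partial>lborel \<partial>?H)"
      using P.Fubini'[OF m] by simp
    also have "\<dots> = (\<integral>\<^sup>+r. ennreal (h n) \<partial>?H)"
    proof (intro nn_integral_cong)
      fix r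
      have "(\<integral>\<^sup>+t. indicator {x. fst x < snd x \<and> snd x \<le> fst x + h n} (t, r) \<partial>lborel)
          = (\<integral>\<^sup>+t. indicator {r - h n..<r} t \<partial>lborel)"
        by (intro nn_integral_cong) (auto simp: indicator_def)
      then show "(\<integral>\<^sup>+t. indicator {x. fst x < snd x \<and> snd x \<le> fst x + h n} (t, r) \<partial>lborel) = ennreal (h n)"
        using h(1)[of n] by simp
    qed
    also have "\<dots> \<le> ennreal (h n) * ennreal (2 * K)"
      using finite_interval_measure_bounded[OF H, of UNIV] by (simp add: mult_left_mono)
    finally show ?thesis
      using h(1)[of n] K by (simp add: ennreal_mult)
  qed
  have "(\<integral>\<^sup>+r. ennreal ((g r)\<^sup>2) \<partial>lborel)
      \<le> (\<integral>\<^sup>+t. liminf (\<lambda>n. ennreal (((G (t + h n) - G t) / h n)\<^sup>2)) \<partial>lborel)"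
  proof (rule nn_integral_mono_AE)
    show "AE t in lborel. ennreal ((g t)\<^sup>2) \<le> liminf (\<lambda>n. ennreal (((G (t + h n) - G t) / h n)\<^sup>2))"
      using der
    proof eventually_elim
      case (elim t)
      have "((\<lambda>e. (G (t + e) - G t) / e) \<longlongrightarrow> g t) (at 0)"
        using elim by (simp add: DERIV_def)
      moreover have "filterlim h (at 0) sequentially"
        using h by (simp add: filterlim_at less_imp_neq[symmetric])
      ultimately have "(\<lambda>n. (G (t + h n) - G t) / h n) \<longlonglongrightarrow> g t"
        by (rule filterlim_compose)
      then have "(\<lambda>n. ennreal (((G (t + h n) - G t) / h n)\<^sup>2)) \<longlonglongrightarrow> ennreal ((g t)\<^sup>2)"
        by (intro tendsto_ennrealI tendsto_power)
      from lim_imp_Liminf[OF sequentially_bot this] show ?case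
        by simp
    qed
  qed
  also have "\<dots> \<le> liminf (\<lambda>n. \<integral>\<^sup>+t. ennreal (((G (t + h n) - G t) / h n)\<^sup>2) \<partial>lborel)"
    by (intro nn_integral_liminf) measurable
  also have "\<dots> \<le> liminf (\<lambda>n::nat. ennreal (8 * K))"
  proof (intro Liminf_mono always_eventually allI)
    fix n
    have "(\<integral>\<^sup>+t. ennreal (((G (t + h n) - G t) / h n)\<^sup>2) \<partial>lborel)
        \<le> (\<integral>\<^sup>+t. ennreal (4 / h n) * ennreal (H (t + h n) - H t) \<partial>lborel)"
    proof (intro nn_integral_mono)
      fix t
      have "((G (t + h n) - G t) / h n)\<^sup>2 \<le> 4 * h n * (H (t + h n) - H t) / (h n)\<^sup>2"
        using sq[of t n] h(1)[of n] by (simp add: power_divide divide_right_mono)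
      also have "\<dots> = 4 / h n * (H (t + h n) - H t)"
        using h(1)[of n] by (simp add: field_simps power2_eq_square)
      finally show "ennreal (((G (t + h n) - G t) / h n)\<^sup>2) \<le> ennreal (4 / h n) * ennreal (H (t + h n) - H t)"
        using h(1)[of n] monoD[OF H(1), of t "t + h n"] by (simp add: ennreal_leI flip: ennreal_mult)
    qed
    also have "\<dots> = ennreal (4 / h n) * (\<integral>\<^sup>+t. ennreal (H (t + h n) - H t) \<partial>lborel)"
      by (intro nn_integral_cmult) measurable
    also have "\<dots> \<le> ennreal (4 / h n) * ennreal (h n * (2 * K))"
      by (intro mult_left_mono tonelli) simp
    also have "\<dots> = ennreal (8 * K)"
      using h(1)[of n] K by (simp flip: ennreal_mult)
    finally show "(\<integral>\<^sup>+t. ennreal (((G (t + h n) - G t) / h n)\<^sup>2) \<partial>lborel) \<le> ennreal (8 * K)" .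
  qed
  also have "\<dots> < \<infinity>"
    by (simp add: Liminf_const)
  finally have g2: "(\<integral>\<^sup>+r. ennreal ((g r)\<^sup>2) \<partial>lborel) < \<infinity>" .
  show thesis
    by (rule that[OF gb g(3) nn g2])
qed

text \<open>The primitive is the distribution function of the finite measure with density
  \<open>m\<close>; it is continuous because this measure has no atoms, and bounded as
  \<open>ex_density_of_dominated\<close> and Helly's theorem require.\<close>

lemma ex_primitive:
  fixes m :: "real \<Rightarrow> real"
  assumes [measurable]: "m \<in> borel_measurable borel" and m0: "\<And>r. 0 \<le> m r"
    and fin: "(\<integral>\<^sup>+r. ennreal (m r) \<partial>lborel) < \<infinity>"
  obtains C :: "real \<Rightarrow> real" and K where "mono C" "\<And>x. isCont C x" "\<And>x. \<bar>C x\<bar> \<le> K"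
    "\<And>s t. s \<le> t \<Longrightarrow> (\<integral>\<^sup>+r\<in>{s..t}. ennreal (m r) \<partial>lborel) = ennreal (C t - C s)"
    "\<And>s t. set_integrable lborel {s..t} m"
    "\<And>s t. s \<le> t \<Longrightarrow> C t - C s = (LINT r:{s..t}|lborel. m r)"
    "AE t in lborel. (C has_real_derivative m t) (at t)"
proof -
  define D where "D = density lborel (\<lambda>r. ennreal (m r))"
  have "finite_measure D"
    using fin by (intro finite_measureI) (auto simp: D_def emeasure_density)
  then interpret D: finite_measure D .
  interpret D: finite_borel_measure D
    by standard (simp add: D_def)
  have single: "emeasure D {x} = 0" for x
    by (simp add: D_def emeasure_density)
  have cont: "isCont (cdf D) x" for x
    using single[of x] by (simp add: D.isCont_cdf measure_def)
  have mono: "mono (cdf D)"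
    by (auto simp: mono_def intro: D.cdf_nondecreasing)
  have nn: "(\<integral>\<^sup>+r\<in>{s..t}. ennreal (m r) \<partial>lborel) = ennreal (cdf D t - cdf D s)" if "s \<le> t" for s t
  proof -
    have "(\<integral>\<^sup>+r\<in>{s..t}. ennreal (m r) \<partial>lborel) = (\<integral>\<^sup>+r\<in>{s<..t}. ennreal (m r) \<partial>lborel)"
      using AE_lborel_singleton[of s] by (intro nn_integral_cong_AE) (auto simp: indicator_def)
    also have "\<dots> = emeasure D {s<..t}"
      by (simp add: D_def emeasure_density)
    also have "\<dots> = ennreal (cdf D t - cdf D s)"
    proof (cases "s = t")
      case False
      then have "s < t" using that by simp
      then show ?thesis
        by (simp add: D.cdf_diff_eq D.emeasure_eq_measure)
    qed simp
    finally show ?thesis .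
  qed
  have le: "cdf D s \<le> cdf D t" if "s \<le> t" for s t
    using that mono by (rule monoD[rotated])
  have LI: "set_integrable lborel {s..t} m" for s t
  proof (cases "s \<le> t")
    case True
    from nn_integral_Icc_imp_LINT(1)[OF assms(1) m0 _ nn[OF True]] le[OF True]
    show ?thesis by simp
  qed (simp add: set_integrable_def)
  have LI2: "cdf D t - cdf D s = (LINT r:{s..t}|lborel. m r)" if "s \<le> t" for s t
  proof -
    from nn_integral_Icc_imp_LINT(2)[OF assms(1) m0 _ nn[OF that]] le[OF that]
    show ?thesis by simp
  qed
  have bd: "\<bar>cdf D x\<bar> \<le> measure D UNIV" for x
    using D.cdf_nonneg[of x] D.bounded_measure[of "{..x}"] by (simp add: cdf_def D_def)
  show thesis
    by (rule that[OF mono cont bd nn LI LI2 AE_has_real_derivative_indefinite_integral[OF LI LI2]])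
qed

section \<open>Existence of the metric derivative\<close>

text \<open>The distances from countably many points of the curve are real functions dominated by
  the primitive of \<open>m\<close>, so each of them has a density. The supremum of the absolute
  values of these densities is the metric derivative: it bounds the distance because the chosen
  points are dense in the image, and it is reached by difference quotients because each distance
  function is 1-Lipschitz.\<close>

lemma metric_derivative:
  fixes u :: "real \<Rightarrow> 'a::metric_space" and m :: "real \<Rightarrow> real"
  assumes [measurable]: "m \<in> borel_measurable borel" and m0: "\<And>r. 0 \<le> m r"
    and fin: "(\<integral>\<^sup>+r. ennreal (m r) \<partial>lborel) < \<infinity>" and fin2: "(\<integral>\<^sup>+r. ennreal ((m r)\<^sup>2) \<partial>lborel) < \<infinity>"
    and dist: "\<And>s t. s \<le> t \<Longrightarrow> ennreal (dist (u s) (u t)) \<le> (\<integral>\<^sup>+r\<in>{s..t}. ennreal (m r) \<partial>lborel)"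
  obtains M where "M \<in> borel_measurable borel" "\<And>r. 0 \<le> M r" "\<And>r. M r \<le> m r"
    "\<And>s t. s \<le> t \<Longrightarrow> ennreal (dist (u s) (u t)) \<le> (\<integral>\<^sup>+r\<in>{s..t}. ennreal (M r) \<partial>lborel)"
    "AE t in lborel. ((\<lambda>s. dist (u s) (u t) / \<bar>t - s\<bar>) \<longlongrightarrow> M t) (at t)"
proof -
  obtain C K1 where C: "mono C" "\<And>x. isCont C x" "\<And>x. \<bar>C x\<bar> \<le> K1"
    "\<And>s t. s \<le> t \<Longrightarrow> (\<integral>\<^sup>+r\<in>{s..t}. ennreal (m r) \<partial>lborel) = ennreal (C t - C s)"
    "\<And>s t. set_integrable lborel {s..t} m"
    "\<And>s t. s \<le> t \<Longrightarrow> C t - C s = (LINT r:{s..t}|lborel. m r)"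
    "AE t in lborel. (C has_real_derivative m t) (at t)"
    using ex_primitive[OF assms(1) m0 fin] by blast
  obtain H K2 where H: "mono H" "\<And>x. isCont H x" "\<And>x. \<bar>H x\<bar> \<le> K2"
    "\<And>s t. s \<le> t \<Longrightarrow> (\<integral>\<^sup>+r\<in>{s..t}. ennreal ((m r)\<^sup>2) \<partial>lborel) = ennreal (H t - H s)"
    "\<And>s t. set_integrable lborel {s..t} (\<lambda>r. (m r)\<^sup>2)"
    "\<And>s t. s \<le> t \<Longrightarrow> H t - H s = (LINT r:{s..t}|lborel. (m r)\<^sup>2)"
    "AE t in lborel. (H has_real_derivative (m t)\<^sup>2) (at t)"
    by (rule ex_primitive[OF borel_measurable_power[OF assms(1)] zero_le_power2 fin2]) (rule that)
  have distC: "dist (u s) (u t) \<le> \<bar>C s - C t\<bar>" for s t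
  proof -
    have *: "dist (u s) (u t) \<le> C t - C s" if "s \<le> t" for s t
      using dist[OF that] C(4)[OF that] monoD[OF C(1) that] by simp
    show ?thesis
      using *[of s t] *[of t s] by (cases "s \<le> t") (auto simp: dist_commute)
  qed
  \<comment> \<open>Young's inequality 2 m \<le> l + m^2 / l, integrated. The factor 2 is spent
    below, where the function \<open>C\<close> plus a distance function grows at most twice as fast
    as \<open>C\<close>.\<close>
  have C_H: "2 * (C t - C s) \<le> l * (t - s) + (H t - H s) / l" if "0 < l" "s \<le> t" for l s t
  proof -
    have 1: "2 * m r \<le> l + (m r)\<^sup>2 / l" for r
    proof -
      have "0 \<le> (m r - l)\<^sup>2 / l" using that by simp
      then show ?thesis using that by (simp add: power2_eq_square field_simps)
    qed
    have ci: "set_integrable lborel {s..t} (\<lambda>_. l)"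
      by (intro borel_integrable_atLeastAtMost') simp
    have i1: "set_integrable lborel {s..t} (\<lambda>r. 2 * m r)"
      by (rule set_integrable_mult_right) (rule C(5))
    have i2: "set_integrable lborel {s..t} (\<lambda>r. (m r)\<^sup>2 / l)"
      by (rule set_integrable_divide) (rule H(5))
    have "2 * (C t - C s) = (LINT r:{s..t}|lborel. 2 * m r)"
      using C(6)[OF that(2)] by simp
    also have "\<dots> \<le> (LINT r:{s..t}|lborel. l + (m r)\<^sup>2 / l)"
      by (rule set_integral_mono[OF i1 set_integral_add(1)[OF ci i2] 1])
    also have "\<dots> = (LINT r:{s..t}|lborel. l) + (LINT r:{s..t}|lborel. (m r)\<^sup>2 / l)"
      by (rule set_integral_add(2)[OF ci i2])
    also have "\<dots> = l * (t - s) + (H t - H s) / l"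
      using that H(6)[OF that(2)] by (simp add: set_integral_const)
    finally show ?thesis .
  qed
  have uc: "isCont u x" for x
  proof -
    have "((\<lambda>s. \<bar>C s - C x\<bar>) \<longlongrightarrow> 0) (at x)"
      using C(2)[of x] by (intro tendsto_rabs_zero LIM_zero) (simp add: isCont_def)
    then have "((\<lambda>s. dist (u s) (u x)) \<longlongrightarrow> 0) (at x)"
      by (rule Lim_null_comparison[rotated]) (simp add: distC)
    then show ?thesis
      unfolding isCont_def by (subst tendsto_dist_iff)
  qed
  define q where "q = from_nat_into (\<rat> :: real set)"
  have q: "range q = \<rat>"
    unfolding q_def using countable_rat Rats_0 by (intro range_from_nat_into) auto
  \<comment> \<open>Subtracting the value at time 0 makes \<open>f n\<close> vanish there, hence
    bounded by the variation of \<open>C\<close>, uniformly in \<open>n\<close>.\<close>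
  define f where "f n t = dist (u (q n)) (u t) - dist (u (q n)) (u 0)" for n t
  have fC: "\<bar>f n s - f n t\<bar> \<le> \<bar>C s - C t\<bar>" for n s t
    using distC[of s t] dist_triangle2[of "u (q n)" "u s" "u t"] dist_triangle2[of "u (q n)" "u t" "u s"]
    unfolding f_def by (simp add: dist_commute)
  have fcont: "isCont (f n) x" for n x
    unfolding f_def using uc[of x] by (intro continuous_intros)
  have "\<forall>n. \<exists>g. g \<in> borel_measurable borel \<and> (AE t in lborel. (f n has_real_derivative g t) (at t)) \<and>
     (\<forall>s t. set_integrable lborel {s..t} g) \<and> (\<forall>s t. s \<le> t \<longrightarrow> f n t - f n s = (LINT r:{s..t}|lborel. g r))"
  proof
    fix n
    \<comment> \<open>The density lemma asks for a monotone function: \<open>C\<close> dominates the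
      variation of \<open>f n\<close>, so the sum is monotone, and the density \<open>m\<close> of
      \<open>C\<close> is subtracted again afterwards.\<close>
    define G where "G t = C t + f n t" for t
    have G: "mono G"
    proof (rule monoI)
      fix x y :: real assume "x \<le> y"
      then show "G x \<le> G y"
        using fC[of n x y] monoD[OF C(1) \<open>x \<le> y\<close>] by (simp add: G_def)
    qed
    have Gc: "isCont G x" for x
      unfolding G_def using C(2) fcont by (intro continuous_intros)
    have Gb: "\<bar>G x\<bar> \<le> max (3 * K1) K2" for x
    proof -
      have "f n 0 = 0" by (simp add: f_def)
      then show ?thesis
        using fC[of n x 0] C(3)[of x] C(3)[of 0] by (simp add: G_def)
    qed
    have Hb: "\<bar>H x\<bar> \<le> max (3 * K1) K2" for x
      using H(3)[of x] by simp
    have dom: "G t - G s \<le> l * (t - s) + (H t - H s) / l" if "0 < l" "s \<le> t" for l s t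
      using C_H[OF that] fC[of n s t] monoD[OF C(1) that(2)] by (simp add: G_def)
    obtain g where g: "g \<in> borel_measurable borel" "\<And>t. 0 \<le> g t"
      "\<And>s t. s \<le> t \<Longrightarrow> (\<integral>\<^sup>+r\<in>{s..t}. ennreal (g r) \<partial>lborel) = ennreal (G t - G s)"
      "(\<integral>\<^sup>+r. ennreal ((g r)\<^sup>2) \<partial>lborel) < \<infinity>"
      by (rule ex_density_of_dominated[OF G continuous_at_imp_continuous_at_within[OF Gc] Gb H(1)
          continuous_at_imp_continuous_at_within[OF H(2)] Hb dom]) (assumption | rule that)+
    have gi: "set_integrable lborel {s..t} g" "s \<le> t \<Longrightarrow> G t - G s = (LINT r:{s..t}|lborel. g r)" for s t
    proof -
      show "G t - G s = (LINT r:{s..t}|lborel. g r)" if "s \<le> t"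
        using nn_integral_Icc_imp_LINT(2)[OF g(1,2) _ g(3)[OF that]] monoD[OF G that] by simp
      show "set_integrable lborel {s..t} g"
      proof (cases "s \<le> t")
        case True
        then show ?thesis
          using nn_integral_Icc_imp_LINT(1)[OF g(1,2) _ g(3)[OF True]] monoD[OF G True] by simp
      qed (simp add: set_integrable_def)
    qed
    have hi: "set_integrable lborel {s..t} (\<lambda>r. g r - m r)" for s t
      using gi(1) C(5) by (intro set_integral_diff)
    have hl: "f n t - f n s = (LINT r:{s..t}|lborel. g r - m r)" if "s \<le> t" for s t
      using gi(2)[OF that] C(6)[OF that] set_integral_diff(2)[OF gi(1) C(5), of s t] by (simp add: G_def)
    show "\<exists>g. g \<in> borel_measurable borel \<and> (AE t in lborel. (f n has_real_derivative g t) (at t)) \<and>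
        (\<forall>s t. set_integrable lborel {s..t} g) \<and> (\<forall>s t. s \<le> t \<longrightarrow> f n t - f n s = (LINT r:{s..t}|lborel. g r))"
      using AE_has_real_derivative_indefinite_integral[OF hi hl] hi hl g(1)
      by (intro exI[of _ "\<lambda>r. g r - m r"]) auto
  qed
  from choice[OF this] obtain g where gg: "\<forall>n. g n \<in> borel_measurable borel \<and>
     (AE t in lborel. (f n has_real_derivative g n t) (at t)) \<and>
     (\<forall>s t. set_integrable lborel {s..t} (g n)) \<and>
     (\<forall>s t. s \<le> t \<longrightarrow> f n t - f n s = (LINT r:{s..t}|lborel. g n r))"
    by (elim exE)
  note g = gg[THEN spec, THEN conjunct1] gg[THEN spec, THEN conjunct2, THEN conjunct1]
    gg[THEN spec, THEN conjunct2, THEN conjunct2, THEN conjunct1, THEN spec, THEN spec]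
    gg[THEN spec, THEN conjunct2, THEN conjunct2, THEN conjunct2, THEN spec, THEN spec, THEN mp]
  note [measurable] = g(1)
  have gm: "AE t in lborel. \<forall>n. \<bar>g n t\<bar> \<le> m t"
    unfolding AE_all_countable
  proof
    fix n
    show "AE t in lborel. \<bar>g n t\<bar> \<le> m t"
      using g(2)[of n] C(7)
    proof eventually_elim
      case (elim t)
      have "((\<lambda>s. \<bar>(C s - C t) / (s - t)\<bar>) \<longlongrightarrow> \<bar>m t\<bar>) (at t)"
        using elim(2) unfolding has_field_derivative_iff by (intro tendsto_intros)
      moreover have "((\<lambda>s. \<bar>(f n s - f n t) / (s - t)\<bar>) \<longlongrightarrow> \<bar>g n t\<bar>) (at t)"
        using elim(1) unfolding has_field_derivative_iff by (intro tendsto_intros)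
      ultimately have "\<bar>g n t\<bar> \<le> \<bar>m t\<bar>"
        by (rule tendsto_le[OF at_neq_bot]) (auto simp: abs_divide intro!: always_eventually divide_right_mono fC)
      then show ?case
        using m0[of t] by simp
    qed
  qed
  \<comment> \<open>Almost everywhere the truncation by \<open>m\<close> changes nothing; it makes
    the supremum finite and \<open>M \<le> m\<close> valid at every point.\<close>
  define M where "M t = (SUP n. min (m t) \<bar>g n t\<bar>)" for t
  have bdd: "bdd_above (range (\<lambda>n. min (m t) \<bar>g n t\<bar>))" for t
    by (rule bdd_aboveI[of _ "m t"]) auto
  have [measurable]: "M \<in> borel_measurable borel"
    unfolding M_def by (rule borel_measurable_cSUP) (auto simp: bdd)
  have M0: "0 \<le> M t" for t
    unfolding M_def by (rule cSUP_upper2[OF bdd, of 0]) (auto simp: m0)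
  have Mm: "M t \<le> m t" for t
    unfolding M_def by (rule cSUP_least) auto
  have gM: "AE t in lborel. \<forall>n. \<bar>g n t\<bar> \<le> M t"
    using gm
  proof eventually_elim
    case (elim t)
    show ?case
    proof
      fix n
      have "\<bar>g n t\<bar> = min (m t) \<bar>g n t\<bar>"
        using elim by (simp add: min.absorb2)
      also have "\<dots> \<le> M t"
        unfolding M_def by (rule cSUP_upper[OF UNIV_I bdd])
      finally show "\<bar>g n t\<bar> \<le> M t" .
    qed
  qed
  have "(\<integral>\<^sup>+r. ennreal (M r) \<partial>lborel) \<le> (\<integral>\<^sup>+r. ennreal (m r) \<partial>lborel)"
    by (intro nn_integral_mono ennreal_leI Mm)
  then have Mfin: "(\<integral>\<^sup>+r. ennreal (M r) \<partial>lborel) < \<infinity>"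
    using fin by (rule le_less_trans)
  obtain L K3 where L: "mono L" "\<And>x. isCont L x" "\<And>x. \<bar>L x\<bar> \<le> K3"
    "\<And>s t. s \<le> t \<Longrightarrow> (\<integral>\<^sup>+r\<in>{s..t}. ennreal (M r) \<partial>lborel) = ennreal (L t - L s)"
    "\<And>s t. set_integrable lborel {s..t} M"
    "\<And>s t. s \<le> t \<Longrightarrow> L t - L s = (LINT r:{s..t}|lborel. M r)"
    "AE t in lborel. (L has_real_derivative M t) (at t)"
    using ex_primitive[OF \<open>M \<in> borel_measurable borel\<close> M0 Mfin] by blast
  have fL: "\<bar>f n t - f n s\<bar> \<le> L t - L s" if "s \<le> t" for n s t
  proof -
    have "\<bar>f n t - f n s\<bar> = \<bar>LINT r:{s..t}|lborel. g n r\<bar>"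
      using g(4)[OF that] by simp
    also have "\<dots> \<le> (LINT r:{s..t}|lborel. \<bar>g n r\<bar>)"
      using set_integral_norm_bound[OF g(3)[of s t n]] by simp
    also have "\<dots> \<le> (LINT r:{s..t}|lborel. M r)"
      using gM by (intro set_integral_mono_AE set_integrable_abs g L) (auto elim: eventually_mono)
    finally show ?thesis
      using L(6)[OF that] by simp
  qed
  \<comment> \<open>At a time \<open>q n\<close> close to s the increment of \<open>f n\<close> from
    s to t is the distance from \<open>u s\<close> to \<open>u t\<close> up to twice the distance
    from \<open>u (q n)\<close> to \<open>u s\<close>, which continuity makes small.\<close>
  have distL: "dist (u s) (u t) \<le> \<bar>L s - L t\<bar>" for s t
  proof -
    have *: "dist (u s) (u t) \<le> L t - L s" if "s \<le> t" for s t
    proof (rule field_le_epsilon)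
      fix e :: real assume "0 < e"
      then obtain d where d: "d > 0" "\<And>x. dist x s < d \<Longrightarrow> dist (u x) (u s) < e / 2"
        using uc[of s] unfolding continuous_at_eps_delta by (metis half_gt_zero)
      obtain x where x: "x \<in> \<rat>" "s < x" "x < s + d"
        using Rats_dense_in_real[of s "s + d"] d(1) by auto
      then obtain n where n: "x = q n"
        using q by (metis rangeE)
      have "dist (u (q n)) (u s) < e / 2"
        using d(2)[of x] x n by (simp add: dist_real_def)
      moreover have "dist (u s) (u t) \<le> dist (u (q n)) (u s) + dist (u (q n)) (u t)"
        by (metis dist_commute dist_triangle)
      ultimately show "dist (u s) (u t) \<le> L t - L s + e"
        using fL[OF that, of n] unfolding f_def by linarith
    qed
    show ?thesis
      using *[of s t] *[of t s] by (cases "s \<le> t") (auto simp: dist_commute)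
  qed
  \<comment> \<open>A squeeze: \<open>distL\<close> and the derivative of \<open>L\<close> bound the
    quotients from above; from below, the reverse triangle inequality compares them with the
    quotients of an \<open>f n\<close> whose density nearly attains the supremum.\<close>
  have lim: "AE t in lborel. ((\<lambda>s. dist (u s) (u t) / \<bar>t - s\<bar>) \<longlongrightarrow> M t) (at t)"
  proof -
    have "AE t in lborel. \<forall>n. (f n has_real_derivative g n t) (at t)"
      using g(2) by (simp add: AE_all_countable)
    with gm L(7) show ?thesis
    proof eventually_elim
      case (elim t)
      have up: "((\<lambda>s. \<bar>(L s - L t) / (s - t)\<bar>) \<longlongrightarrow> M t) (at t)"
        using tendsto_rabs[OF elim(2)[unfolded has_field_derivative_iff]] M0[of t] by simp
      show ?case
      proof (rule order_tendstoI)
        fix a assume "M t < a"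
        with up have "\<forall>\<^sub>F s in at t. \<bar>(L s - L t) / (s - t)\<bar> < a"
          by (rule order_tendstoD)
        then show "\<forall>\<^sub>F s in at t. dist (u s) (u t) / \<bar>t - s\<bar> < a"
        proof eventually_elim
          case (elim s)
          have "dist (u s) (u t) / \<bar>t - s\<bar> \<le> \<bar>L s - L t\<bar> / \<bar>s - t\<bar>"
            using distL[of s t] by (simp add: abs_minus_commute divide_right_mono)
          with elim show ?case
            by (simp add: abs_divide)
        qed
      next
        fix a assume "a < M t"
        then obtain n where n: "a < min (m t) \<bar>g n t\<bar>"
          unfolding M_def using less_cSUP_iff[OF _ bdd] by auto
        have "((\<lambda>s. \<bar>(f n s - f n t) / (s - t)\<bar>) \<longlongrightarrow> \<bar>g n t\<bar>) (at t)"
          using elim(3) unfolding has_field_derivative_iff by (intro tendsto_intros) auto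
        moreover have "a < \<bar>g n t\<bar>"
          using n by simp
        ultimately have "\<forall>\<^sub>F s in at t. a < \<bar>(f n s - f n t) / (s - t)\<bar>"
          by (rule order_tendstoD)
        then show "\<forall>\<^sub>F s in at t. a < dist (u s) (u t) / \<bar>t - s\<bar>"
        proof eventually_elim
          case (elim s)
          have "\<bar>f n s - f n t\<bar> \<le> dist (u s) (u t)"
            unfolding f_def using abs_dist_diff_le[of "u s" "u (q n)" "u t"] by (simp add: dist_commute)
          then have "\<bar>f n s - f n t\<bar> / \<bar>s - t\<bar> \<le> dist (u s) (u t) / \<bar>t - s\<bar>"
            by (simp add: abs_minus_commute divide_right_mono)
          with elim show ?case
            by (simp add: abs_divide)
        qed
      qed
    qed
  qed
  have final: "ennreal (dist (u s) (u t)) \<le> (\<integral>\<^sup>+r\<in>{s..t}. ennreal (M r) \<partial>lborel)" if "s \<le> t" for s t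
    using distL[of s t] monoD[OF L(1) that] by (simp add: L(4)[OF that] ennreal_leI)
  show thesis
    by (rule that[OF \<open>M \<in> borel_measurable borel\<close> M0 Mm final lim])
qed

section \<open>Curves with a locally square integrable speed\<close>

text \<open>\<open>M\<close> is a Borel representative of the metric derivative on positive times,
  defined and nonnegative everywhere and locally square integrable. \<open>metric_deriv\<close>
  itself is a \<open>Lim\<close> whose value is unspecified where the limit fails, so integrals are
  taken of \<open>M\<close> and translated back almost everywhere. Nothing is said about negative
  times.\<close>

definition has_speed :: "(real \<Rightarrow> 'a::metric_space) \<Rightarrow> (real \<Rightarrow> real) \<Rightarrow> bool" where
  "has_speed u M \<longleftrightarrow> M \<in> borel_measurable borel \<and> (\<forall>t. 0 \<le> M t) \<and>
     (\<forall>T. (\<integral>\<^sup>+r\<in>{0..T}. ennreal ((M r)\<^sup>2) \<partial>lborel) < \<infinity>) \<and>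
     (\<forall>s t. 0 \<le> s \<longrightarrow> s \<le> t \<longrightarrow> ennreal (dist (u s) (u t)) \<le> (\<integral>\<^sup>+r\<in>{s..t}. ennreal (M r) \<partial>lborel)) \<and>
     (AE t in lborel. 0 < t \<longrightarrow> ((\<lambda>s. dist (u s) (u t) / \<bar>t - s\<bar>) \<longlongrightarrow> M t) (at t))"

lemma has_speedD:
  assumes "has_speed u M"
  shows "M \<in> borel_measurable borel" "0 \<le> M t"
    "(\<integral>\<^sup>+r\<in>{0..T}. ennreal ((M r)\<^sup>2) \<partial>lborel) < \<infinity>"
    "0 \<le> s \<Longrightarrow> s \<le> t \<Longrightarrow> ennreal (dist (u s) (u t)) \<le> (\<integral>\<^sup>+r\<in>{s..t}. ennreal (M r) \<partial>lborel)"
    "AE t in lborel. 0 < t \<longrightarrow> ((\<lambda>s. dist (u s) (u t) / \<bar>t - s\<bar>) \<longlongrightarrow> M t) (at t)"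
  using assms unfolding has_speed_def by auto

lemma Cauchy_Schwarz_Icc:
  fixes m :: "real \<Rightarrow> real"
  assumes [measurable]: "m \<in> borel_measurable borel" and m0: "\<And>r. 0 \<le> m r" and "s \<le> t"
  shows "(\<integral>\<^sup>+r\<in>{s..t}. ennreal (m r) \<partial>lborel)\<^sup>2
    \<le> ennreal (t - s) * (\<integral>\<^sup>+r\<in>{s..t}. ennreal ((m r)\<^sup>2) \<partial>lborel)"
proof -
  have eq1: "(\<integral>\<^sup>+r\<in>{s..t}. ennreal (m r) \<partial>lborel)
      = (\<integral>\<^sup>+r. indicator {s..t} r * (ennreal (m r) * indicator {s..t} r) \<partial>lborel)"
    by (intro nn_integral_cong) (auto simp: indicator_def)
  have eq2: "(\<integral>\<^sup>+r. (ennreal (m r) * indicator {s..t} r)\<^sup>2 \<partial>lborel)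
      = (\<integral>\<^sup>+r\<in>{s..t}. ennreal ((m r)\<^sup>2) \<partial>lborel)"
    using m0 by (intro nn_integral_cong) (auto simp: indicator_def ennreal_power)
  have eq3: "(\<integral>\<^sup>+r. (indicator {s..t} r)\<^sup>2 \<partial>lborel) = ennreal (t - s)"
  proof -
    have "(\<integral>\<^sup>+r. (indicator {s..t} r :: ennreal)\<^sup>2 \<partial>lborel) = (\<integral>\<^sup>+r. indicator {s..t} r \<partial>lborel)"
      by (intro nn_integral_cong) (auto simp: indicator_def)
    then show ?thesis
      using \<open>s \<le> t\<close> by simp
  qed
  show ?thesis
    unfolding eq1
    by (rule order_trans[OF Cauchy_Schwarz_nn_integral]) (auto simp: eq2 eq3)
qed

lemma nn_integral_Icc_finite_of_square:
  fixes m :: "real \<Rightarrow> real"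
  assumes "m \<in> borel_measurable borel" "\<And>r. 0 \<le> m r"
    and fin: "(\<integral>\<^sup>+r\<in>{s..t}. ennreal ((m r)\<^sup>2) \<partial>lborel) < \<infinity>"
  shows "(\<integral>\<^sup>+r\<in>{s..t}. ennreal (m r) \<partial>lborel) < \<infinity>"
proof (cases "s \<le> t")
  case True
  have "(\<integral>\<^sup>+r\<in>{s..t}. ennreal (m r) \<partial>lborel)\<^sup>2 < \<infinity>"
    by (rule le_less_trans[OF Cauchy_Schwarz_Icc[OF assms(1,2) True]])
      (use fin in \<open>simp add: ennreal_mult_less_top\<close>)
  then show ?thesis
    by (simp add: power_less_top_ennreal)
qed simp

lemma has_speed_dist_square:
  assumes "has_speed u M" "0 \<le> s" "s \<le> t"
  shows "ennreal ((dist (u s) (u t))\<^sup>2) \<le> ennreal (t - s) * (\<integral>\<^sup>+r\<in>{s..t}. ennreal ((M r)\<^sup>2) \<partial>lborel)"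
proof -
  have "ennreal ((dist (u s) (u t))\<^sup>2) = (ennreal (dist (u s) (u t)))\<^sup>2"
    by (simp add: ennreal_power)
  also have "\<dots> \<le> (\<integral>\<^sup>+r\<in>{s..t}. ennreal (M r) \<partial>lborel)\<^sup>2"
    by (intro power_mono has_speedD(4)[OF assms]) simp
  also have "\<dots> \<le> ennreal (t - s) * (\<integral>\<^sup>+r\<in>{s..t}. ennreal ((M r)\<^sup>2) \<partial>lborel)"
    by (intro Cauchy_Schwarz_Icc has_speedD[OF assms(1)] assms)
  finally show ?thesis .
qed

lemma eventually_at_real_within_open:
  fixes t :: real
  assumes "a < t" "t < b"
  shows "\<forall>\<^sub>F s in at t. a < s \<and> s < b"
  using assms by (intro eventually_conj order_tendstoD[OF tendsto_ident_at])

text \<open>The bounds \<open>m n\<close> may be unrelated for different \<open>n\<close>: the limits of the difference quotients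
  single out one function.\<close>

lemma ex_has_speed:
  fixes u :: "real \<Rightarrow> 'a::metric_space" and m :: "nat \<Rightarrow> real \<Rightarrow> real"
  assumes m_meas [measurable]: "\<And>n. m n \<in> borel_measurable borel" and m0: "\<And>n r. 0 \<le> m n r"
    and fin: "\<And>n. (\<integral>\<^sup>+r\<in>{0..real n}. ennreal ((m n r)\<^sup>2) \<partial>lborel) < \<infinity>"
    and dist: "\<And>n s t. 0 \<le> s \<Longrightarrow> s \<le> t \<Longrightarrow> t \<le> real n \<Longrightarrow>
      ennreal (dist (u s) (u t)) \<le> (\<integral>\<^sup>+r\<in>{s..t}. ennreal (m n r) \<partial>lborel)"
  obtains M where "has_speed u M" "\<And>t. M t \<le> m (Suc (nat \<lceil>t\<rceil>)) t"
proof -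
  have "\<exists>M. M \<in> borel_measurable borel \<and> (\<forall>r. 0 \<le> M r) \<and> (\<forall>r. M r \<le> m n r * indicator {0..real n} r) \<and>
      (\<forall>s t. 0 \<le> s \<longrightarrow> s \<le> t \<longrightarrow> t \<le> real n \<longrightarrow> ennreal (dist (u s) (u t)) \<le> (\<integral>\<^sup>+r\<in>{s..t}. ennreal (M r) \<partial>lborel)) \<and>
      (AE t in lborel. 0 < t \<and> t < real n \<longrightarrow> ((\<lambda>s. dist (u s) (u t) / \<bar>t - s\<bar>) \<longlongrightarrow> M t) (at t))" for n
  proof -
    \<comment> \<open>The curve is frozen outside {0..n}, since \<open>metric_derivative\<close>
      concerns curves on the whole line.\<close>
    define v where "v t = u (max 0 (min t (real n)))" for t
    define b where "b r = m n r * indicator {0..real n} r" for r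
    have [measurable]: "b \<in> borel_measurable borel"
      unfolding b_def by measurable
    have b0: "0 \<le> b r" for r
      unfolding b_def by (simp add: m0)
    have bsq: "(\<integral>\<^sup>+r. ennreal ((b r)\<^sup>2) \<partial>lborel) = (\<integral>\<^sup>+r\<in>{0..real n}. ennreal ((m n r)\<^sup>2) \<partial>lborel)"
      by (intro nn_integral_cong) (auto simp: b_def indicator_def)
    have b1: "(\<integral>\<^sup>+r. ennreal (b r) \<partial>lborel) = (\<integral>\<^sup>+r\<in>{0..real n}. ennreal (m n r) \<partial>lborel)"
      by (intro nn_integral_cong) (auto simp: b_def indicator_def)
    have bfin: "(\<integral>\<^sup>+r. ennreal (b r) \<partial>lborel) < \<infinity>"
      unfolding b1 by (rule nn_integral_Icc_finite_of_square[OF m_meas m0 fin])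
    have bfin2: "(\<integral>\<^sup>+r. ennreal ((b r)\<^sup>2) \<partial>lborel) < \<infinity>"
      unfolding bsq by (rule fin)
    have vdist: "ennreal (dist (v s) (v t)) \<le> (\<integral>\<^sup>+r\<in>{s..t}. ennreal (b r) \<partial>lborel)" if "s \<le> t" for s t
    proof (cases "s < real n \<and> 0 < t")
      case True
      define s' t' where "s' = max 0 (min s (real n))" and "t' = max 0 (min t (real n))"
      have "ennreal (dist (v s) (v t)) \<le> (\<integral>\<^sup>+r\<in>{s'..t'}. ennreal (m n r) \<partial>lborel)"
        unfolding v_def s'_def[symmetric] t'_def[symmetric]
        using that by (intro dist) (auto simp: s'_def t'_def)
      also have "\<dots> \<le> (\<integral>\<^sup>+r\<in>{s..t}. ennreal (b r) \<partial>lborel)"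
        using True by (intro nn_integral_mono) (auto simp: b_def indicator_def s'_def t'_def)
      finally show ?thesis .
    next
      case False
      then have "v s = v t"
        using that unfolding v_def by (intro arg_cong[where f = u]) auto
      then show ?thesis by simp
    qed
    obtain M where M: "M \<in> borel_measurable borel" "\<And>r. 0 \<le> M r" "\<And>r. M r \<le> b r"
      "\<And>s t. s \<le> t \<Longrightarrow> ennreal (dist (v s) (v t)) \<le> (\<integral>\<^sup>+r\<in>{s..t}. ennreal (M r) \<partial>lborel)"
      "AE t in lborel. ((\<lambda>s. dist (v s) (v t) / \<bar>t - s\<bar>) \<longlongrightarrow> M t) (at t)"
      by (rule metric_derivative[OF \<open>b \<in> borel_measurable borel\<close> b0 bfin bfin2 vdist]) (assumption | rule that)+
    have 1: "ennreal (dist (u s) (u t)) \<le> (\<integral>\<^sup>+r\<in>{s..t}. ennreal (M r) \<partial>lborel)"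
      if "0 \<le> s" "s \<le> t" "t \<le> real n" for s t
      using M(4)[OF that(2)] that by (simp add: v_def)
    have 2: "AE t in lborel. 0 < t \<and> t < real n \<longrightarrow> ((\<lambda>s. dist (u s) (u t) / \<bar>t - s\<bar>) \<longlongrightarrow> M t) (at t)"
      using M(5)
    proof eventually_elim
      case (elim t)
      show ?case
      proof
        assume t: "0 < t \<and> t < real n"
        then have "\<forall>\<^sub>F s in at t. 0 < s \<and> s < real n"
          by (intro eventually_at_real_within_open) auto
        then have "\<forall>\<^sub>F s in at t. dist (v s) (v t) / \<bar>t - s\<bar> = dist (u s) (u t) / \<bar>t - s\<bar>"
          by eventually_elim (use t in \<open>simp add: v_def\<close>)
        with elim show "((\<lambda>s. dist (u s) (u t) / \<bar>t - s\<bar>) \<longlongrightarrow> M t) (at t)"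
          by (rule Lim_transform_eventually)
      qed
    qed
    show ?thesis
      using M(1,2) 1 2 M(3)[unfolded b_def] by (intro exI[of _ M]) simp
  qed
  then have "\<forall>n. \<exists>M. M \<in> borel_measurable borel \<and> (\<forall>r. 0 \<le> M r) \<and> (\<forall>r. M r \<le> m n r * indicator {0..real n} r) \<and>
      (\<forall>s t. 0 \<le> s \<longrightarrow> s \<le> t \<longrightarrow> t \<le> real n \<longrightarrow> ennreal (dist (u s) (u t)) \<le> (\<integral>\<^sup>+r\<in>{s..t}. ennreal (M r) \<partial>lborel)) \<and>
      (AE t in lborel. 0 < t \<and> t < real n \<longrightarrow> ((\<lambda>s. dist (u s) (u t) / \<bar>t - s\<bar>) \<longlongrightarrow> M t) (at t))"
    by (rule allI)
  from choice[OF this] obtain M where MM: "\<forall>n. M n \<in> borel_measurable borel \<and> (\<forall>r. 0 \<le> M n r) \<and>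
      (\<forall>r. M n r \<le> m n r * indicator {0..real n} r) \<and>
      (\<forall>s t. 0 \<le> s \<longrightarrow> s \<le> t \<longrightarrow> t \<le> real n \<longrightarrow> ennreal (dist (u s) (u t)) \<le> (\<integral>\<^sup>+r\<in>{s..t}. ennreal (M n r) \<partial>lborel)) \<and>
      (AE t in lborel. 0 < t \<and> t < real n \<longrightarrow> ((\<lambda>s. dist (u s) (u t) / \<bar>t - s\<bar>) \<longlongrightarrow> M n t) (at t))"
    by (elim exE)
  have M_meas [measurable]: "M n \<in> borel_measurable borel" for n
    using MM by simp
  have M0: "0 \<le> M n r" and Mm: "M n r \<le> m n r * indicator {0..real n} r" for n r
    using MM by simp_all
  have Md: "ennreal (dist (u s) (u t)) \<le> (\<integral>\<^sup>+r\<in>{s..t}. ennreal (M n r) \<partial>lborel)"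
    if "0 \<le> s" "s \<le> t" "t \<le> real n" for n s t
    using MM that by simp
  have Ml: "AE t in lborel. \<forall>n. 0 < t \<and> t < real n \<longrightarrow> ((\<lambda>s. dist (u s) (u t) / \<bar>t - s\<bar>) \<longlongrightarrow> M n t) (at t)"
    unfolding AE_all_countable using MM by simp
  \<comment> \<open>The index must exceed t strictly, because the limit for index n is known only at
    t < n; at an integer t the ceiling alone would not do.\<close>
  define L where "L t = M (Suc (nat \<lceil>t\<rceil>)) t" for t
  have [measurable]: "L \<in> borel_measurable borel"
    unfolding L_def by measurable
  have L0: "0 \<le> L t" for t
    by (simp add: L_def M0)
  have Llim: "AE t in lborel. 0 < t \<longrightarrow> ((\<lambda>s. dist (u s) (u t) / \<bar>t - s\<bar>) \<longlongrightarrow> L t) (at t)"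
    using Ml
  proof eventually_elim
    case (elim t)
    have "t < real (Suc (nat \<lceil>t\<rceil>))"
      by linarith
    with elim show ?case
      unfolding L_def by blast
  qed
  have LM: "AE t in lborel. 0 < t \<and> t < real n \<longrightarrow> L t = M n t" for n
    using Ml Llim
  proof eventually_elim
    case (elim t)
    then show ?case
      using tendsto_unique[OF at_neq_bot] by blast
  qed
  have LM': "AE t in lborel. t \<in> {0..real n} \<longrightarrow> L t = M n t" for n
    using LM[of n] AE_lborel_singleton[of 0] AE_lborel_singleton[of "real n"]
    by eventually_elim auto
  have Lfin: "(\<integral>\<^sup>+r\<in>{0..T}. ennreal ((L r)\<^sup>2) \<partial>lborel) < \<infinity>" for T
  proof -
    define n where "n = nat \<lceil>T\<rceil>"
    have "(\<integral>\<^sup>+r\<in>{0..T}. ennreal ((L r)\<^sup>2) \<partial>lborel) \<le> (\<integral>\<^sup>+r\<in>{0..real n}. ennreal ((m n r)\<^sup>2) \<partial>lborel)"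
    proof (rule nn_integral_mono_AE)
      show "AE r in lborel. ennreal ((L r)\<^sup>2) * indicator {0..T} r \<le> ennreal ((m n r)\<^sup>2) * indicator {0..real n} r"
        using LM'[of n]
      proof eventually_elim
        case (elim r)
        show ?case
        proof (cases "r \<in> {0..T}")
          case True
          then have r: "r \<in> {0..real n}"
            unfolding n_def by auto linarith
          then have "L r = M n r" using elim by simp
          then have "(L r)\<^sup>2 \<le> (m n r)\<^sup>2"
            using Mm[of n r] M0[of n r] r by (intro power_mono) auto
          then show ?thesis
            using r True by (simp add: ennreal_leI del: atLeastAtMost_iff)
        qed simp
      qed
    qed
    also have "\<dots> < \<infinity>" by (rule fin)
    finally show ?thesis .
  qed
  have Ld: "ennreal (dist (u s) (u t)) \<le> (\<integral>\<^sup>+r\<in>{s..t}. ennreal (L r) \<partial>lborel)" if "0 \<le> s" "s \<le> t" for s t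
  proof -
    define n where "n = nat \<lceil>t\<rceil>"
    have t: "t \<le> real n"
      unfolding n_def by linarith
    have "ennreal (dist (u s) (u t)) \<le> (\<integral>\<^sup>+r\<in>{s..t}. ennreal (M n r) \<partial>lborel)"
      by (rule Md[OF that t])
    also have "\<dots> = (\<integral>\<^sup>+r\<in>{s..t}. ennreal (L r) \<partial>lborel)"
    proof (rule nn_integral_cong_AE)
      show "AE r in lborel. ennreal (M n r) * indicator {s..t} r = ennreal (L r) * indicator {s..t} r"
        using LM'[of n] by eventually_elim (use that t in \<open>auto simp: indicator_def\<close>)
    qed
    finally show ?thesis .
  qed
  have "has_speed u L"
    unfolding has_speed_def using L0 Lfin Ld Llim by simp
  moreover have "L t \<le> m (Suc (nat \<lceil>t\<rceil>)) t" for t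
    unfolding L_def using Mm[of "Suc (nat \<lceil>t\<rceil>)" t] m0[of "Suc (nat \<lceil>t\<rceil>)" t]
    by (auto simp: indicator_def of_bool_def split: if_splits)
  ultimately show thesis
    by (rule that)
qed

text \<open>If \<open>f\<close> is not integrable, the left-hand side is the default value 0. This
  matters for \<open>AC\<close>, whose bound is a Bochner integral of a function of arbitrary
  sign.\<close>

lemma ennreal_LINT_le_nn_integral:
  fixes f :: "'b \<Rightarrow> real"
  shows "ennreal (integral\<^sup>L M f) \<le> (\<integral>\<^sup>+x. ennreal \<bar>f x\<bar> \<partial>M)"
proof (cases "integrable M f")
  case True
  have "ennreal (integral\<^sup>L M f) \<le> ennreal (\<integral>x. \<bar>f x\<bar> \<partial>M)"
    using True by (intro ennreal_leI integral_mono) auto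
  also have "\<dots> = (\<integral>\<^sup>+x. ennreal \<bar>f x\<bar> \<partial>M)"
    using True by (intro nn_integral_eq_integral[symmetric]) auto
  finally show ?thesis .
qed (simp add: not_integrable_integral_eq)

text \<open>The bounds in \<open>AC_loc\<close> are Lebesgue measurable, depend on the interval and
  may be negative. Absolute values of almost everywhere equal Borel functions are passed to
  \<open>ex_has_speed\<close>, which removes the dependence on the interval.\<close>

lemma AC_loc_2_imp_has_speed:
  fixes u :: "real \<Rightarrow> 'a::metric_space"
  assumes "AC_loc 2 {0..} u"
  obtains M where "has_speed u M"
proof -
  have "\<exists>b. b \<in> borel_measurable borel \<and> (\<forall>r. 0 \<le> b r) \<and>
      (\<integral>\<^sup>+r\<in>{0..real n}. ennreal ((b r)\<^sup>2) \<partial>lborel) < \<infinity> \<and>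
      (\<forall>s t. 0 \<le> s \<longrightarrow> s \<le> t \<longrightarrow> t \<le> real n \<longrightarrow>
        ennreal (dist (u s) (u t)) \<le> (\<integral>\<^sup>+r\<in>{s..t}. ennreal (b r) \<partial>lborel))" for n
  proof -
    have "AC 2 {0..real n} u"
      using assms by (auto simp: AC_loc_def)
    then obtain m :: "real \<Rightarrow> real" where m: "in_Lp 2 (lebesgue_on {0..real n}) (\<lambda>r. ereal (m r))"
      and d: "\<And>s t. 0 \<le> s \<Longrightarrow> s \<le> t \<Longrightarrow> t \<le> real n \<Longrightarrow> dist (u s) (u t) \<le> (LINT r:{s..t}|lebesgue. m r)"
      unfolding AC_def by auto
    have meas: "m \<in> borel_measurable (lebesgue_on {0..real n})"
      using m unfolding in_Lp_def by (auto simp: borel_measurable_ereal_iff)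
    have sq: "(\<integral>\<^sup>+x. ennreal (\<bar>m x\<bar> powr 2) \<partial>lebesgue_on {0..real n}) < \<infinity>"
      using m unfolding in_Lp_def by simp
    have "(\<lambda>x. if x \<in> {0..real n} then m x else 0) \<in> borel_measurable lebesgue"
      by (rule borel_measurable_if_I[OF meas]) simp
    from completion_ex_borel_measurable_real[OF this] obtain g where
      g: "g \<in> borel_measurable lborel" "AE x in lborel. (if x \<in> {0..real n} then m x else 0) = g x"
      by blast
    define b where "b x = \<bar>g x\<bar>" for x
    have [measurable]: "b \<in> borel_measurable borel"
      using g(1) unfolding b_def by simp
    have "(\<integral>\<^sup>+x. ennreal (\<bar>m x\<bar> powr 2) \<partial>lebesgue_on {0..real n})
        = (\<integral>\<^sup>+x\<in>{0..real n}. ennreal (\<bar>m x\<bar> powr 2) \<partial>lborel)"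
      by (subst nn_integral_restrict_space) (auto simp: nn_integral_completion)
    also have "\<dots> = (\<integral>\<^sup>+r\<in>{0..real n}. ennreal ((b r)\<^sup>2) \<partial>lborel)"
      using g(2) by (intro nn_integral_cong_AE) (auto elim!: eventually_mono simp: b_def indicator_def)
    finally have bfin: "(\<integral>\<^sup>+r\<in>{0..real n}. ennreal ((b r)\<^sup>2) \<partial>lborel) < \<infinity>"
      using sq by simp
    have bd: "ennreal (dist (u s) (u t)) \<le> (\<integral>\<^sup>+r\<in>{s..t}. ennreal (b r) \<partial>lborel)"
      if st: "0 \<le> s" "s \<le> t" "t \<le> real n" for s t
    proof -
      have "ennreal (dist (u s) (u t)) \<le> ennreal (LINT r:{s..t}|lebesgue. m r)"
        by (intro ennreal_leI d st)
      also have "\<dots> \<le> (\<integral>\<^sup>+r. ennreal \<bar>indicator {s..t} r *\<^sub>R m r\<bar> \<partial>lebesgue)"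
        unfolding set_lebesgue_integral_def by (rule ennreal_LINT_le_nn_integral)
      also have "\<dots> = (\<integral>\<^sup>+r\<in>{s..t}. ennreal (b r) \<partial>lborel)"
        unfolding nn_integral_completion using g(2)
        by (intro nn_integral_cong_AE) (use st in \<open>auto elim!: eventually_mono simp: b_def indicator_def\<close>)
      finally show ?thesis .
    qed
    show ?thesis
      using bfin bd by (intro exI[of _ b]) (auto simp: b_def)
  qed
  then have "\<forall>n. \<exists>b. b \<in> borel_measurable borel \<and> (\<forall>r. 0 \<le> b r) \<and>
      (\<integral>\<^sup>+r\<in>{0..real n}. ennreal ((b r)\<^sup>2) \<partial>lborel) < \<infinity> \<and>
      (\<forall>s t. 0 \<le> s \<longrightarrow> s \<le> t \<longrightarrow> t \<le> real n \<longrightarrow>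
        ennreal (dist (u s) (u t)) \<le> (\<integral>\<^sup>+r\<in>{s..t}. ennreal (b r) \<partial>lborel))"
    by (rule allI)
  from choice[OF this] obtain b where b: "\<forall>n. b n \<in> borel_measurable borel \<and> (\<forall>r. 0 \<le> b n r) \<and>
      (\<integral>\<^sup>+r\<in>{0..real n}. ennreal ((b n r)\<^sup>2) \<partial>lborel) < \<infinity> \<and>
      (\<forall>s t. 0 \<le> s \<longrightarrow> s \<le> t \<longrightarrow> t \<le> real n \<longrightarrow>
        ennreal (dist (u s) (u t)) \<le> (\<integral>\<^sup>+r\<in>{s..t}. ennreal (b n r) \<partial>lborel))"
    by (elim exE)
  show thesis
  proof (rule ex_has_speed[of b u])
    fix M assume "has_speed u M"
    then show thesis by (rule that)
  qed (use b in simp_all)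
qed

lemma has_speed_set_integrable:
  assumes M: "has_speed u M" and "0 \<le> s"
  shows "set_integrable lborel {s..t} M"
    "(\<integral>\<^sup>+r\<in>{s..t}. ennreal (M r) \<partial>lborel) = ennreal (LINT r:{s..t}|lborel. M r)"
proof -
  have "(\<integral>\<^sup>+r\<in>{s..t}. ennreal ((M r)\<^sup>2) \<partial>lborel) \<le> (\<integral>\<^sup>+r\<in>{0..t}. ennreal ((M r)\<^sup>2) \<partial>lborel)"
    using \<open>0 \<le> s\<close> by (intro nn_integral_mono) (auto simp: indicator_def)
  also have "\<dots> < \<infinity>"
    by (rule has_speedD(3)[OF M])
  finally have "(\<integral>\<^sup>+r\<in>{s..t}. ennreal (M r) \<partial>lborel) < \<infinity>"
    by (rule nn_integral_Icc_finite_of_square[OF has_speedD(1,2)[OF M]])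
  then obtain c where c: "0 \<le> c" "(\<integral>\<^sup>+r\<in>{s..t}. ennreal (M r) \<partial>lborel) = ennreal c"
    by (metis ennreal_cases infinity_ennreal_def less_irrefl)
  show "set_integrable lborel {s..t} M"
    "(\<integral>\<^sup>+r\<in>{s..t}. ennreal (M r) \<partial>lborel) = ennreal (LINT r:{s..t}|lborel. M r)"
    using nn_integral_Icc_imp_LINT[OF has_speedD(1,2)[OF M] c] c(2) by simp_all
qed

lemma has_speed_dist_le:
  assumes M: "has_speed u M" and "0 \<le> s" "s \<le> t"
  shows "dist (u s) (u t) \<le> (LINT r:{s..t}|lborel. M r)"
proof -
  have "0 \<le> (LINT r:{s..t}|lborel. M r)"
    unfolding set_lebesgue_integral_def using has_speedD(2)[OF M] by (intro Bochner_Integration.integral_nonneg) simp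
  then show ?thesis
    using has_speedD(4)[OF assms] unfolding has_speed_set_integrable(2)[OF assms(1,2)] by simp
qed

lemma has_speed_imp_AC_loc_2:
  assumes M: "has_speed u M"
  shows "AC_loc 2 {0..} u"
  unfolding AC_loc_def
proof (intro allI impI)
  fix a b :: real assume ab: "{a..b} \<subseteq> {0..}"
  note [measurable] = has_speedD(1)[OF M]
  show "AC 2 {a..b} u"
    unfolding AC_def
  proof (intro exI conjI ballI impI)
    have "M \<in> borel_measurable lebesgue"
      by (rule measurable_completion) measurable
    then have "M \<in> borel_measurable (lebesgue_on {a..b})"
      by (rule measurable_restrict_space1)
    moreover have "(\<integral>\<^sup>+x. ennreal (\<bar>M x\<bar> powr 2) \<partial>lebesgue_on {a..b}) < \<infinity>"
    proof -
      have "(\<integral>\<^sup>+x. ennreal (\<bar>M x\<bar> powr 2) \<partial>lebesgue_on {a..b})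
          = (\<integral>\<^sup>+x\<in>{a..b}. ennreal (\<bar>M x\<bar> powr 2) \<partial>lborel)"
        by (subst nn_integral_restrict_space) (auto simp: nn_integral_completion)
      also have "\<dots> \<le> (\<integral>\<^sup>+x\<in>{0..b}. ennreal ((M x)\<^sup>2) \<partial>lborel)"
        using ab by (intro nn_integral_mono) (auto simp: indicator_def subset_iff)
      also have "\<dots> < \<infinity>"
        by (rule has_speedD(3)[OF M])
      finally show ?thesis .
    qed
    ultimately show "in_Lp 2 (lebesgue_on {a..b}) (\<lambda>r. ereal (M r))"
      unfolding in_Lp_def by simp
  next
    fix s t assume st: "s \<in> {a..b}" "t \<in> {a..b}" "s \<le> t"
    then have "0 \<le> s" using ab by auto
    have "(LINT r:{s..t}|lebesgue. M r) = (LINT r:{s..t}|lborel. M r)"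
      unfolding set_lebesgue_integral_def by (rule integral_completion) measurable
    then show "dist (u s) (u t) \<le> (LINT r:{s..t}|lebesgue. M r)"
      using has_speed_dist_le[OF M \<open>0 \<le> s\<close> \<open>s \<le> t\<close>] by simp
  qed
qed

lemma metric_deriv_eq:
  assumes "((\<lambda>s. dist (u s) (u t) / \<bar>t - s\<bar>) \<longlongrightarrow> L) (at t)" "t \<in> interior I"
  shows "metric_deriv I u t = L"
  unfolding metric_deriv_def at_within_interior[OF assms(2)]
  by (rule tendsto_Lim[OF at_neq_bot assms(1)])

lemma has_speed_metric_deriv:
  assumes M: "has_speed u M"
  shows "AE t in lborel. 0 < t \<longrightarrow> metric_deriv {0..} u t = M t"
  using has_speedD(5)[OF M]
proof eventually_elim
  case (elim t)
  then show ?case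
    using metric_deriv_eq[of u t "M t" "{0..}"] by simp
qed

lemma has_speed_holder:
  assumes M: "has_speed u M" and "s \<in> {0..T}" "t \<in> {0..T}" "0 \<le> K"
    and K: "(\<integral>\<^sup>+r\<in>{0..T}. ennreal ((M r)\<^sup>2) \<partial>lborel) \<le> ennreal K"
  shows "(dist (u s) (u t))\<^sup>2 \<le> \<bar>t - s\<bar> * K"
proof -
  have *: "(dist (u s) (u t))\<^sup>2 \<le> (t - s) * K" if "0 \<le> s" "s \<le> t" "t \<le> T" for s t
  proof -
    have "ennreal ((dist (u s) (u t))\<^sup>2) \<le> ennreal (t - s) * (\<integral>\<^sup>+r\<in>{s..t}. ennreal ((M r)\<^sup>2) \<partial>lborel)"
      by (rule has_speed_dist_square[OF M that(1,2)])
    also have "\<dots> \<le> ennreal (t - s) * (\<integral>\<^sup>+r\<in>{0..T}. ennreal ((M r)\<^sup>2) \<partial>lborel)"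
      using that by (intro mult_left_mono nn_integral_mono) (auto simp: indicator_def)
    also have "\<dots> \<le> ennreal (t - s) * ennreal K"
      by (intro mult_left_mono K) simp
    also have "\<dots> = ennreal ((t - s) * K)"
      using that \<open>0 \<le> K\<close> by (simp add: ennreal_mult)
    finally show ?thesis
      using that \<open>0 \<le> K\<close> by simp
  qed
  show ?thesis
    using *[of s t] *[of t s] assms(2,3) by (cases "s \<le> t") (auto simp: dist_commute)
qed

text \<open>The argument \<open>max 0 t\<close> makes the curve constant before time 0, where
  \<open>has_speed\<close> gives no information; continuity on the whole line then yields Borel
  measurability by composition.\<close>

lemma has_speed_isCont:
  assumes M: "has_speed u M"
  shows "isCont (\<lambda>t. u (max 0 t)) t"
proof -
  define T where "T = \<bar>t\<bar> + 1"
  obtain K where K: "0 \<le> K" "(\<integral>\<^sup>+r\<in>{0..T}. ennreal ((M r)\<^sup>2) \<partial>lborel) = ennreal K"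
    using has_speedD(3)[OF M, of T] by (cases "\<integral>\<^sup>+r\<in>{0..T}. ennreal ((M r)\<^sup>2) \<partial>lborel") auto
  have "\<forall>\<^sub>F s in at t. t - 1 < s \<and> s < t + 1"
    by (intro eventually_at_real_within_open) auto
  then have ev: "\<forall>\<^sub>F s in at t. norm ((dist (u (max 0 s)) (u (max 0 t)))\<^sup>2) \<le> \<bar>s - t\<bar> * K"
  proof eventually_elim
    case (elim s)
    have "(dist (u (max 0 s)) (u (max 0 t)))\<^sup>2 \<le> \<bar>max 0 t - max 0 s\<bar> * K"
      using elim K by (intro has_speed_holder[OF M, of _ T]) (auto simp: T_def)
    also have "\<dots> \<le> \<bar>s - t\<bar> * K"
      using K by (intro mult_right_mono) auto
    finally show ?case by simp
  qed
  have "((\<lambda>s. \<bar>s - t\<bar> * K) \<longlongrightarrow> 0) (at t)"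
    by (intro tendsto_eq_intros) auto
  with ev have "((\<lambda>s. (dist (u (max 0 s)) (u (max 0 t)))\<^sup>2) \<longlongrightarrow> 0) (at t)"
    by (rule Lim_null_comparison)
  then have "((\<lambda>s. sqrt ((dist (u (max 0 s)) (u (max 0 t)))\<^sup>2)) \<longlongrightarrow> sqrt 0) (at t)"
    by (rule tendsto_real_sqrt)
  then have "((\<lambda>s. dist (u (max 0 s)) (u (max 0 t))) \<longlongrightarrow> 0) (at t)"
    by simp
  then show ?thesis
    unfolding isCont_def by (subst tendsto_dist_iff)
qed

section \<open>Lower semicontinuity of the dissipation\<close>

text \<open>Cauchy-Schwarz on the window from t to t + h costs one factor h, and by Tonelli every r
  belongs to windows whose starting points fill a set of length at most h; together they cancel h^2.
  Stopping at T - h keeps the windows inside {0..T}.\<close>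

lemma has_speed_difference_quotient:
  assumes M: "has_speed u M" and h: "0 < h"
  shows "(\<integral>\<^sup>+t\<in>{0..T - h}. ennreal ((dist (u (t + h)) (u t) / h)\<^sup>2) \<partial>lborel)
    \<le> (\<integral>\<^sup>+r\<in>{0..T}. ennreal ((M r)\<^sup>2) \<partial>lborel)"
proof -
  note [measurable] = has_speedD(1)[OF M]
  let ?A = "{x :: real \<times> real. 0 \<le> fst x \<and> fst x \<le> T - h \<and> fst x \<le> snd x \<and> snd x \<le> fst x + h}"
  let ?f = "\<lambda>(t, r). ennreal ((M r)\<^sup>2) * indicator ?A (t, r)"
  have m: "?f \<in> borel_measurable (lborel \<Otimes>\<^sub>M lborel)"
    by measurable
  have "(\<integral>\<^sup>+t\<in>{0..T - h}. ennreal ((dist (u (t + h)) (u t) / h)\<^sup>2) \<partial>lborel)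
      \<le> (\<integral>\<^sup>+t. ennreal (1 / h) * (\<integral>\<^sup>+r. ?f (t, r) \<partial>lborel) \<partial>lborel)"
  proof (rule nn_integral_mono)
    fix t
    show "ennreal ((dist (u (t + h)) (u t) / h)\<^sup>2) * indicator {0..T - h} t
        \<le> ennreal (1 / h) * (\<integral>\<^sup>+r. ?f (t, r) \<partial>lborel)"
    proof (cases "t \<in> {0..T - h}")
      case True
      have eq: "(\<integral>\<^sup>+r. ?f (t, r) \<partial>lborel) = (\<integral>\<^sup>+r\<in>{t..t + h}. ennreal ((M r)\<^sup>2) \<partial>lborel)"
        using True by (intro nn_integral_cong) (auto simp: indicator_def)
      have "ennreal ((dist (u (t + h)) (u t) / h)\<^sup>2) = ennreal (1 / h\<^sup>2) * ennreal ((dist (u t) (u (t + h)))\<^sup>2)"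
        by (simp add: power_divide dist_commute flip: ennreal_mult)
      also have "\<dots> \<le> ennreal (1 / h\<^sup>2) * (ennreal (t + h - t) * (\<integral>\<^sup>+r\<in>{t..t + h}. ennreal ((M r)\<^sup>2) \<partial>lborel))"
        using True h by (intro mult_left_mono has_speed_dist_square[OF M]) auto
      also have "\<dots> = ennreal (1 / h\<^sup>2 * h) * (\<integral>\<^sup>+r\<in>{t..t + h}. ennreal ((M r)\<^sup>2) \<partial>lborel)"
        using h by (subst ennreal_mult) (auto simp: mult.assoc)
      also have "1 / h\<^sup>2 * h = 1 / h"
        using h by (simp add: power2_eq_square)
      finally show ?thesis
        using True eq by simp
    qed simp
  qed
  also have "\<dots> = ennreal (1 / h) * (\<integral>\<^sup>+t. \<integral>\<^sup>+r. ?f (t, r) \<partial>lborel \<partial>lborel)"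
    by (intro nn_integral_cmult) measurable
  also have "(\<integral>\<^sup>+t. \<integral>\<^sup>+r. ?f (t, r) \<partial>lborel \<partial>lborel) = (\<integral>\<^sup>+r. \<integral>\<^sup>+t. ?f (t, r) \<partial>lborel \<partial>lborel)"
    using lborel_pair.Fubini'[OF m] by simp
  also have "\<dots> \<le> (\<integral>\<^sup>+r. ennreal h * (ennreal ((M r)\<^sup>2) * indicator {0..T} r) \<partial>lborel)"
  proof (rule nn_integral_mono)
    fix r
    have "(\<integral>\<^sup>+t. ?f (t, r) \<partial>lborel) \<le> (\<integral>\<^sup>+t. (ennreal ((M r)\<^sup>2) * indicator {0..T} r) * indicator {r - h..r} t \<partial>lborel)"
      using h by (intro nn_integral_mono) (auto simp: indicator_def)
    also have "\<dots> = ennreal h * (ennreal ((M r)\<^sup>2) * indicator {0..T} r)"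
      using h by (subst nn_integral_cmult) (auto simp: mult.commute)
    finally show "(\<integral>\<^sup>+t. ?f (t, r) \<partial>lborel) \<le> ennreal h * (ennreal ((M r)\<^sup>2) * indicator {0..T} r)" .
  qed
  also have "\<dots> = ennreal h * (\<integral>\<^sup>+r\<in>{0..T}. ennreal ((M r)\<^sup>2) \<partial>lborel)"
    by (intro nn_integral_cmult) measurable
  finally have "(\<integral>\<^sup>+t\<in>{0..T - h}. ennreal ((dist (u (t + h)) (u t) / h)\<^sup>2) \<partial>lborel)
      \<le> ennreal (1 / h) * (ennreal h * (\<integral>\<^sup>+r\<in>{0..T}. ennreal ((M r)\<^sup>2) \<partial>lborel))"
    by (simp add: mult_left_mono)
  also have "\<dots> = ennreal (1 / h * h) * (\<integral>\<^sup>+r\<in>{0..T}. ennreal ((M r)\<^sup>2) \<partial>lborel)"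
    using h by (subst ennreal_mult) (auto simp: mult.assoc)
  finally show ?thesis
    using h by simp
qed

text \<open>Only distances pass to the limit, so speeds are replaced by difference quotients. For
  fixed step h Fatou's lemma is applied in k, with (MT1) entering through \<open>lim\<close>; a
  second use of Fatou lets h tend to 0 along the limit curve.\<close>

lemma has_speed_lower_semicontinuous:
  fixes u :: "real \<Rightarrow> 'a::metric_space" and v :: "nat \<Rightarrow> real \<Rightarrow> 'a"
  assumes M: "has_speed u M" and N: "\<And>k. has_speed (v k) (N k)"
    and lim: "\<And>s t c. 0 \<le> s \<Longrightarrow> 0 \<le> t \<Longrightarrow> c < dist (u s) (u t) \<Longrightarrow>
      \<forall>\<^sub>F k in sequentially. c < dist (v k s) (v k t)"
  shows "(\<integral>\<^sup>+r\<in>{0..T}. ennreal ((M r)\<^sup>2) \<partial>lborel)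
    \<le> liminf (\<lambda>k. \<integral>\<^sup>+r\<in>{0..T}. ennreal ((N k r)\<^sup>2) \<partial>lborel)"
proof -
  have meas: "(\<lambda>t. ennreal ((dist (w (t + h)) (w t) / h)\<^sup>2) * indicator {0..S} t) \<in> borel_measurable borel"
    if W: "has_speed w W" and h: "0 < h" for w :: "real \<Rightarrow> 'a" and W h S
  proof -
    have c: "continuous_on UNIV (\<lambda>t. w (max 0 t))"
      using has_speed_isCont[OF W] by (simp add: continuous_on_eq_continuous_at)
    have "continuous_on UNIV (\<lambda>t. dist (w (max 0 (t + h))) (w (max 0 t)))"
      by (intro continuous_intros continuous_on_compose2[OF c, of UNIV "\<lambda>t. t + h"] c) auto
    then have [measurable]: "(\<lambda>t. dist (w (max 0 (t + h))) (w (max 0 t))) \<in> borel_measurable borel"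
      by (rule borel_measurable_continuous_onI)
    have "(\<lambda>t. ennreal ((dist (w (max 0 (t + h))) (w (max 0 t)) / h)\<^sup>2) * indicator {0..S} t) \<in> borel_measurable borel"
      by measurable
    also have "(\<lambda>t. ennreal ((dist (w (max 0 (t + h))) (w (max 0 t)) / h)\<^sup>2) * indicator {0..S} t)
        = (\<lambda>t. ennreal ((dist (w (t + h)) (w t) / h)\<^sup>2) * indicator {0..S} t)"
      using h by (auto simp: fun_eq_iff indicator_def max_def)
    finally show ?thesis .
  qed
  let ?L = "liminf (\<lambda>k. \<integral>\<^sup>+r\<in>{0..T}. ennreal ((N k r)\<^sup>2) \<partial>lborel)"
  have step: "(\<integral>\<^sup>+t\<in>{0..T - h}. ennreal ((dist (u (t + h)) (u t) / h)\<^sup>2) \<partial>lborel) \<le> ?L" if h: "0 < h" for h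
  proof -
    have "(\<integral>\<^sup>+t\<in>{0..T - h}. ennreal ((dist (u (t + h)) (u t) / h)\<^sup>2) \<partial>lborel)
        \<le> (\<integral>\<^sup>+t. liminf (\<lambda>k. ennreal ((dist (v k (t + h)) (v k t) / h)\<^sup>2) * indicator {0..T - h} t) \<partial>lborel)"
    proof (rule nn_integral_mono)
      fix t
      show "ennreal ((dist (u (t + h)) (u t) / h)\<^sup>2) * indicator {0..T - h} t
          \<le> liminf (\<lambda>k. ennreal ((dist (v k (t + h)) (v k t) / h)\<^sup>2) * indicator {0..T - h} t)"
      proof (cases "t \<in> {0..T - h}")
        case True
        have "ennreal ((dist (u (t + h)) (u t) / h)\<^sup>2) \<le> liminf (\<lambda>k. ennreal ((dist (v k (t + h)) (v k t) / h)\<^sup>2))"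
          unfolding le_Liminf_iff
        proof (intro allI impI)
          fix y assume y: "y < ennreal ((dist (u (t + h)) (u t) / h)\<^sup>2)"
          then obtain c where c: "y = ennreal c" "0 \<le> c"
            by (metis ennreal_cases order.strict_trans ennreal_less_top less_irrefl)
          have "c < (dist (u (t + h)) (u t) / h)\<^sup>2"
            using y c by (simp add: ennreal_less_iff)
          then have "sqrt c < dist (u (t + h)) (u t) / h"
            by (intro real_less_lsqrt) (use c h in auto)
          then have "sqrt c * h < dist (u (t + h)) (u t)"
            using h by (simp add: pos_less_divide_eq)
          then have "\<forall>\<^sub>F k in sequentially. sqrt c * h < dist (v k (t + h)) (v k t)"
            using True h by (intro lim) auto
          then show "\<forall>\<^sub>F k in sequentially. y < ennreal ((dist (v k (t + h)) (v k t) / h)\<^sup>2)"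
          proof eventually_elim
            case (elim k)
            then have "sqrt c < dist (v k (t + h)) (v k t) / h"
              using h by (simp add: pos_less_divide_eq)
            then have "(sqrt c)\<^sup>2 < (dist (v k (t + h)) (v k t) / h)\<^sup>2"
              using c by (intro power_strict_mono) auto
            then show ?case
              using c by (simp add: ennreal_less_iff)
          qed
        qed
        then show ?thesis
          using True by simp
      qed simp
    qed
    also have "\<dots> \<le> liminf (\<lambda>k. \<integral>\<^sup>+t\<in>{0..T - h}. ennreal ((dist (v k (t + h)) (v k t) / h)\<^sup>2) \<partial>lborel)"
      using meas[OF N h] by (intro nn_integral_liminf) simp
    also have "\<dots> \<le> ?L"
      by (intro Liminf_mono always_eventually allI has_speed_difference_quotient[OF N h])
    finally show ?thesis .
  qed
  define h where "h n = 1 / real (Suc n)" for n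
  have h: "0 < h n" "h \<longlonglongrightarrow> 0" for n
    unfolding h_def using LIMSEQ_inverse_real_of_nat by (auto simp: inverse_eq_divide)
  have "(\<integral>\<^sup>+r\<in>{0..T}. ennreal ((M r)\<^sup>2) \<partial>lborel)
      \<le> (\<integral>\<^sup>+t. liminf (\<lambda>n. ennreal ((dist (u (t + h n)) (u t) / h n)\<^sup>2) * indicator {0..T - h n} t) \<partial>lborel)"
  proof (rule nn_integral_mono_AE)
    show "AE t in lborel. ennreal ((M t)\<^sup>2) * indicator {0..T} t
        \<le> liminf (\<lambda>n. ennreal ((dist (u (t + h n)) (u t) / h n)\<^sup>2) * indicator {0..T - h n} t)"
      using has_speedD(5)[OF M] AE_lborel_singleton[of 0] AE_lborel_singleton[of T]
    proof eventually_elim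
      case (elim t)
      show ?case
      proof (cases "t \<in> {0..T}")
        case True
        then have t: "0 < t" "t < T"
          using elim by auto
        have f: "filterlim (\<lambda>n. t + h n) (at t) sequentially"
          using h(1) tendsto_add[OF tendsto_const h(2), of t] by (auto simp: filterlim_at less_imp_neq[symmetric])
        have "(\<lambda>n. dist (u (t + h n)) (u t) / \<bar>t - (t + h n)\<bar>) \<longlonglongrightarrow> M t"
          using elim(1) t(1) by (intro filterlim_compose[OF _ f]) auto
        then have "(\<lambda>n. ennreal ((dist (u (t + h n)) (u t) / \<bar>t - (t + h n)\<bar>)\<^sup>2)) \<longlonglongrightarrow> ennreal ((M t)\<^sup>2)"
          by (intro tendsto_ennrealI tendsto_power)
        moreover have "\<forall>\<^sub>F n in sequentially. h n < T - t"
          using h(2) t by (intro order_tendstoD) auto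
        then have "\<forall>\<^sub>F n in sequentially. ennreal ((dist (u (t + h n)) (u t) / \<bar>t - (t + h n)\<bar>)\<^sup>2)
            = ennreal ((dist (u (t + h n)) (u t) / h n)\<^sup>2) * indicator {0..T - h n} t"
          by eventually_elim (use t h(1) in \<open>auto simp: indicator_def power_divide\<close>)
        ultimately have "(\<lambda>n. ennreal ((dist (u (t + h n)) (u t) / h n)\<^sup>2) * indicator {0..T - h n} t) \<longlonglongrightarrow> ennreal ((M t)\<^sup>2)"
          by (rule Lim_transform_eventually)
        from lim_imp_Liminf[OF sequentially_bot this] show ?thesis
          using True by simp
      qed simp
    qed
  qed
  also have "\<dots> \<le> liminf (\<lambda>n. \<integral>\<^sup>+t\<in>{0..T - h n}. ennreal ((dist (u (t + h n)) (u t) / h n)\<^sup>2) \<partial>lborel)"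
    using meas[OF M h(1)] by (intro nn_integral_liminf) simp
  also have "\<dots> \<le> liminf (\<lambda>n::nat. ?L)"
    by (intro Liminf_mono always_eventually allI step h)
  also have "\<dots> = ?L"
    by (simp add: Liminf_const)
  finally show ?thesis .
qed

section \<open>Limits of curves with bounded dissipation\<close>

lemma approx_from_right:
  fixes x :: real
  assumes "countable (- P)"
  obtains p :: "nat \<Rightarrow> real" where "\<And>j. p j \<in> P" "\<And>j. x < p j" "\<And>j. p j < x + 1 / real (Suc j)"
    "filterlim p (at_right x) sequentially"
proof -
  have "\<exists>q. q \<in> P \<and> x < q \<and> q < x + 1 / real (Suc j)" for j
  proof (rule ccontr)
    assume "\<not> ?thesis"
    then have "{x<..<x + 1 / real (Suc j)} \<subseteq> - P" by auto
    with assms have "countable {x<..<x + 1 / real (Suc j)}"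
      by (rule countable_subset[rotated])
    then show False
      using uncountable_open_interval[of x "x + 1 / real (Suc j)"] by simp
  qed
  then have "\<forall>j. \<exists>q. q \<in> P \<and> x < q \<and> q < x + 1 / real (Suc j)" by (rule allI)
  from choice[OF this] obtain p where p: "\<forall>j. p j \<in> P \<and> x < p j \<and> p j < x + 1 / real (Suc j)"
    by (elim exE)
  have "p \<longlonglongrightarrow> x"
  proof (rule tendsto_sandwich[of "\<lambda>_. x" _ _ "\<lambda>j. x + inverse (real (Suc j))"])
    show "(\<lambda>j. x + inverse (real (Suc j))) \<longlonglongrightarrow> x"
      using tendsto_add[OF tendsto_const LIMSEQ_inverse_real_of_nat, of x] by simp
  qed (use p in \<open>auto intro!: always_eventually simp: less_imp_le inverse_eq_divide simp del: of_nat_Suc\<close>)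
  then have "filterlim p (at_right x) sequentially"
    using p by (auto simp: filterlim_at less_imp_neq[symmetric])
  with p show thesis
    by (intro that[of p]) auto
qed

text \<open>Helly's theorem gives convergence only at continuity points of the limit, a set with
  countable complement; right-continuity extends the inequality to all times. \<open>D\<close> is
  left abstract so that it can be a linear function of time or a distance between curve points, and
  q < t + 1 keeps the approximating times in a bounded window.\<close>

lemma le_of_le_on_dense_right:
  fixes F :: "real \<Rightarrow> real" and D :: "real \<Rightarrow> real \<Rightarrow> real"
  assumes P: "countable (- P)" and rc: "\<And>x. continuous (at_right x) F"
    and D: "\<And>p q. p \<longlonglongrightarrow> s \<Longrightarrow> q \<longlonglongrightarrow> t \<Longrightarrow> (\<And>j. s < p j) \<Longrightarrow> (\<And>j. t < q j) \<Longrightarrow> (\<And>j. q j < t + 1) \<Longrightarrow>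
      (\<lambda>j. D (p j) (q j)) \<longlonglongrightarrow> D s t"
    and le: "\<And>p q. p \<in> P \<Longrightarrow> q \<in> P \<Longrightarrow> s < p \<Longrightarrow> p \<le> q \<Longrightarrow> q < t + 1 \<Longrightarrow> D p q \<le> F q - F p"
    and "s < t"
  shows "D s t \<le> F t - F s"
proof -
  obtain p :: "nat \<Rightarrow> real" where p: "\<And>j. p j \<in> P" "\<And>j. s < p j" "filterlim p (at_right s) sequentially"
    using approx_from_right[OF P, of s] by metis
  obtain q :: "nat \<Rightarrow> real" where q: "\<And>j. q j \<in> P" "\<And>j. t < q j" "\<And>j. q j < t + 1 / real (Suc j)"
      "filterlim q (at_right t) sequentially"
    by (rule approx_from_right[OF P, of t]) (rule that)
  have q1: "q j < t + 1" for j
    by (rule less_le_trans[OF q(3)]) simp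
  have pl: "p \<longlonglongrightarrow> s" and ql: "q \<longlonglongrightarrow> t"
    using p(3) q(4) by (auto simp: filterlim_at)
  have "(\<lambda>j. F (q j) - F (p j)) \<longlonglongrightarrow> F t - F s"
    using filterlim_compose[OF _ p(3), of F] filterlim_compose[OF _ q(4), of F] rc
    by (intro tendsto_diff) (auto simp: continuous_within)
  moreover have "(\<lambda>j. D (p j) (q j)) \<longlonglongrightarrow> D s t"
    by (rule D[OF pl ql p(2) q(2) q1])
  moreover have "\<forall>\<^sub>F j in sequentially. p j < t"
    using pl \<open>s < t\<close> by (rule order_tendstoD)
  then have "\<forall>\<^sub>F j in sequentially. D (p j) (q j) \<le> F (q j) - F (p j)"
  proof eventually_elim
    case (elim j)
    show ?case
      using elim q(2)[of j] by (intro le p q q1) auto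
  qed
  ultimately show ?thesis
    by (intro tendsto_le[OF sequentially_bot]) auto
qed

text \<open>Helly's theorem is applied to the primitives \<open>C k\<close> of the speeds and
  \<open>D k\<close> of their squares. The domination of increments of \<open>C k\<close> by those
  of \<open>D k\<close> passes to the limits \<open>G\<close> and \<open>H\<close>, so
  \<open>G\<close> has a square integrable density by \<open>ex_density_of_dominated\<close>. Since
  \<open>lim\<close> makes increments of \<open>G\<close> dominate distances along \<open>u\<close>,
  this density bounds the speed of the limit.\<close>

lemma ex_has_speed_limit:
  fixes u :: "real \<Rightarrow> 'a::metric_space" and v :: "nat \<Rightarrow> real \<Rightarrow> 'a"
  assumes N: "\<And>k. has_speed (v k) (N k)"
    and bound: "\<And>T. \<exists>K\<ge>0. \<forall>k. (\<integral>\<^sup>+r\<in>{0..T}. ennreal ((N k r)\<^sup>2) \<partial>lborel) \<le> ennreal K"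
    and lim: "\<And>s t c. 0 \<le> s \<Longrightarrow> 0 \<le> t \<Longrightarrow> c < dist (u s) (u t) \<Longrightarrow>
      \<forall>\<^sub>F k in sequentially. c < dist (v k s) (v k t)"
  obtains M where "has_speed u M"
proof -
  note [measurable] = has_speedD(1)[OF N]
  have N0: "0 \<le> N k r" for k r
    by (rule has_speedD(2)[OF N])
  have "\<exists>g. g \<in> borel_measurable borel \<and> (\<forall>r. 0 \<le> g r) \<and>
      (\<integral>\<^sup>+r\<in>{0..real n}. ennreal ((g r)\<^sup>2) \<partial>lborel) < \<infinity> \<and>
      (\<forall>s t. 0 \<le> s \<longrightarrow> s \<le> t \<longrightarrow> t \<le> real n \<longrightarrow>
        ennreal (dist (u s) (u t)) \<le> (\<integral>\<^sup>+r\<in>{s..t}. ennreal (g r) \<partial>lborel))" for n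
  proof -
    \<comment> \<open>One unit beyond n leaves room for approximating times to the right of t \<le>
      n.\<close>
    define T where "T = real n + 1"
    have T0: "0 \<le> T" by (simp add: T_def)
    obtain K where K: "0 \<le> K" "\<And>k. (\<integral>\<^sup>+r\<in>{0..T}. ennreal ((N k r)\<^sup>2) \<partial>lborel) \<le> ennreal K"
      using bound[of T] by auto
    \<comment> \<open>A common bound for both families of primitives: the integral of
      \<open>b\<close> is at most T + K since b \<le> 1 + b^2 on {0..T}, and that of its square is
      at most K.\<close>
    define R where "R = T + K"
    have R0: "0 \<le> R" by (simp add: R_def T0 K)
    define b where "b k r = N k r * indicator {0..T} r" for k r
    have b_meas [measurable]: "b k \<in> borel_measurable borel" for k
      unfolding b_def by measurable
    have b0: "0 \<le> b k r" for k r
      by (simp add: b_def N0)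
    have bsq: "(\<integral>\<^sup>+r. ennreal ((b k r)\<^sup>2) \<partial>lborel) \<le> ennreal K" for k
    proof -
      have "(\<integral>\<^sup>+r. ennreal ((b k r)\<^sup>2) \<partial>lborel) = (\<integral>\<^sup>+r\<in>{0..T}. ennreal ((N k r)\<^sup>2) \<partial>lborel)"
        by (intro nn_integral_cong) (auto simp: b_def indicator_def)
      then show ?thesis using K(2)[of k] by simp
    qed
    have b1: "(\<integral>\<^sup>+r. ennreal (b k r) \<partial>lborel) \<le> ennreal R" for k
    proof -
      have "(\<integral>\<^sup>+r. ennreal (b k r) \<partial>lborel) \<le> (\<integral>\<^sup>+r. indicator {0..T} r + ennreal ((b k r)\<^sup>2) \<partial>lborel)"
      proof (rule nn_integral_mono)
        fix r
        have "b k r \<le> 1 + (b k r)\<^sup>2"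
          using sum_squares_bound[of 1 "b k r"] b0[of k r] by simp
        then show "ennreal (b k r) \<le> indicator {0..T} r + ennreal ((b k r)\<^sup>2)"
          by (cases "r \<in> {0..T}") (auto simp: b_def N0 ennreal_leI simp flip: ennreal_plus ennreal_1)
      qed
      also have "\<dots> = (\<integral>\<^sup>+r. indicator {0..T} r \<partial>lborel) + (\<integral>\<^sup>+r. ennreal ((b k r)\<^sup>2) \<partial>lborel)"
        by (intro nn_integral_add) measurable
      also have "\<dots> \<le> ennreal T + ennreal K"
        using T0 by (intro add_mono bsq) simp
      also have "\<dots> = ennreal R"
        by (simp add: R_def T0 K)
      finally show ?thesis .
    qed
    \<comment> \<open>Normalizing the primitive to vanish at 0 makes one bound \<open>R\<close>
      serve for all k, as Helly's theorem requires.\<close>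
    have prim: "\<exists>C. mono C \<and> (\<forall>x. isCont C x) \<and> (\<forall>x. \<bar>C x\<bar> \<le> R) \<and>
        (\<forall>s t. s \<le> t \<longrightarrow> (\<integral>\<^sup>+r\<in>{s..t}. ennreal (f r) \<partial>lborel) = ennreal (C t - C s)) \<and>
        (\<forall>s t. set_integrable lborel {s..t} f) \<and>
        (\<forall>s t. s \<le> t \<longrightarrow> C t - C s = (LINT r:{s..t}|lborel. f r))"
      if f: "f \<in> borel_measurable borel" "\<And>r. 0 \<le> f r" "(\<integral>\<^sup>+r. ennreal (f r) \<partial>lborel) \<le> ennreal R"
        for f :: "real \<Rightarrow> real"
    proof -
      have fin: "(\<integral>\<^sup>+r. ennreal (f r) \<partial>lborel) < \<infinity>"
        by (rule le_less_trans[OF f(3)]) simp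
      obtain C L where C: "mono C" "\<And>x. isCont C x" "\<And>x. \<bar>C x\<bar> \<le> L"
        "\<And>s t. s \<le> t \<Longrightarrow> (\<integral>\<^sup>+r\<in>{s..t}. ennreal (f r) \<partial>lborel) = ennreal (C t - C s)"
        "\<And>s t. set_integrable lborel {s..t} f"
        "\<And>s t. s \<le> t \<Longrightarrow> C t - C s = (LINT r:{s..t}|lborel. f r)"
        "AE t in lborel. (C has_real_derivative f t) (at t)"
        by (rule ex_primitive[OF f(1,2) fin]) (rule that)
      have le: "C t - C s \<le> R" if "s \<le> t" for s t
      proof -
        have "ennreal (C t - C s) \<le> (\<integral>\<^sup>+r. ennreal (f r) \<partial>lborel)"
          unfolding C(4)[OF that, symmetric] by (intro nn_integral_mono) (auto simp: indicator_def)
        also have "\<dots> \<le> ennreal R" by (rule f(3))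
        finally show ?thesis using R0 by simp
      qed
      show ?thesis
      proof (intro exI[of _ "\<lambda>x. C x - C 0"] conjI allI impI)
        show "mono (\<lambda>x. C x - C 0)"
          using C(1) by (auto simp: mono_def)
        show "isCont (\<lambda>x. C x - C 0) x" for x
          using C(2) by (intro continuous_intros)
        show "\<bar>C x - C 0\<bar> \<le> R" for x
          using le[of 0 x] le[of x 0] monoD[OF C(1), of 0 x] monoD[OF C(1), of x 0] by (cases "0 \<le> x") auto
      qed (use C in auto)
    qed
    have "\<forall>k. \<exists>C. mono C \<and> (\<forall>x. isCont C x) \<and> (\<forall>x. \<bar>C x\<bar> \<le> R) \<and>
        (\<forall>s t. s \<le> t \<longrightarrow> (\<integral>\<^sup>+r\<in>{s..t}. ennreal (b k r) \<partial>lborel) = ennreal (C t - C s)) \<and>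
        (\<forall>s t. set_integrable lborel {s..t} (b k)) \<and>
        (\<forall>s t. s \<le> t \<longrightarrow> C t - C s = (LINT r:{s..t}|lborel. b k r))"
      by (intro allI prim b_meas b0 b1)
    from choice[OF this] obtain C where C: "\<forall>k. mono (C k) \<and> (\<forall>x. isCont (C k) x) \<and> (\<forall>x. \<bar>C k x\<bar> \<le> R) \<and>
        (\<forall>s t. s \<le> t \<longrightarrow> (\<integral>\<^sup>+r\<in>{s..t}. ennreal (b k r) \<partial>lborel) = ennreal (C k t - C k s)) \<and>
        (\<forall>s t. set_integrable lborel {s..t} (b k)) \<and>
        (\<forall>s t. s \<le> t \<longrightarrow> C k t - C k s = (LINT r:{s..t}|lborel. b k r))"
      by (elim exE)
    have KR: "ennreal K \<le> ennreal R"
      using T0 by (intro ennreal_leI) (simp add: R_def)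
    have "\<forall>k. \<exists>C. mono C \<and> (\<forall>x. isCont C x) \<and> (\<forall>x. \<bar>C x\<bar> \<le> R) \<and>
        (\<forall>s t. s \<le> t \<longrightarrow> (\<integral>\<^sup>+r\<in>{s..t}. ennreal ((b k r)\<^sup>2) \<partial>lborel) = ennreal (C t - C s)) \<and>
        (\<forall>s t. set_integrable lborel {s..t} (\<lambda>r. (b k r)\<^sup>2)) \<and>
        (\<forall>s t. s \<le> t \<longrightarrow> C t - C s = (LINT r:{s..t}|lborel. (b k r)\<^sup>2))"
      by (intro allI prim borel_measurable_power b_meas zero_le_power2 order_trans[OF bsq KR])
    from choice[OF this] obtain D where D: "\<forall>k. mono (D k) \<and> (\<forall>x. isCont (D k) x) \<and> (\<forall>x. \<bar>D k x\<bar> \<le> R) \<and>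
        (\<forall>s t. s \<le> t \<longrightarrow> (\<integral>\<^sup>+r\<in>{s..t}. ennreal ((b k r)\<^sup>2) \<partial>lborel) = ennreal (D k t - D k s)) \<and>
        (\<forall>s t. set_integrable lborel {s..t} (\<lambda>r. (b k r)\<^sup>2)) \<and>
        (\<forall>s t. s \<le> t \<longrightarrow> D k t - D k s = (LINT r:{s..t}|lborel. (b k r)\<^sup>2))"
      by (elim exE)
    have CD: "C k t - C k s \<le> l * (t - s) + (D k t - D k s) / l" if "0 < l" "s \<le> t" for k l s t
    proof -
      have 1: "b k r \<le> l + (b k r)\<^sup>2 / l" for r
      proof (cases "b k r \<le> l")
        case True
        then show ?thesis using that by (simp add: add_increasing2)
      next
        case False
        then have "b k r * l \<le> (b k r)\<^sup>2"
          using that b0[of k r] by (simp add: power2_eq_square mult_left_mono)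
        then have "b k r \<le> (b k r)\<^sup>2 / l"
          using that by (simp add: pos_le_divide_eq)
        then show ?thesis using that by simp
      qed
      have i0: "set_integrable lborel {s..t} (\<lambda>_. l)"
        by (intro borel_integrable_atLeastAtMost') simp
      have i1: "set_integrable lborel {s..t} (b k)"
        using C by simp
      have i2: "set_integrable lborel {s..t} (\<lambda>r. (b k r)\<^sup>2 / l)"
        by (rule set_integrable_divide) (use D in simp)
      have "C k t - C k s = (LINT r:{s..t}|lborel. b k r)"
        using C that by simp
      also have "\<dots> \<le> (LINT r:{s..t}|lborel. l + (b k r)\<^sup>2 / l)"
        by (rule set_integral_mono[OF i1 set_integral_add(1)[OF i0 i2] 1])
      also have "\<dots> = (LINT r:{s..t}|lborel. l) + (LINT r:{s..t}|lborel. (b k r)\<^sup>2 / l)"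
        by (rule set_integral_add(2)[OF i0 i2])
      also have "\<dots> = l * (t - s) + (D k t - D k s) / l"
        using that D by (simp add: set_integral_const)
      finally show ?thesis .
    qed
    have "\<exists>r1. strict_mono (r1 :: nat \<Rightarrow> nat) \<and> (\<exists>F. (\<forall>x. continuous (at_right x) F) \<and> mono F \<and>
        (\<forall>x. \<bar>F x\<bar> \<le> R) \<and> (\<forall>x. continuous (at x) F \<longrightarrow> (\<lambda>k. C (r1 k) x) \<longlonglongrightarrow> F x))"
      using C by (intro Helly_selection) (auto intro: continuous_at_imp_continuous_at_within)
    then obtain r1 :: "nat \<Rightarrow> nat" and G where r1: "strict_mono r1" and G: "\<And>x. continuous (at_right x) G" "mono G"
        "\<And>x. \<bar>G x\<bar> \<le> R" "\<And>x. isCont G x \<Longrightarrow> (\<lambda>k. C (r1 k) x) \<longlonglongrightarrow> G x"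
      by auto
    have "\<exists>r2. strict_mono (r2 :: nat \<Rightarrow> nat) \<and> (\<exists>F. (\<forall>x. continuous (at_right x) F) \<and> mono F \<and>
        (\<forall>x. \<bar>F x\<bar> \<le> R) \<and> (\<forall>x. continuous (at x) F \<longrightarrow> (\<lambda>k. (D \<circ> r1) (r2 k) x) \<longlonglongrightarrow> F x))"
      using D by (intro Helly_selection) (auto intro: continuous_at_imp_continuous_at_within)
    then obtain r2 :: "nat \<Rightarrow> nat" and H where r2: "strict_mono r2" and H: "\<And>x. continuous (at_right x) H" "mono H"
        "\<And>x. \<bar>H x\<bar> \<le> R" "\<And>x. isCont H x \<Longrightarrow> (\<lambda>k. D (r1 (r2 k)) x) \<longlonglongrightarrow> H x"
      by auto
    have G': "(\<lambda>k. C (r1 (r2 k)) x) \<longlonglongrightarrow> G x" if "isCont G x" for x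
      using LIMSEQ_subseq_LIMSEQ[OF G(4)[OF that] r2] by (simp add: o_def)
    define P where "P = {x. isCont G x \<and> isCont H x}"
    have P: "countable (- P)"
    proof -
      have "- P = {x. \<not> isCont G x} \<union> {x. \<not> isCont H x}"
        by (auto simp: P_def)
      then show ?thesis
        using mono_ctble_discont[OF G(2)] mono_ctble_discont[OF H(2)] by simp
    qed
    \<comment> \<open>The inequality holds between common continuity points of \<open>G\<close> and
      \<open>H\<close> by passing to the limit in \<open>CD\<close>, and everywhere by
      right-continuity of H / l - G.\<close>
    have dom: "G t - G s \<le> l * (t - s) + (H t - H s) / l" if l: "0 < l" and st: "s \<le> t" for l s t
    proof (cases "s = t")
      case False
      define F where "F x = H x / l - G x" for x
      have "- l * (t - s) \<le> F t - F s"
      proof (rule le_of_le_on_dense_right[OF P, of F s t "\<lambda>p q. - l * (q - p)"])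
        show "continuous (at_right x) F" for x
          unfolding F_def using G(1) H(1) l by (intro continuous_intros) auto
        show "- l * (q - p) \<le> F q - F p" if pq: "p \<in> P" "q \<in> P" "p \<le> q" for p q
        proof -
          have "(\<lambda>k. C (r1 (r2 k)) q - C (r1 (r2 k)) p) \<longlonglongrightarrow> G q - G p"
            using pq by (intro tendsto_diff G') (auto simp: P_def)
          moreover have "(\<lambda>k. l * (q - p) + (D (r1 (r2 k)) q - D (r1 (r2 k)) p) / l) \<longlonglongrightarrow> l * (q - p) + (H q - H p) / l"
            using pq l by (intro tendsto_intros H(4)) (auto simp: P_def)
          ultimately have "G q - G p \<le> l * (q - p) + (H q - H p) / l"
            by (rule LIMSEQ_le) (use CD[OF l pq(3)] in auto)
          then show ?thesis
            by (simp add: F_def diff_divide_distrib)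
        qed
      qed (use st False in \<open>auto intro!: tendsto_intros\<close>)
      then show ?thesis
        by (simp add: F_def diff_divide_distrib)
    qed simp
    \<comment> \<open>A larger distance in the limit would by \<open>lim\<close> appear along the
      sequence and contradict the uniform Hoelder bound there.\<close>
    have uh: "(dist (u s) (u t))\<^sup>2 \<le> \<bar>t - s\<bar> * K" if st: "s \<in> {0..T}" "t \<in> {0..T}" for s t
    proof (rule ccontr)
      assume "\<not> ?thesis"
      then have "sqrt (\<bar>t - s\<bar> * K) < dist (u s) (u t)"
        by (intro real_less_lsqrt) (auto simp: K)
      then have "\<forall>\<^sub>F k in sequentially. sqrt (\<bar>t - s\<bar> * K) < dist (v k s) (v k t)"
        using st by (intro lim) auto
      then obtain k where "sqrt (\<bar>t - s\<bar> * K) < dist (v k s) (v k t)"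
        by (auto simp: eventually_sequentially)
      moreover have "dist (v k s) (v k t) \<le> sqrt (\<bar>t - s\<bar> * K)"
        by (intro real_le_rsqrt has_speed_holder[OF N st K])
      ultimately show False by simp
    qed
    have Gd: "dist (u s) (u t) \<le> G t - G s" if st: "0 \<le> s" "s < t" "t \<le> real n" for s t
    proof (rule le_of_le_on_dense_right[OF P G(1), of s t "\<lambda>p q. dist (u p) (u q)"])
      show "s < t" by (rule st)
    next
      fix p q :: real assume pq: "p \<in> P" "q \<in> P" "s < p" "p \<le> q" "q < t + 1"
      show "dist (u p) (u q) \<le> G q - G p"
      proof (rule dense_le)
        fix c assume "c < dist (u p) (u q)"
        then have "\<forall>\<^sub>F k in sequentially. c < dist (v k p) (v k q)"
          using pq st by (intro lim) auto
        then have "\<forall>\<^sub>F k in sequentially. c < dist (v (r1 (r2 k)) p) (v (r1 (r2 k)) q)"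
          using eventually_subseq[OF strict_mono_o[OF r1 r2], of "\<lambda>k. c < dist (v k p) (v k q)"] by simp
        then have "\<forall>\<^sub>F k in sequentially. c \<le> C (r1 (r2 k)) q - C (r1 (r2 k)) p"
        proof eventually_elim
          case (elim k)
          let ?k = "r1 (r2 k)"
          have "ennreal (dist (v ?k p) (v ?k q)) \<le> (\<integral>\<^sup>+r\<in>{p..q}. ennreal (N ?k r) \<partial>lborel)"
            using pq st by (intro has_speedD(4)[OF N]) auto
          also have "\<dots> = (\<integral>\<^sup>+r\<in>{p..q}. ennreal (b ?k r) \<partial>lborel)"
            using pq st by (intro nn_integral_cong) (auto simp: b_def indicator_def T_def)
          also have "\<dots> = ennreal (C ?k q - C ?k p)"
            using C pq by simp
          finally have "ennreal (dist (v ?k p) (v ?k q)) \<le> ennreal (C ?k q - C ?k p)" .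
          moreover have "C ?k p \<le> C ?k q"
            using C pq(4) by (blast dest: monoD)
          ultimately have "dist (v ?k p) (v ?k q) \<le> C ?k q - C ?k p"
            by (simp only: ennreal_le_iff diff_ge_0_iff_ge)
          with elim show ?case by simp
        qed
        moreover have "(\<lambda>k. C (r1 (r2 k)) q - C (r1 (r2 k)) p) \<longlonglongrightarrow> G q - G p"
          using pq by (intro tendsto_diff G') (auto simp: P_def)
        ultimately show "c \<le> G q - G p"
          by (intro tendsto_lowerbound[OF _ _ sequentially_bot])
      qed
    next
      fix p q :: "nat \<Rightarrow> real"
      assume pq: "p \<longlonglongrightarrow> s" "q \<longlonglongrightarrow> t" "\<And>j. s < p j" "\<And>j. t < q j" "\<And>j. q j < t + 1"
      have *: "(\<lambda>j. u (x j)) \<longlonglongrightarrow> u y" if x: "x \<longlonglongrightarrow> y" "\<forall>\<^sub>F j in sequentially. x j \<in> {0..T}" "y \<in> {0..T}" for x y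
      proof -
        have "(\<lambda>j. sqrt (\<bar>y - x j\<bar> * K)) \<longlonglongrightarrow> sqrt (\<bar>y - y\<bar> * K)"
          by (intro tendsto_intros x)
        then have "(\<lambda>j. sqrt (\<bar>y - x j\<bar> * K)) \<longlonglongrightarrow> 0" by simp
        moreover have "\<forall>\<^sub>F j in sequentially. norm (dist (u (x j)) (u y)) \<le> sqrt (\<bar>y - x j\<bar> * K)"
          using x(2) by eventually_elim (use x(3) in \<open>auto intro!: real_le_rsqrt uh\<close>)
        ultimately have "(\<lambda>j. dist (u (x j)) (u y)) \<longlonglongrightarrow> 0"
          by (rule Lim_null_comparison[rotated])
        then show ?thesis
          by (subst tendsto_dist_iff)
      qed
      have "\<forall>\<^sub>F j in sequentially. p j < t"
        using pq(1) st(2) by (rule order_tendstoD)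
      then have "\<forall>\<^sub>F j in sequentially. p j \<in> {0..T}"
        by eventually_elim (use pq(3) st in \<open>auto simp: T_def intro: less_imp_le order_trans\<close>)
      moreover have "q j \<in> {0..T}" for j
        using pq(4)[of j] pq(5)[of j] st by (simp add: T_def)
      ultimately show "(\<lambda>j. dist (u (p j)) (u (q j))) \<longlonglongrightarrow> dist (u s) (u t)"
        using st by (intro tendsto_dist * pq) (auto simp: T_def)
    qed
    obtain g where g: "g \<in> borel_measurable borel" "\<And>t. 0 \<le> g t"
      "\<And>s t. s \<le> t \<Longrightarrow> (\<integral>\<^sup>+r\<in>{s..t}. ennreal (g r) \<partial>lborel) = ennreal (G t - G s)"
      "(\<integral>\<^sup>+r. ennreal ((g r)\<^sup>2) \<partial>lborel) < \<infinity>"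
      by (rule ex_density_of_dominated[OF G(2,1,3) H(2,1,3) dom]) (assumption | rule that)+
    have gd: "ennreal (dist (u s) (u t)) \<le> (\<integral>\<^sup>+r\<in>{s..t}. ennreal (g r) \<partial>lborel)"
      if st: "0 \<le> s" "s \<le> t" "t \<le> real n" for s t
      using Gd[of s t] st by (cases "s = t") (auto simp: g(3)[OF st(2)] intro!: ennreal_leI)
    have "(\<integral>\<^sup>+r\<in>{0..real n}. ennreal ((g r)\<^sup>2) \<partial>lborel) \<le> (\<integral>\<^sup>+r. ennreal ((g r)\<^sup>2) \<partial>lborel)"
      by (intro nn_integral_mono) (auto simp: indicator_def)
    also have "\<dots> < \<infinity>" by (rule g(4))
    finally show ?thesis
      using g(1,2) gd by (intro exI[of _ g]) simp
  qed
  then have "\<forall>n. \<exists>g. g \<in> borel_measurable borel \<and> (\<forall>r. 0 \<le> g r) \<and>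
      (\<integral>\<^sup>+r\<in>{0..real n}. ennreal ((g r)\<^sup>2) \<partial>lborel) < \<infinity> \<and>
      (\<forall>s t. 0 \<le> s \<longrightarrow> s \<le> t \<longrightarrow> t \<le> real n \<longrightarrow>
        ennreal (dist (u s) (u t)) \<le> (\<integral>\<^sup>+r\<in>{s..t}. ennreal (g r) \<partial>lborel))"
    by (rule allI)
  from choice[OF this] obtain g where g: "\<forall>n. g n \<in> borel_measurable borel \<and> (\<forall>r. 0 \<le> g n r) \<and>
      (\<integral>\<^sup>+r\<in>{0..real n}. ennreal ((g n r)\<^sup>2) \<partial>lborel) < \<infinity> \<and>
      (\<forall>s t. 0 \<le> s \<longrightarrow> s \<le> t \<longrightarrow> t \<le> real n \<longrightarrow>
        ennreal (dist (u s) (u t)) \<le> (\<integral>\<^sup>+r\<in>{s..t}. ennreal (g n r) \<partial>lborel))"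
    by (elim exE)
  show thesis
  proof (rule ex_has_speed[of g u])
    fix M assume "has_speed u M"
    then show thesis by (rule that)
  qed (use g in simp_all)
qed

section \<open>Energies satisfying the LSCC assumptions\<close>

locale lscc_space =
  fixes \<sigma> :: "'a::complete_space topology" and \<phi> :: "'a \<Rightarrow> ereal" and ustar :: 'a and A B :: real
  assumes compat: "compatible \<sigma>" and proper: "proper \<phi>" and lscc: "LSCC \<sigma> \<phi> ustar A B"
begin

lemma topspace_UNIV [simp]: "topspace \<sigma> = UNIV"
  using compat by (simp add: compatible_def)

lemma eventually_dist_greater:
  assumes "limitin \<sigma> w u sequentially" "limitin \<sigma> z v sequentially" "c < dist u v"
  shows "\<forall>\<^sub>F n in sequentially. c < dist (w n) (z n)"
proof -
  have "ereal (dist u v) \<le> liminf (\<lambda>n. ereal (dist (w n) (z n)))"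
    using compat assms(1,2) by (simp add: compatible_def)
  moreover have "ereal c < ereal (dist u v)"
    using assms(3) by simp
  ultimately have "ereal c < liminf (\<lambda>n. ereal (dist (w n) (z n)))"
    by (rule less_le_trans[rotated])
  then show ?thesis
    by (auto dest: less_LiminfD)
qed

lemma limitin_const_seq: "limitin \<sigma> (\<lambda>_. x) x sequentially"
  by (simp add: limitin_const)

lemma open_neighbourhood:
  assumes "openin \<sigma> U" "x \<in> U"
  obtains V d where "openin \<sigma> V" "x \<in> V" "0 < d" "\<And>y v. v \<in> V \<Longrightarrow> dist y v < d \<Longrightarrow> y \<in> U"
proof -
  obtain V d where V: "openin \<sigma> V" "x \<in> V" "0 < d" "\<And>y. infdist y V < d \<Longrightarrow> y \<in> U"
    using compat assms unfolding compatible_def by metis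
  show thesis
  proof (rule that[OF V(1-3)])
    fix y v assume "v \<in> V" "dist y v < d"
    then show "y \<in> U"
      using V(4) infdist_le[of v V y] by simp
  qed
qed

text \<open>This is the use of (MT2): the metric neighbourhood of a smaller sigma-open set
  \<open>V\<close> lies in \<open>U\<close>, so a perturbation that vanishes in the metric cannot
  leave \<open>U\<close>. It later moves the limit from \<open>u t\<close> to nearby points of small
  slope.\<close>

lemma limitin_perturb:
  assumes w: "limitin \<sigma> w u sequentially" and d: "(\<lambda>n. dist (w n) (z n)) \<longlonglongrightarrow> 0"
  shows "limitin \<sigma> z u sequentially"
  unfolding limitin_def
proof (intro conjI allI impI)
  fix U assume U: "openin \<sigma> U \<and> u \<in> U"
  then obtain V e where V: "openin \<sigma> V" "u \<in> V" "0 < e" "\<And>y v. v \<in> V \<Longrightarrow> dist y v < e \<Longrightarrow> y \<in> U"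
    using open_neighbourhood by blast
  have "\<forall>\<^sub>F n in sequentially. w n \<in> V"
    using w V unfolding limitin_def by blast
  moreover have "\<forall>\<^sub>F n in sequentially. dist (w n) (z n) < e"
    using d V(3) by (rule order_tendstoD)
  ultimately show "\<forall>\<^sub>F n in sequentially. z n \<in> U"
    by eventually_elim (use V(4) in \<open>auto simp: dist_commute\<close>)
qed simp

lemma limitin_of_tendsto:
  assumes "w \<longlonglongrightarrow> x"
  shows "limitin \<sigma> w x sequentially"
proof (rule limitin_perturb[OF limitin_const_seq])
  show "(\<lambda>n. dist x (w n)) \<longlonglongrightarrow> 0"
    using tendsto_dist[OF tendsto_const assms, of x] by simp
qed

lemma phi_not_MInf [simp]: "\<phi> u \<noteq> - \<infinity>"
  using proper by (simp add: proper_def)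

lemma phi_lsc:
  assumes "bounded (range w)" "limitin \<sigma> w u sequentially"
  shows "\<phi> u \<le> liminf (\<lambda>n. \<phi> (w n))"
  using lscc assms unfolding LSCC_def by blast

lemma phi_lsc_dist:
  assumes "w \<longlonglongrightarrow> u"
  shows "\<phi> u \<le> liminf (\<lambda>n. \<phi> (w n))"
  by (rule phi_lsc[OF convergent_imp_bounded[OF assms] limitin_of_tendsto[OF assms]])

text \<open>Metric convergence implies sigma-convergence, so the lower semicontinuity assumption
  makes all sublevel sets of \<phi> closed in the metric.\<close>

lemma phi_measurable [measurable]: "\<phi> \<in> borel_measurable borel"
  unfolding borel_measurable_iff_Iic_ereal
proof
  fix a
  have "closed (\<phi> -` {..a})"
    unfolding closed_sequential_limits
  proof (intro allI impI)
    fix x l assume xl: "(\<forall>n. x n \<in> \<phi> -` {..a}) \<and> x \<longlonglongrightarrow> l"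
    then have "\<phi> l \<le> liminf (\<lambda>n. \<phi> (x n))"
      by (intro phi_lsc_dist) simp
    also have "\<dots> \<le> liminf (\<lambda>n::nat. a)"
      using xl by (intro Liminf_mono always_eventually) auto
    finally show "l \<in> \<phi> -` {..a}"
      by (simp add: Liminf_const)
  qed
  then show "\<phi> -` {..a} \<inter> space borel \<in> sets borel"
    by simp
qed

lemma phi_lower_bound: "ereal (- B * (dist u v)\<^sup>2 - quad_bound A B ustar v) \<le> \<phi> u"
  using lscc unfolding LSCC_def by blast

lemma A_nonneg: "0 \<le> A" and B_nonneg: "0 \<le> B"
  using lscc unfolding LSCC_def by auto

lemma quad_bound_nonneg: "0 \<le> quad_bound A B ustar v"
  using A_nonneg B_nonneg by (simp add: quad_bound_def)

text \<open>The compactness assumption asks for a bound along the whole sequence; dropping the first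
  \<open>N\<close> terms lets an eventual bound suffice.\<close>

lemma ex_limitin_subseq:
  assumes "\<And>n::nat. N \<le> n \<Longrightarrow> \<phi> (w n) \<le> ereal C" "bounded (range w)"
  shows "\<exists>r l. strict_mono (r :: nat \<Rightarrow> nat) \<and> limitin \<sigma> (w \<circ> r) l sequentially"
proof -
  define z where "z n = w (n + N)" for n
  have "(SUP n. \<phi> (z n)) \<le> ereal C"
    by (intro SUP_least) (simp add: z_def assms)
  then have "(SUP n. \<phi> (z n)) < \<infinity>"
    by (rule le_less_trans) simp
  moreover have "bounded (range z)"
    by (rule bounded_subset[OF assms(2)]) (auto simp: z_def)
  ultimately obtain r l where r: "strict_mono (r :: nat \<Rightarrow> nat)" "limitin \<sigma> (z \<circ> r) l sequentially"
    using lscc unfolding LSCC_def by blast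
  show ?thesis
  proof (intro exI conjI)
    show "strict_mono (\<lambda>n. r n + N)"
      using r(1) by (simp add: strict_mono_def)
    show "limitin \<sigma> (w \<circ> (\<lambda>n. r n + N)) l sequentially"
      using r(2) by (simp add: z_def o_def)
  qed
qed

section \<open>Pointwise compactness of sequences of curves\<close>

lemma ex_pointwise_limit:
  fixes w :: "nat \<Rightarrow> real \<Rightarrow> 'a"
  assumes D: "countable D" "D \<subseteq> {0..}" "\<And>t e. 0 \<le> t \<Longrightarrow> 0 < e \<Longrightarrow> \<exists>q\<in>D. \<bar>q - t\<bar> < e"
    and sub: "\<And>q. q \<in> D \<Longrightarrow> \<exists>C. \<forall>\<^sub>F n in sequentially. \<phi> (w n q) \<le> ereal C"
    and bdd: "\<And>q. q \<in> D \<Longrightarrow> bounded (range (\<lambda>n. w n q))"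
    and equi: "\<And>T e. 0 < e \<Longrightarrow> \<exists>d>0. \<forall>\<^sub>F n in sequentially. \<forall>s\<in>{0..T}. \<forall>t\<in>{0..T}. \<bar>s - t\<bar> < d \<longrightarrow> dist (w n s) (w n t) < e"
  obtains r u where "strict_mono (r :: nat \<Rightarrow> nat)" "\<And>t. 0 \<le> t \<Longrightarrow> limitin \<sigma> (\<lambda>k. w (r k) t) (u t) sequentially"
proof -
  have "D \<noteq> {}"
    using D(3)[of 0 1] by auto
  define q where "q = from_nat_into D"
  have q: "range q = D"
    unfolding q_def using \<open>D \<noteq> {}\<close> D(1) by (rule range_from_nat_into)
  define P where "P n s \<longleftrightarrow> (\<exists>l. limitin \<sigma> (\<lambda>k. w (s k) (q n)) l sequentially)" for n and s :: "nat \<Rightarrow> nat"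
  interpret subseqs P
  proof
    fix n and s :: "nat \<Rightarrow> nat" assume s: "strict_mono s"
    have qn: "q n \<in> D" using q by auto
    obtain C N where CN: "\<And>n'. N \<le> n' \<Longrightarrow> \<phi> (w n' (q n)) \<le> ereal C"
      using sub[OF qn] unfolding eventually_sequentially by blast
    have "\<exists>r l. strict_mono (r :: nat \<Rightarrow> nat) \<and> limitin \<sigma> ((\<lambda>k. w (s k) (q n)) \<circ> r) l sequentially"
    proof (rule ex_limitin_subseq)
      show "\<phi> (w (s k) (q n)) \<le> ereal C" if "N \<le> k" for k
        using CN seq_suble[OF s, of k] that by (meson le_trans)
      show "bounded (range (\<lambda>k. w (s k) (q n)))"
        by (rule bounded_subset[OF bdd[OF qn]]) auto
    qed
    then show "\<exists>r'. strict_mono r' \<and> P n (s \<circ> r')"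
      by (auto simp: P_def o_def)
  qed
  define r where "r = diagseq"
  have r: "strict_mono r"
    unfolding r_def by (rule subseq_diagseq)
  have "\<exists>l. limitin \<sigma> (\<lambda>k. w (r k) p) l sequentially" if "p \<in> D" for p
  proof -
    obtain n where n: "p = q n" using \<open>p \<in> D\<close> q by auto
    \<comment> \<open>The diagonal sequence is a subsequence of stage n only from index
      \<open>Suc n\<close> on; the finite shift is undone afterwards.\<close>
    have "P n (diagseq \<circ> ((+) (Suc n)))"
    proof (rule diagseq_holds)
      fix r s n assume "strict_mono (r :: nat \<Rightarrow> nat)" "P n s"
      then show "P n (s \<circ> r)"
        unfolding P_def using limitin_subsequence[of r \<sigma> "\<lambda>k. w (s k) (q n)"] by (auto simp: o_def)
    qed
    then obtain l where "limitin \<sigma> (\<lambda>k. w (r (k + Suc n)) p) l sequentially"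
      by (auto simp: P_def n r_def o_def add.commute)
    then show ?thesis
      using limitin_sequentially_offset_rev[of \<sigma> "\<lambda>k. w (r k) p"] by blast
  qed
  then obtain l where l: "\<And>p. p \<in> D \<Longrightarrow> limitin \<sigma> (\<lambda>k. w (r k) p) (l p) sequentially"
    by metis
  have "\<exists>x. limitin \<sigma> (\<lambda>k. w (r k) t) x sequentially" if t: "0 \<le> t" for t
  proof -
    define T where "T = t + 1"
    have "\<exists>p. p \<in> D \<and> \<bar>p - t\<bar> < inverse (real (Suc j))" for j
      using D(3)[OF t, of "inverse (real (Suc j))"] by auto
    then have "\<forall>j. \<exists>p. p \<in> D \<and> \<bar>p - t\<bar> < inverse (real (Suc j))" by (rule allI)
    from choice[OF this] obtain p where p: "\<forall>j. p j \<in> D \<and> \<bar>p j - t\<bar> < inverse (real (Suc j))"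
      by (elim exE)
    have pT: "p j \<in> {0..T}" for j
    proof -
      have "inverse (real (Suc j)) \<le> 1"
        by (simp add: inverse_le_1_iff)
      moreover have "p j \<in> D" "\<bar>p j - t\<bar> < inverse (real (Suc j))"
        using p by auto
      moreover have "0 \<le> p j"
        using \<open>p j \<in> D\<close> D(2) by auto
      ultimately show ?thesis
        by (simp add: T_def)
    qed
    have pt: "p \<longlonglongrightarrow> t"
    proof (rule LIM_zero_cancel, rule Lim_null_comparison)
      show "\<forall>\<^sub>F j in sequentially. norm (p j - t) \<le> inverse (real (Suc j))"
        using p by (auto intro!: always_eventually less_imp_le)
      show "(\<lambda>j. inverse (real (Suc j))) \<longlonglongrightarrow> 0"
        by (rule LIMSEQ_inverse_real_of_nat)
    qed
    have equi': "\<exists>d>0. \<forall>\<^sub>F n in sequentially. \<forall>s\<in>{0..T}. \<forall>t\<in>{0..T}. \<bar>s - t\<bar> < d \<longrightarrow> dist (w (r n) s) (w (r n) t) < e"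
      if e: "0 < e" for e
    proof -
      obtain d where d: "d > 0" "\<forall>\<^sub>F n in sequentially. \<forall>s\<in>{0..T}. \<forall>t\<in>{0..T}. \<bar>s - t\<bar> < d \<longrightarrow> dist (w n s) (w n t) < e"
        using equi[OF e, of T] by auto
      show ?thesis
        using d(1) eventually_subseq[OF r d(2)] by blast
    qed
    \<comment> \<open>The candidates for the limit at t are the limits at dense times
      \<open>p j\<close> tending to t. If two of them were further apart than the oscillation
      allowed by equicontinuity, (MT1) would show this along the sequence.\<close>
    have "Cauchy (\<lambda>j. l (p j))"
      unfolding Cauchy_def
    proof (intro allI impI)
      fix e :: real assume e: "0 < e"
      then obtain d where d: "d > 0"
        "\<forall>\<^sub>F n in sequentially. \<forall>s\<in>{0..T}. \<forall>t\<in>{0..T}. \<bar>s - t\<bar> < d \<longrightarrow> dist (w (r n) s) (w (r n) t) < e / 2"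
        using equi'[of "e / 2"] by auto
      have "Cauchy p"
        using pt by (rule LIMSEQ_imp_Cauchy)
      then obtain M where M: "\<And>m n. m \<ge> M \<Longrightarrow> n \<ge> M \<Longrightarrow> dist (p m) (p n) < d"
        using d(1) unfolding Cauchy_def by blast
      have "dist (l (p m)) (l (p n)) < e" if mn: "m \<ge> M" "n \<ge> M" for m n
      proof (rule ccontr)
        assume "\<not> dist (l (p m)) (l (p n)) < e"
        then have "e / 2 < dist (l (p m)) (l (p n))"
          using e by simp
        then have "\<forall>\<^sub>F k in sequentially. e / 2 < dist (w (r k) (p m)) (w (r k) (p n))"
          using p by (intro eventually_dist_greater[OF l l]) auto
        with d(2) have "\<forall>\<^sub>F k in sequentially. False"
        proof eventually_elim
          case (elim k)
          then show False
            using pT M[OF mn] by (force simp: dist_real_def)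
        qed
        then show False by simp
      qed
      then show "\<exists>M. \<forall>m\<ge>M. \<forall>n\<ge>M. dist (l (p m)) (l (p n)) < e"
        by blast
    qed
    then obtain x where x: "(\<lambda>j. l (p j)) \<longlonglongrightarrow> x"
      using Cauchy_convergent convergent_def by blast
    \<comment> \<open>Convergence at one dense time close to t is carried over to t by (MT2), with
      equicontinuity supplying the small metric distance.\<close>
    have "limitin \<sigma> (\<lambda>k. w (r k) t) x sequentially"
      unfolding limitin_def
    proof (intro conjI allI impI)
      fix U assume U: "openin \<sigma> U \<and> x \<in> U"
      then obtain V e where V: "openin \<sigma> V" "x \<in> V" "0 < e" "\<And>y v. v \<in> V \<Longrightarrow> dist y v < e \<Longrightarrow> y \<in> U"
        using open_neighbourhood by blast
      obtain d where d: "d > 0"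
        "\<forall>\<^sub>F n in sequentially. \<forall>s\<in>{0..T}. \<forall>t\<in>{0..T}. \<bar>s - t\<bar> < d \<longrightarrow> dist (w (r n) s) (w (r n) t) < e"
        using equi'[OF V(3)] by auto
      have "\<forall>\<^sub>F j in sequentially. l (p j) \<in> V"
        using limitin_of_tendsto[OF x] V unfolding limitin_def by blast
      moreover have "\<forall>\<^sub>F j in sequentially. dist (p j) t < d"
        using tendstoD[OF pt d(1)] .
      ultimately have "\<forall>\<^sub>F j in sequentially. l (p j) \<in> V \<and> dist (p j) t < d"
        by (rule eventually_conj)
      then obtain j where j: "l (p j) \<in> V" "dist (p j) t < d"
        by (auto simp: eventually_sequentially)
      have "\<forall>\<^sub>F k in sequentially. w (r k) (p j) \<in> V"
        using l[of "p j"] p V(1) j(1) unfolding limitin_def by blast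
      with d(2) show "\<forall>\<^sub>F k in sequentially. w (r k) t \<in> U"
      proof eventually_elim
        case (elim k)
        have "dist (w (r k) t) (w (r k) (p j)) < e"
          using elim(1) pT[of j] t j(2) by (auto simp: T_def dist_real_def abs_minus_commute)
        with elim(2) show ?case by (rule V(4))
      qed
    qed simp
    then show ?thesis by blast
  qed
  then obtain u where "\<And>t. 0 \<le> t \<Longrightarrow> limitin \<sigma> (\<lambda>k. w (r k) t) (u t) sequentially"
    by metis
  with r show thesis by (rule that)
qed

text \<open>A minimizer of \<open>y \<mapsto> \<phi> y + s * dist x y\<close> on the closed ball has slope at most \<open>s\<close>
  unless it lies on the boundary.\<close>

lemma ex_descent_point:
  assumes x: "\<phi> x < \<infinity>" and r: "0 < r" and s: "0 < s"
    and slope: "\<And>y. dist x y \<le> r \<Longrightarrow> \<phi> y \<le> \<phi> x \<Longrightarrow> ennreal s < local_slope \<phi> y"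
  shows "\<exists>y. dist x y = r \<and> \<phi> y + ereal (s * r) \<le> \<phi> x"
proof -
  define \<Psi> where "\<Psi> y = \<phi> y + ereal (s * dist x y)" for y
  define m where "m = (INF y\<in>cball x r. \<Psi> y)"
  have m_le: "m \<le> \<Psi> y" if "dist x y \<le> r" for y
    unfolding m_def using that by (intro INF_lower) simp
  have "\<Psi> ` cball x r \<noteq> {}"
    using r by auto
  from Inf_as_limit[OF this] obtain f where f: "\<And>n. f n \<in> \<Psi> ` cball x r" "f \<longlonglongrightarrow> m"
    unfolding m_def by blast
  have "\<forall>n. \<exists>y. y \<in> cball x r \<and> f n = \<Psi> y"
    using f(1) by blast
  from choice[OF this] obtain z where z: "\<forall>n. z n \<in> cball x r \<and> f n = \<Psi> (z n)"
    by (elim exE)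
  obtain a where a: "\<phi> x = ereal a"
    using x by (cases "\<phi> x") auto
  have "m \<le> ereal a"
    using m_le[of x] r a by (simp add: \<Psi>_def)
  then have "m < ereal (a + 1)"
    by (rule le_less_trans) simp
  with f(2) have "\<forall>\<^sub>F n in sequentially. f n < ereal (a + 1)"
    by (rule order_tendstoD)
  then obtain N where N: "\<And>n. N \<le> n \<Longrightarrow> f n < ereal (a + 1)"
    by (auto simp: eventually_sequentially)
  have bz: "bounded (range z)"
    by (rule bounded_subset[OF bounded_cball[of x r]]) (use z in auto)
  have "\<phi> (z n) \<le> ereal (a + 1)" if "N \<le> n" for n
  proof -
    have "\<phi> (z n) + 0 \<le> \<phi> (z n) + ereal (s * dist x (z n))"
      using s by (intro add_left_mono) simp
    also have "\<dots> \<le> ereal (a + 1)"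
      using N[OF that] z by (simp add: \<Psi>_def less_imp_le)
    finally show ?thesis by simp
  qed
  from ex_limitin_subseq[OF this bz] obtain q y where
    q: "strict_mono (q :: nat \<Rightarrow> nat)" and y: "limitin \<sigma> (z \<circ> q) y sequentially"
    by blast
  have xy: "dist x y \<le> r"
  proof (rule ccontr)
    assume "\<not> dist x y \<le> r"
    then have "\<forall>\<^sub>F n in sequentially. r < dist x ((z \<circ> q) n)"
      by (intro eventually_dist_greater[OF limitin_const_seq y]) simp
    then have "\<forall>\<^sub>F n::nat in sequentially. False"
      by eventually_elim (use z in \<open>auto simp: not_le[symmetric]\<close>)
    then show False by simp
  qed
  have "\<phi> y \<le> liminf (\<lambda>n. \<phi> ((z \<circ> q) n))"
    by (rule phi_lsc[OF bounded_subset[OF bz] y]) auto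
  moreover have "ereal (s * dist x y) \<le> liminf (\<lambda>n. ereal (s * dist x ((z \<circ> q) n)))"
    unfolding le_Liminf_iff
  proof (intro allI impI)
    fix b assume b: "b < ereal (s * dist x y)"
    show "\<forall>\<^sub>F n in sequentially. b < ereal (s * dist x ((z \<circ> q) n))"
    proof (cases b)
      case (real c)
      have "c / s < dist x y"
        using b real s by (simp add: pos_divide_less_eq mult.commute)
      then have "\<forall>\<^sub>F n in sequentially. c / s < dist x ((z \<circ> q) n)"
        by (rule eventually_dist_greater[OF limitin_const_seq y])
      then show ?thesis
        by eventually_elim (use real s in \<open>simp add: pos_divide_less_eq mult.commute\<close>)
    qed (use b in auto)
  qed
  moreover from this have "liminf (\<lambda>n. ereal (s * dist x ((z \<circ> q) n))) \<noteq> - \<infinity>"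
    by auto
  \<comment> \<open>Finiteness of this lower limit excludes a sum of opposite infinities in the
    superadditivity of \<open>liminf\<close>.\<close>
  moreover have "liminf (\<lambda>n. ereal (s * dist x ((z \<circ> q) n))) \<noteq> \<infinity>"
  proof -
    have "liminf (\<lambda>n. ereal (s * dist x ((z \<circ> q) n))) \<le> liminf (\<lambda>n::nat. ereal (s * r))"
      using z s by (intro Liminf_mono always_eventually) auto
    then show ?thesis by (auto simp: Liminf_const)
  qed
  ultimately have "\<Psi> y \<le> liminf (\<lambda>n. \<phi> ((z \<circ> q) n) + ereal (s * dist x ((z \<circ> q) n)))"
    unfolding \<Psi>_def by (intro order_trans[OF add_mono ereal_liminf_add_mono]) auto
  also have "\<dots> = liminf (f \<circ> q)"
    using z by (simp add: \<Psi>_def o_def)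
  also have "\<dots> = m"
    using LIMSEQ_subseq_LIMSEQ[OF f(2) q] by (intro lim_imp_Liminf) auto
  finally have "\<Psi> y \<le> m" .
  then have min: "\<Psi> y \<le> \<Psi> z'" if "dist x z' \<le> r" for z'
    using m_le[OF that] by (rule order_trans)
  have yx: "\<phi> y + ereal (s * dist x y) \<le> ereal a"
    using min[of x] r a by (simp add: \<Psi>_def)
  then obtain b where b: "\<phi> y = ereal b"
    by (cases "\<phi> y") auto
  have ba: "b + s * dist x y \<le> a"
    using yx b by simp
  have "dist x y = r"
  proof (rule ccontr)
    assume "dist x y \<noteq> r"
    then have lt: "dist x y < r" using xy by simp
    have "\<forall>\<^sub>F v in at y. dist v y < r - dist x y"
      unfolding eventually_at using lt by (intro exI[of _ "r - dist x y"]) auto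
    moreover have "\<forall>\<^sub>F v in at y. v \<noteq> y"
      by (simp add: eventually_at_filter)
    \<comment> \<open>Points v close to y stay in the ball, so minimality gives \<phi> y - \<phi> v
      \<le> s (dist x v - dist x y) \<le> s dist y v. The slope at y is then at most s, which the
      strict inequality in \<open>slope\<close> forbids.\<close>
    ultimately have "\<forall>\<^sub>F v in at y. e2ennreal (max 0 (\<phi> y - \<phi> v)) / ennreal (dist y v) \<le> ennreal s"
    proof eventually_elim
      case (elim v)
      have xv: "dist x v \<le> dist x y + dist y v"
        by (rule dist_triangle)
      then have "\<Psi> y \<le> \<Psi> v"
        using elim(1) by (intro min) (simp add: dist_commute)
      show ?case
      proof (cases "\<phi> v")
        case (real c)
        have "b + s * dist x y \<le> c + s * dist x v"
          using \<open>\<Psi> y \<le> \<Psi> v\<close> real b by (simp add: \<Psi>_def)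
        also have "s * dist x v \<le> s * (dist x y + dist y v)"
          using xv s by (intro mult_left_mono) auto
        finally have "max 0 (b - c) \<le> s * dist y v"
          using s by (simp add: distrib_left)
        moreover have "0 < dist y v"
          using elim(2) by simp
        ultimately have "max 0 (b - c) / dist y v \<le> s"
          by (simp add: pos_divide_le_eq)
        moreover have "max 0 (\<phi> y - \<phi> v) = ereal (max 0 (b - c))"
          using real b by (simp add: max_def)
        then have "e2ennreal (max 0 (\<phi> y - \<phi> v)) = ennreal (max 0 (b - c))"
          by (simp only: e2ennreal_ereal)
        ultimately show ?thesis
          using \<open>0 < dist y v\<close> by (simp only: divide_ennreal ennreal_leI max.cobounded1)
      next
        case PInf
        moreover have "e2ennreal 0 = 0"
          using e2ennreal_ereal[of 0] by (simp add: zero_ereal_def)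
        ultimately show ?thesis using b by (simp add: max_def)
      qed simp
    qed
    then have "Limsup (at y) (\<lambda>v. e2ennreal (max 0 (\<phi> y - \<phi> v)) / ennreal (dist y v)) \<le> ennreal s"
      by (rule Limsup_bounded)
    then have "local_slope \<phi> y \<le> ennreal s"
      using b by (simp add: local_slope_def edom_def)
    moreover have "b \<le> a"
      using ba mult_nonneg_nonneg[OF less_imp_le[OF s] zero_le_dist[of x y]] by linarith
    then have "ennreal s < local_slope \<phi> y"
      using xy a b by (intro slope) auto
    ultimately show False by simp
  qed
  with yx a show ?thesis
    by (intro exI[of _ y]) simp
qed

text \<open>Each step moves by R / n and lowers the energy by s R / n. The invariant keeps the i-th
  point within i R / n of x and below the level of x, so the ball for the next step is still inside
  the region where \<open>slope\<close> holds.\<close>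

lemma descent_chain:
  assumes x: "\<phi> x < \<infinity>" and R: "0 < R" and s: "0 < s" and n: "0 < n"
    and slope: "\<And>y. dist x y \<le> R \<Longrightarrow> \<phi> y \<le> \<phi> x \<Longrightarrow> ennreal s < local_slope \<phi> y"
  obtains z :: "nat \<Rightarrow> 'a" where "z 0 = x"
    "\<And>i j. i \<le> n \<Longrightarrow> j \<le> n \<Longrightarrow> dist (z i) (z j) \<le> R / real n * \<bar>real i - real j\<bar>"
    "\<And>i. i \<le> n \<Longrightarrow> \<phi> (z i) + ereal (s * (R / real n) * real i) \<le> \<phi> x"
proof -
  define r where "r = R / real n"
  have r: "0 < r" using R n by (simp add: r_def)
  have "\<exists>z. \<forall>i. (i \<le> n \<longrightarrow> dist x (z i) \<le> real i * r \<and> \<phi> (z i) + ereal (s * r * real i) \<le> \<phi> x) \<and>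
      (i < n \<longrightarrow> dist (z i) (z (Suc i)) = r)"
  proof (rule dependent_nat_choice)
    show "\<exists>y. 0 \<le> n \<longrightarrow> dist x y \<le> real 0 * r \<and> \<phi> y + ereal (s * r * real 0) \<le> \<phi> x"
      by (intro exI[of _ x]) (simp add: zero_ereal_def[symmetric])
  next
    fix y i
    assume y: "i \<le> n \<longrightarrow> dist x y \<le> real i * r \<and> \<phi> y + ereal (s * r * real i) \<le> \<phi> x"
    show "\<exists>y'. (Suc i \<le> n \<longrightarrow> dist x y' \<le> real (Suc i) * r \<and> \<phi> y' + ereal (s * r * real (Suc i)) \<le> \<phi> x) \<and>
        (i < n \<longrightarrow> dist y y' = r)"
    proof (cases "i < n")
      case True
      obtain a where a: "\<phi> x = ereal a"
        using x by (cases "\<phi> x") auto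
      have y1: "dist x y \<le> real i * r" "\<phi> y + ereal (s * r * real i) \<le> ereal a"
        using y True a by auto
      then obtain b where b: "\<phi> y = ereal b"
        by (cases "\<phi> y") auto
      have ba: "b + s * r * real i \<le> a"
        using y1 b by simp
      have "\<exists>y'. dist y y' = r \<and> \<phi> y' + ereal (s * r) \<le> \<phi> y"
      proof (rule ex_descent_point[OF _ r s])
        show "\<phi> y < \<infinity>" using b by simp
        fix y' assume y': "dist y y' \<le> r" "\<phi> y' \<le> \<phi> y"
        have "real (Suc i) * r \<le> real n * r"
          using True r by (intro mult_right_mono) auto
        also have "real n * r = R"
          using n by (simp add: r_def)
        finally have "real i * r + r \<le> R"
          by (simp add: distrib_right)
        then have "dist x y' \<le> R"
          using dist_triangle[of x y' y] y1(1) y'(1) by linarith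
        moreover have "0 \<le> s * r * real i"
          using s r by simp
        then have "\<phi> y \<le> \<phi> x"
          using ba a b by simp
        then have "\<phi> y' \<le> \<phi> x"
          using y'(2) by simp
        ultimately show "ennreal s < local_slope \<phi> y'"
          by (rule slope)
      qed
      then obtain y' where y': "dist y y' = r" "\<phi> y' + ereal (s * r) \<le> ereal b"
        using b by auto
      then obtain c where c: "\<phi> y' = ereal c"
        by (cases "\<phi> y'") auto
      have "dist x y' \<le> real (Suc i) * r"
        using dist_triangle[of x y' y] y1(1) y'(1) by (simp add: distrib_right)
      moreover have "\<phi> y' + ereal (s * r * real (Suc i)) \<le> \<phi> x"
        using y'(2) ba a c by (simp add: distrib_left)
      ultimately show ?thesis
        using y'(1) by blast
    qed auto
  qed
  then obtain z where z: "\<forall>i. (i \<le> n \<longrightarrow> dist x (z i) \<le> real i * r \<and> \<phi> (z i) + ereal (s * r * real i) \<le> \<phi> x) \<and>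
      (i < n \<longrightarrow> dist (z i) (z (Suc i)) = r)"
    by (elim exE)
  have z0: "z 0 = x"
    using z[THEN spec, of 0] by simp
  have d: "dist (z i) (z (i + k)) \<le> r * real k" if "i + k \<le> n" for i k
    using that
  proof (induction k)
    case (Suc k)
    have "dist (z i) (z (i + Suc k)) \<le> dist (z i) (z (i + k)) + dist (z (i + k)) (z (Suc (i + k)))"
      using dist_triangle by simp
    also have "dist (z (i + k)) (z (Suc (i + k))) = r"
      using z Suc.prems by simp
    finally show ?case
      using Suc by (simp add: distrib_left)
  qed simp
  have d': "dist (z i) (z j) \<le> r * \<bar>real i - real j\<bar>" if "i \<le> n" "j \<le> n" for i j
  proof (cases "i \<le> j")
    case True
    then show ?thesis
      using d[of i "j - i"] that by (simp add: of_nat_diff)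
  next
    case False
    then show ?thesis
      using d[of j "i - j"] that by (simp add: of_nat_diff dist_commute)
  qed
  show thesis
    using z0 d' z by (intro that[of z]) (auto simp: r_def)
qed

text \<open>A lower bound on the slope produces a curve along which \<open>\<phi>\<close> decreases: the points
  reached by descent steps of length \<open>R / n\<close> converge as \<open>n\<close> tends to infinity.\<close>

lemma ex_descending_curve:
  assumes x: "\<phi> x < \<infinity>" and R: "0 < R" and s: "0 < s"
    and slope: "\<And>y. dist x y \<le> R \<Longrightarrow> \<phi> y \<le> \<phi> x \<Longrightarrow> ennreal s < local_slope \<phi> y"
  obtains v where "v 0 = x"
    "\<And>t t'. 0 \<le> t \<Longrightarrow> 0 \<le> t' \<Longrightarrow> dist (v t) (v t') \<le> s * \<bar>min t (R / s) - min t' (R / s)\<bar>"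
    "\<And>t. 0 \<le> t \<Longrightarrow> \<phi> (v t) + ereal (s\<^sup>2 * min t (R / s)) \<le> \<phi> x"
proof -
  define T where "T = R / s"
  have T: "0 < T" using R s by (simp add: T_def)
  have sT: "s * T = R" using s by (simp add: T_def)
  obtain a where a: "\<phi> x = ereal a"
    using x by (cases "\<phi> x") auto
  have "\<exists>w. w 0 = x \<and> (\<forall>t\<ge>0. \<forall>t'\<ge>0. dist (w t) (w t') \<le> s * \<bar>min t T - min t' T\<bar> + R / real (Suc m)) \<and>
      (\<forall>t\<ge>0. \<phi> (w t) \<le> ereal (a - s\<^sup>2 * min t T + s * (R / real (Suc m))))" for m
  proof -
    define n where "n = Suc m"
    have n: "0 < n" by (simp add: n_def)
    obtain z where z: "z 0 = x"
      "\<And>i j. i \<le> n \<Longrightarrow> j \<le> n \<Longrightarrow> dist (z i) (z j) \<le> R / real n * \<bar>real i - real j\<bar>"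
      "\<And>i. i \<le> n \<Longrightarrow> \<phi> (z i) + ereal (s * (R / real n) * real i) \<le> \<phi> x"
      using descent_chain[OF x R s n slope] by blast
    \<comment> \<open>Time is rescaled to the number of steps, so that speed s covers the length R
      in time T. Rounding down to \<open>i t\<close> misses less than one step, which is the error R
      / n below.\<close>
    define p where "p t = real n * min t T / T" for t
    define i where "i t = nat \<lfloor>p t\<rfloor>" for t
    have p: "0 \<le> p t" "p t \<le> real n" if "0 \<le> t" for t
      using that T n by (auto simp: p_def pos_divide_le_eq intro!: mult_left_mono)
    have i: "real (i t) \<le> p t" "p t < real (i t) + 1" if "0 \<le> t" for t
      using p[OF that] by (auto simp: i_def of_nat_nat)
    have i_n: "i t \<le> n" if "0 \<le> t" for t
      using order_trans[OF i(1)[OF that] p(2)[OF that]] by simp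
    have Rp: "R / real n * p t = s * min t T" for t
      using n T by (simp add: p_def sT[symmetric])
    have 1: "dist (z (i t)) (z (i t')) \<le> s * \<bar>min t T - min t' T\<bar> + R / real n" if "0 \<le> t" "0 \<le> t'" for t t'
    proof -
      have "dist (z (i t)) (z (i t')) \<le> R / real n * \<bar>real (i t) - real (i t')\<bar>"
        by (intro z(2) i_n that)
      also have "\<dots> \<le> R / real n * (\<bar>p t - p t'\<bar> + 1)"
        using i[OF that(1)] i[OF that(2)] R n by (intro mult_left_mono) auto
      also have "\<dots> = \<bar>R / real n * (p t - p t')\<bar> + R / real n"
        using R n by (simp add: distrib_left abs_mult)
      also have "R / real n * (p t - p t') = R / real n * p t - R / real n * p t'"
        by (rule right_diff_distrib)
      also have "\<bar>R / real n * p t - R / real n * p t'\<bar> = s * \<bar>min t T - min t' T\<bar>"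
        unfolding Rp using s by (simp add: abs_mult flip: right_diff_distrib)
      finally show ?thesis .
    qed
    have 2: "\<phi> (z (i t)) \<le> ereal (a - s\<^sup>2 * min t T + s * (R / real n))" if "0 \<le> t" for t
    proof -
      have le: "\<phi> (z (i t)) + ereal (s * (R / real n) * real (i t)) \<le> ereal a"
        using z(3)[OF i_n[OF that]] a by simp
      then obtain b where b: "\<phi> (z (i t)) = ereal b"
        by (cases "\<phi> (z (i t))") auto
      have "s * (R / real n * p t) \<le> s * (R / real n * (real (i t) + 1))"
        using i[OF that] R n s by (intro mult_left_mono) auto
      then have "s * (s * min t T) \<le> s * (R / real n) * real (i t) + s * (R / real n)"
        unfolding Rp by (simp add: distrib_left)
      then show ?thesis
        using le b by (simp add: power2_eq_square)
    qed
    show ?thesis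
      using 1 2 z(1) T by (intro exI[of _ "\<lambda>t. z (i t)"]) (auto simp: n_def[symmetric] i_def p_def)
  qed
  then have "\<forall>m. \<exists>w. w 0 = x \<and> (\<forall>t\<ge>0. \<forall>t'\<ge>0. dist (w t) (w t') \<le> s * \<bar>min t T - min t' T\<bar> + R / real (Suc m)) \<and>
      (\<forall>t\<ge>0. \<phi> (w t) \<le> ereal (a - s\<^sup>2 * min t T + s * (R / real (Suc m))))"
    by (rule allI)
  from choice[OF this] obtain w where w: "\<forall>m. w m 0 = x \<and>
      (\<forall>t\<ge>0. \<forall>t'\<ge>0. dist (w m t) (w m t') \<le> s * \<bar>min t T - min t' T\<bar> + R / real (Suc m)) \<and>
      (\<forall>t\<ge>0. \<phi> (w m t) \<le> ereal (a - s\<^sup>2 * min t T + s * (R / real (Suc m))))"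
    by (elim exE)
  have w0: "w m 0 = x" for m
    using w by blast
  have wd: "dist (w m t) (w m t') \<le> s * \<bar>min t T - min t' T\<bar> + R / real (Suc m)" if "0 \<le> t" "0 \<le> t'" for m t t'
    using w that by blast
  have wp: "\<phi> (w m t) \<le> ereal (a - s\<^sup>2 * min t T + s * (R / real (Suc m)))" if "0 \<le> t" for m t
    using w that by blast
  have R0: "(\<lambda>m. R / real (Suc m)) \<longlonglongrightarrow> 0"
    using tendsto_mult_right_zero[OF LIMSEQ_inverse_real_of_nat, of R] by (simp add: divide_inverse)
  have wb: "bounded (range (\<lambda>m. w m t))" if "0 \<le> t" for t
  proof (rule bounded_subset[OF bounded_cball[of x "s * T + R"]])
    have "dist x (w m t) \<le> s * T + R" for m
    proof -
      have "dist x (w m t) \<le> s * \<bar>min 0 T - min t T\<bar> + R / real (Suc m)"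
        using wd[of 0 t m] that w0 by simp
      also have "\<dots> \<le> s * T + R"
        using that T s R by (intro add_mono mult_left_mono) (auto simp: field_simps)
      finally show ?thesis .
    qed
    then show "range (\<lambda>m. w m t) \<subseteq> cball x (s * T + R)" by auto
  qed
  \<comment> \<open>The energies are bounded at every time, so rational times serve as dense set.
    The interpolations jump by R / (m + 1), hence the curves are equicontinuous only for large
    m.\<close>
  obtain r v where r: "strict_mono (r :: nat \<Rightarrow> nat)" and v: "\<And>t. 0 \<le> t \<Longrightarrow> limitin \<sigma> (\<lambda>k. w (r k) t) (v t) sequentially"
  proof (rule ex_pointwise_limit[of "\<rat> \<inter> {0..}" w])
    show "countable (\<rat> \<inter> {0..} :: real set)"
      using countable_rat by (rule countable_subset[rotated]) auto
    show "\<exists>q\<in>\<rat> \<inter> {0..}. \<bar>q - t\<bar> < e" if te: "0 \<le> t" "0 < e" for t e :: real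
    proof -
      obtain q where "q \<in> \<rat>" "t < q" "q < t + e"
        using Rats_dense_in_real[of t "t + e"] te by auto
      then show ?thesis
        using te by (intro bexI[of _ q]) auto
    qed
    show "\<exists>C. \<forall>\<^sub>F m in sequentially. \<phi> (w m q) \<le> ereal C" if "q \<in> \<rat> \<inter> {0..}" for q
    proof (intro exI[of _ "a + s * R"] always_eventually allI)
      fix m
      have "\<phi> (w m q) \<le> ereal (a - s\<^sup>2 * min q T + s * (R / real (Suc m)))"
        using that by (intro wp) simp
      also have "a - s\<^sup>2 * min q T + s * (R / real (Suc m)) \<le> a + s * R"
      proof -
        have "0 \<le> s\<^sup>2 * min q T" using that T by simp
        moreover have "s * (R / real (Suc m)) \<le> s * R"
          using s R by (intro mult_left_mono) (auto simp: field_simps)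
        ultimately show ?thesis by linarith
      qed
      finally show "\<phi> (w m q) \<le> ereal (a + s * R)" by simp
    qed
    show "\<exists>d>0. \<forall>\<^sub>F m in sequentially. \<forall>p\<in>{0..S}. \<forall>t\<in>{0..S}. \<bar>p - t\<bar> < d \<longrightarrow> dist (w m p) (w m t) < e"
      if e: "0 < e" for S e
    proof (intro exI conjI)
      show "0 < e / (2 * s)" using e s by simp
      have "\<forall>\<^sub>F m in sequentially. R / real (Suc m) < e / 2"
        using R0 e by (intro order_tendstoD) auto
      then show "\<forall>\<^sub>F m in sequentially. \<forall>p\<in>{0..S}. \<forall>t\<in>{0..S}. \<bar>p - t\<bar> < e / (2 * s) \<longrightarrow> dist (w m p) (w m t) < e"
      proof eventually_elim
        case (elim m)
        show ?case
        proof (intro ballI impI)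
          fix p t assume pt: "p \<in> {0..S}" "t \<in> {0..S}" "\<bar>p - t\<bar> < e / (2 * s)"
          have "dist (w m p) (w m t) \<le> s * \<bar>min p T - min t T\<bar> + R / real (Suc m)"
            using pt by (intro wd) auto
          also have "s * \<bar>min p T - min t T\<bar> \<le> s * \<bar>p - t\<bar>"
            using s by (intro mult_left_mono) auto
          also have "s * \<bar>p - t\<bar> \<le> s * (e / (2 * s))"
            using pt s by (intro mult_left_mono) auto
          also have "s * (e / (2 * s)) = e / 2"
            using s by simp
          finally show "dist (w m p) (w m t) < e"
            using elim by linarith
        qed
      qed
    qed
  qed (auto intro: wb)
  have R0': "(\<lambda>k. R / real (Suc (r k))) \<longlonglongrightarrow> 0"
    using LIMSEQ_subseq_LIMSEQ[OF R0 r] by (simp add: o_def)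
  show thesis
  proof (rule that)
    show "v 0 = x"
    proof (rule ccontr)
      assume "v 0 \<noteq> x"
      then have "\<forall>\<^sub>F k in sequentially. 0 < dist (w (r k) 0) x"
        by (intro eventually_dist_greater[OF v limitin_const_seq]) auto
      then show False
        by (simp add: w0)
    qed
    show "dist (v t) (v t') \<le> s * \<bar>min t (R / s) - min t' (R / s)\<bar>" if tt: "0 \<le> t" "0 \<le> t'" for t t'
    proof (rule dense_le)
      fix c assume "c < dist (v t) (v t')"
      then have "\<forall>\<^sub>F k in sequentially. c < dist (w (r k) t) (w (r k) t')"
        by (intro eventually_dist_greater[OF v v] tt)
      then have "\<forall>\<^sub>F k in sequentially. c \<le> s * \<bar>min t T - min t' T\<bar> + R / real (Suc (r k))"
        by eventually_elim (use wd[OF tt] in \<open>force intro: less_imp_le less_le_trans\<close>)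
      moreover have "(\<lambda>k. s * \<bar>min t T - min t' T\<bar> + R / real (Suc (r k))) \<longlonglongrightarrow> s * \<bar>min t T - min t' T\<bar> + 0"
        by (intro tendsto_add tendsto_const R0')
      ultimately show "c \<le> s * \<bar>min t (R / s) - min t' (R / s)\<bar>"
        unfolding T_def[symmetric] by (auto intro: tendsto_lowerbound)
    qed
    show "\<phi> (v t) + ereal (s\<^sup>2 * min t (R / s)) \<le> \<phi> x" if t: "0 \<le> t" for t
    proof -
      have "\<phi> (v t) \<le> liminf (\<lambda>k. \<phi> (w (r k) t))"
        by (rule phi_lsc[OF bounded_subset[OF wb[OF t]] v[OF t]]) auto
      also have "\<dots> \<le> liminf (\<lambda>k. ereal (a - s\<^sup>2 * min t T + s * (R / real (Suc (r k)))))"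
        using wp[OF t] by (intro Liminf_mono always_eventually) auto
      also have "\<dots> = ereal (a - s\<^sup>2 * min t T + s * 0)"
        by (intro lim_imp_Liminf tendsto_intros R0') auto
      finally show ?thesis
        unfolding T_def[symmetric] a by (cases "\<phi> (v t)") auto
    qed
  qed
qed

end

section \<open>The WED functional\<close>

text \<open>\<open>f\<close> may be nonmeasurable, since it will contain
  \<open>metric_deriv\<close>; the Borel function \<open>g\<close> that agrees with it almost
  everywhere carries the computation.\<close>

lemma nn_integral_wed_measure:
  fixes f g :: "real \<Rightarrow> ennreal"
  assumes [measurable]: "g \<in> borel_measurable borel" and eq: "AE t in lborel. 0 < t \<longrightarrow> f t = g t"
  shows "(\<integral>\<^sup>+t. f t \<partial>wed_measure \<epsilon>) = (\<integral>\<^sup>+t\<in>{0<..}. ennreal (exp (- t / \<epsilon>) / \<epsilon>) * g t \<partial>lborel)"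
proof -
  let ?h = "\<lambda>t. ennreal (exp (- t / \<epsilon>) / \<epsilon>)"
  have hm: "?h \<in> borel_measurable (lebesgue_on {0<..})"
    by (intro measurable_restrict_space1 measurable_completion) measurable
  have gm: "g \<in> borel_measurable (lebesgue_on {0<..})"
    by (intro measurable_restrict_space1 measurable_completion) measurable
  have "AE t in wed_measure \<epsilon>. f t = g t"
    unfolding wed_measure_def AE_density[OF hm]
    using eq by (subst AE_restrict_space_iff) (auto simp: AE_completion_iff elim: eventually_mono)
  then have "(\<integral>\<^sup>+t. f t \<partial>wed_measure \<epsilon>) = (\<integral>\<^sup>+t. g t \<partial>wed_measure \<epsilon>)"
    by (rule nn_integral_cong_AE)
  also have "\<dots> = (\<integral>\<^sup>+t. ?h t * g t \<partial>lebesgue_on {0<..})"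
    unfolding wed_measure_def by (rule nn_integral_density[OF hm gm])
  also have "\<dots> = (\<integral>\<^sup>+t\<in>{0<..}. ?h t * g t \<partial>lborel)"
    by (subst nn_integral_restrict_space) (auto simp: nn_integral_completion)
  finally show ?thesis .
qed

lemma nn_integral_exp_Ioi:
  assumes "0 < (c::real)"
  shows "(\<integral>\<^sup>+r\<in>{t<..}. ennreal (exp (- r / c)) \<partial>lborel) = ennreal (c * exp (- t / c))"
proof -
  have "(\<integral>\<^sup>+r\<in>{t<..}. ennreal (exp (- r / c)) \<partial>lborel) = (\<integral>\<^sup>+r\<in>{t..}. ennreal (exp (- r / c)) \<partial>lborel)"
    using AE_lborel_singleton[of t] by (intro nn_integral_cong_AE) (auto simp: indicator_def)
  also have "\<dots> = ennreal (0 - (- c * exp (- t / c)))"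
  proof (rule nn_integral_FTC_atLeast)
    show "((\<lambda>r. - c * exp (- r / c)) has_real_derivative exp (- r / c)) (at r)" for r
      using assms by (auto intro!: derivative_eq_intros)
    have "filterlim (\<lambda>r. - r / c) at_bot at_top"
      using assms by (auto intro!: filterlim_tendsto_pos_mult_at_bot[of "\<lambda>_. 1 / c", OF tendsto_const _ filterlim_uminus_at_bot_at_top, simplified] simp: field_simps)
    then have "((\<lambda>r. exp (- r / c)) \<longlongrightarrow> 0) at_top"
      by (rule filterlim_compose[OF exp_at_bot])
    then show "((\<lambda>r. - c * exp (- r / c)) \<longlongrightarrow> 0) at_top"
      by (rule tendsto_mult_right_zero)
  qed (use assms in auto)
  finally show ?thesis by simp
qed

text \<open>Cauchy-Schwarz with the factors exp (q / (4 \<epsilon>)) and exp (- q / (4 \<epsilon>))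
  m bounds the inner square by 2 \<epsilon> exp (r / (2 \<epsilon>)) times the integral of exp (- q
  / (2 \<epsilon>)) m^2. After exchanging the integrals, integrating 2 \<epsilon> exp (- r / (2
  \<epsilon>)) over r > q gives 4 \<epsilon>^2 exp (- q / (2 \<epsilon>)), whence the
  constant.\<close>

lemma Hardy_inequality:
  fixes m :: "real \<Rightarrow> real"
  assumes [measurable]: "m \<in> borel_measurable borel" and m0: "\<And>r. 0 \<le> m r" and \<epsilon>: "0 < \<epsilon>"
  shows "(\<integral>\<^sup>+r\<in>{t<..}. ennreal (exp (- r / \<epsilon>)) * (\<integral>\<^sup>+q\<in>{t..r}. ennreal (m q) \<partial>lborel)\<^sup>2 \<partial>lborel)
    \<le> ennreal (4 * \<epsilon>\<^sup>2) * (\<integral>\<^sup>+r\<in>{t<..}. ennreal (exp (- r / \<epsilon>) * (m r)\<^sup>2) \<partial>lborel)"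
proof -
  let ?k = "\<lambda>q. exp (- q / (2 * \<epsilon>)) * (m q)\<^sup>2"
  let ?A = "{x :: real \<times> real. t < fst x \<and> t < snd x \<and> snd x \<le> fst x}"
  let ?f = "\<lambda>(r, q). ennreal (2 * \<epsilon> * exp (- r / (2 * \<epsilon>))) * ennreal (?k q) * indicator ?A (r, q)"
  have fm: "?f \<in> borel_measurable (lborel \<Otimes>\<^sub>M lborel)"
    by measurable
  have CS: "(\<integral>\<^sup>+q\<in>{t..r}. ennreal (m q) \<partial>lborel)\<^sup>2
      \<le> ennreal (2 * \<epsilon> * exp (r / (2 * \<epsilon>))) * (\<integral>\<^sup>+q\<in>{t<..r}. ennreal (?k q) \<partial>lborel)" if "t < r" for r
  proof -
    let ?a = "\<lambda>q. ennreal (exp (q / (4 * \<epsilon>))) * indicator {t..r} q"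
    let ?b = "\<lambda>q. ennreal (exp (- q / (4 * \<epsilon>)) * m q) * indicator {t..r} q"
    have "(\<integral>\<^sup>+q\<in>{t..r}. ennreal (m q) \<partial>lborel) = (\<integral>\<^sup>+q. ?a q * ?b q \<partial>lborel)"
      using m0 by (intro nn_integral_cong) (auto simp: indicator_def ennreal_mult[symmetric] exp_minus)
    then have "(\<integral>\<^sup>+q\<in>{t..r}. ennreal (m q) \<partial>lborel)\<^sup>2
        \<le> (\<integral>\<^sup>+q. (?a q)\<^sup>2 \<partial>lborel) * (\<integral>\<^sup>+q. (?b q)\<^sup>2 \<partial>lborel)"
      by (simp only:) (rule Cauchy_Schwarz_nn_integral; measurable)
    also have "(\<integral>\<^sup>+q. (?a q)\<^sup>2 \<partial>lborel) = (\<integral>\<^sup>+q. ennreal (exp (q / (2 * \<epsilon>))) * indicator {t..r} q \<partial>lborel)"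
      by (intro nn_integral_cong) (auto simp: indicator_def ennreal_power exp_double[symmetric] field_simps)
    also have "\<dots> = ennreal (2 * \<epsilon> * exp (r / (2 * \<epsilon>)) - 2 * \<epsilon> * exp (t / (2 * \<epsilon>)))"
      using \<epsilon> that by (intro nn_integral_FTC_Icc) (auto intro!: derivative_eq_intros)
    also have "\<dots> \<le> ennreal (2 * \<epsilon> * exp (r / (2 * \<epsilon>)))"
      using \<epsilon> by (intro ennreal_leI) simp
    also have "(\<integral>\<^sup>+q. (?b q)\<^sup>2 \<partial>lborel) = (\<integral>\<^sup>+q\<in>{t<..r}. ennreal (?k q) \<partial>lborel)"
      using AE_lborel_singleton[of t]
      by (intro nn_integral_cong_AE)
        (auto elim!: eventually_mono simp: indicator_def ennreal_power m0 power_mult_distrib exp_double[symmetric] field_simps)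
    finally show ?thesis
      by (simp add: mult_right_mono)
  qed
  have "(\<integral>\<^sup>+r\<in>{t<..}. ennreal (exp (- r / \<epsilon>)) * (\<integral>\<^sup>+q\<in>{t..r}. ennreal (m q) \<partial>lborel)\<^sup>2 \<partial>lborel)
      \<le> (\<integral>\<^sup>+r. \<integral>\<^sup>+q. ?f (r, q) \<partial>lborel \<partial>lborel)"
  proof (rule nn_integral_mono)
    fix r
    show "ennreal (exp (- r / \<epsilon>)) * (\<integral>\<^sup>+q\<in>{t..r}. ennreal (m q) \<partial>lborel)\<^sup>2 * indicator {t<..} r
        \<le> (\<integral>\<^sup>+q. ?f (r, q) \<partial>lborel)"
    proof (cases "t < r")
      case True
      have "ennreal (exp (- r / \<epsilon>)) * (\<integral>\<^sup>+q\<in>{t..r}. ennreal (m q) \<partial>lborel)\<^sup>2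
          \<le> ennreal (exp (- r / \<epsilon>)) * (ennreal (2 * \<epsilon> * exp (r / (2 * \<epsilon>))) * (\<integral>\<^sup>+q\<in>{t<..r}. ennreal (?k q) \<partial>lborel))"
        by (intro mult_left_mono CS True) simp
      also have "\<dots> = ennreal (exp (- r / \<epsilon>) * (2 * \<epsilon> * exp (r / (2 * \<epsilon>)))) * (\<integral>\<^sup>+q\<in>{t<..r}. ennreal (?k q) \<partial>lborel)"
        using \<epsilon> by (subst ennreal_mult) (auto simp: mult.assoc)
      also have "exp (- r / \<epsilon>) * (2 * \<epsilon> * exp (r / (2 * \<epsilon>))) = 2 * \<epsilon> * exp (- r / (2 * \<epsilon>))"
      proof -
        have "exp (- r / \<epsilon>) * exp (r / (2 * \<epsilon>)) = exp (- r / (2 * \<epsilon>))"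
          using \<epsilon> by (simp add: exp_add[symmetric] field_simps)
        then show ?thesis by (simp add: mult.left_commute)
      qed
      also have "ennreal (2 * \<epsilon> * exp (- r / (2 * \<epsilon>))) * (\<integral>\<^sup>+q\<in>{t<..r}. ennreal (?k q) \<partial>lborel)
          = (\<integral>\<^sup>+q. ennreal (2 * \<epsilon> * exp (- r / (2 * \<epsilon>))) * (ennreal (?k q) * indicator {t<..r} q) \<partial>lborel)"
        by (rule nn_integral_cmult[symmetric]) measurable
      also have "\<dots> = (\<integral>\<^sup>+q. ?f (r, q) \<partial>lborel)"
        using True by (intro nn_integral_cong) (auto simp: indicator_def)
      finally show ?thesis
        using True by simp
    qed simp
  qed
  also have "\<dots> = (\<integral>\<^sup>+q. \<integral>\<^sup>+r. ?f (r, q) \<partial>lborel \<partial>lborel)"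
    using lborel_pair.Fubini'[OF fm] by simp
  also have "\<dots> = (\<integral>\<^sup>+q. ennreal (4 * \<epsilon>\<^sup>2) * (ennreal (exp (- q / \<epsilon>) * (m q)\<^sup>2) * indicator {t<..} q) \<partial>lborel)"
  proof (rule nn_integral_cong)
    fix q
    show "(\<integral>\<^sup>+r. ?f (r, q) \<partial>lborel) = ennreal (4 * \<epsilon>\<^sup>2) * (ennreal (exp (- q / \<epsilon>) * (m q)\<^sup>2) * indicator {t<..} q)"
    proof (cases "t < q")
      case True
      have "(\<integral>\<^sup>+r. ?f (r, q) \<partial>lborel)
          = (\<integral>\<^sup>+r. ennreal (2 * \<epsilon> * ?k q) * (ennreal (exp (- r / (2 * \<epsilon>))) * indicator {q<..} r) \<partial>lborel)"
        using True \<epsilon> AE_lborel_singleton[of q]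
        by (intro nn_integral_cong_AE) (auto elim!: eventually_mono simp: indicator_def ennreal_mult[symmetric] mult_ac)
      also have "\<dots> = ennreal (2 * \<epsilon> * ?k q) * ennreal (2 * \<epsilon> * exp (- q / (2 * \<epsilon>)))"
        using \<epsilon> nn_integral_exp_Ioi[of "2 * \<epsilon>" q] by (subst nn_integral_cmult) auto
      also have "\<dots> = ennreal (4 * \<epsilon>\<^sup>2 * (exp (- q / \<epsilon>) * (m q)\<^sup>2))"
      proof -
        have "exp (- q / \<epsilon>) = exp (- q / (2 * \<epsilon>)) * exp (- q / (2 * \<epsilon>))"
          using \<epsilon> by (simp add: exp_add[symmetric] field_simps)
        then show ?thesis
          using \<epsilon> m0[of q] by (subst ennreal_mult[symmetric]) (simp_all add: power2_eq_square mult_ac)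
      qed
      finally show ?thesis
        using True by (simp add: ennreal_mult)
    next
      case False
      then have "?f (r, q) = 0" for r
        by (simp add: indicator_def)
      then show ?thesis
        using False by simp
    qed
  qed
  also have "\<dots> = ennreal (4 * \<epsilon>\<^sup>2) * (\<integral>\<^sup>+r\<in>{t<..}. ennreal (exp (- r / \<epsilon>) * (m r)\<^sup>2) \<partial>lborel)"
    by (rule nn_integral_cmult) measurable
  finally show ?thesis .
qed

lemma set_integrable_Ioi_exp:
  fixes \<epsilon> t :: real
  assumes "0 < \<epsilon>"
  shows "set_integrable lborel {t<..} (\<lambda>r. exp (- r / \<epsilon>) / \<epsilon>)"
    "(LINT r:{t<..}|lborel. exp (- r / \<epsilon>) / \<epsilon>) = exp (- t / \<epsilon>)"
proof -
  have eq: "(\<integral>\<^sup>+r\<in>{t<..}. ennreal (exp (- r / \<epsilon>) / \<epsilon>) \<partial>lborel) = ennreal (exp (- t / \<epsilon>))"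
  proof -
    have "(\<integral>\<^sup>+r\<in>{t<..}. ennreal (exp (- r / \<epsilon>) / \<epsilon>) \<partial>lborel)
        = (\<integral>\<^sup>+r. ennreal (1 / \<epsilon>) * (ennreal (exp (- r / \<epsilon>)) * indicator {t<..} r) \<partial>lborel)"
      using assms by (intro nn_integral_cong) (auto simp: indicator_def ennreal_mult[symmetric])
    also have "\<dots> = ennreal (1 / \<epsilon>) * ennreal (\<epsilon> * exp (- t / \<epsilon>))"
      using nn_integral_exp_Ioi[OF assms, of t] by (subst nn_integral_cmult) auto
    finally show ?thesis
      using assms by (simp add: ennreal_mult[symmetric])
  qed
  have m: "(\<lambda>r. exp (- r / \<epsilon>) / \<epsilon>) \<in> borel_measurable borel" by measurable
  have n: "0 \<le> exp (- r / \<epsilon>) / \<epsilon>" for r using assms by simp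
  show "set_integrable lborel {t<..} (\<lambda>r. exp (- r / \<epsilon>) / \<epsilon>)"
    "(LINT r:{t<..}|lborel. exp (- r / \<epsilon>) / \<epsilon>) = exp (- t / \<epsilon>)"
    using nn_integral_Icc_imp_LINT[OF m n _ eq] by simp_all
qed

text \<open>The running cost of a competitor that moves with speed \<open>s\<close> during \<open>{t..t + T}\<close>, with \<open>\<phi>\<close>
  decreasing at rate \<open>s\<^sup>2\<close>, and then rests.\<close>

lemma competitor_integral:
  fixes t T s a \<epsilon> :: real
  assumes \<epsilon>: "0 < \<epsilon>" and T: "0 \<le> T"
  defines "G \<equiv> \<lambda>r. (if r \<le> t + T then \<epsilon> / 2 * s\<^sup>2 else 0) + a - s\<^sup>2 * min (r - t) T"
  shows "set_integrable lborel {t<..} (\<lambda>r. exp (- r / \<epsilon>) / \<epsilon> * G r)"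
    "(LINT r:{t<..}|lborel. exp (- r / \<epsilon>) / \<epsilon> * G r)
      = exp (- t / \<epsilon>) * (a - 1 / 2 * s\<^sup>2 * \<epsilon> * (1 - exp (- T / \<epsilon>)))"
proof -
  \<comment> \<open>An antiderivative of the weighted cost while the competitor moves. During the
    rest the cost is the constant a - s^2 T.\<close>
  let ?K = "\<lambda>r. exp (- r / \<epsilon>) * (s\<^sup>2 * (r - t) + s\<^sup>2 * \<epsilon> / 2 - a)"
  let ?f = "\<lambda>r. exp (- r / \<epsilon>) / \<epsilon> * (\<epsilon> / 2 * s\<^sup>2 + a - s\<^sup>2 * (r - t))"
  have "has_bochner_integral lborel (\<lambda>r. ?f r * indicator {t..t + T} r) (?K (t + T) - ?K t)"
  proof (rule has_bochner_integral_FTC_Icc_real)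
    show "t \<le> t + T" using T by simp
    show "(?K has_real_derivative ?f r) (at r)" for r
      using \<epsilon> by (auto intro!: derivative_eq_intros simp: field_simps)
    show "isCont ?f r" for r
      using \<epsilon> by (intro continuous_intros) auto
  qed
  then have 1: "has_bochner_integral lborel (\<lambda>r. indicator {t<..t + T} r *\<^sub>R (exp (- r / \<epsilon>) / \<epsilon> * G r)) (?K (t + T) - ?K t)"
  proof (rule has_bochner_integral_cong_AE[THEN iffD1, rotated -1])
    show "AE r in lborel. ?f r * indicator {t..t + T} r = indicator {t<..t + T} r *\<^sub>R (exp (- r / \<epsilon>) / \<epsilon> * G r)"
      using AE_lborel_singleton[of t] by eventually_elim (auto simp: indicator_def G_def)
  qed (unfold G_def, measurable)
  have 2: "has_bochner_integral lborel (\<lambda>r. indicator {t + T<..} r *\<^sub>R (exp (- r / \<epsilon>) / \<epsilon> * G r))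
      (exp (- (t + T) / \<epsilon>) * (a - s\<^sup>2 * T))"
  proof -
    have "has_bochner_integral lborel (\<lambda>r. indicator {t + T<..} r *\<^sub>R (exp (- r / \<epsilon>) / \<epsilon>)) (exp (- (t + T) / \<epsilon>))"
      using set_integrable_Ioi_exp[OF \<epsilon>, of "t + T"]
      by (simp add: has_bochner_integral_iff set_integrable_def set_lebesgue_integral_def)
    then have "has_bochner_integral lborel (\<lambda>r. indicator {t + T<..} r *\<^sub>R (exp (- r / \<epsilon>) / \<epsilon>) * (a - s\<^sup>2 * T))
        (exp (- (t + T) / \<epsilon>) * (a - s\<^sup>2 * T))"
      by (rule has_bochner_integral_mult_left)
    also have "(\<lambda>r. indicator {t + T<..} r *\<^sub>R (exp (- r / \<epsilon>) / \<epsilon>) * (a - s\<^sup>2 * T))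
        = (\<lambda>r. indicator {t + T<..} r *\<^sub>R (exp (- r / \<epsilon>) / \<epsilon> * G r))"
      by (auto simp: fun_eq_iff indicator_def G_def)
    finally show ?thesis .
  qed
  have "has_bochner_integral lborel (\<lambda>r. indicator {t<..} r *\<^sub>R (exp (- r / \<epsilon>) / \<epsilon> * G r))
      ((?K (t + T) - ?K t) + exp (- (t + T) / \<epsilon>) * (a - s\<^sup>2 * T))"
  proof -
    have "(\<lambda>r. indicator {t<..} r *\<^sub>R (exp (- r / \<epsilon>) / \<epsilon> * G r))
      = (\<lambda>r. indicator {t<..t + T} r *\<^sub>R (exp (- r / \<epsilon>) / \<epsilon> * G r) + indicator {t + T<..} r *\<^sub>R (exp (- r / \<epsilon>) / \<epsilon> * G r))"
      using T by (auto simp: fun_eq_iff indicator_def)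
    then show ?thesis
      using has_bochner_integral_add[OF 1 2] by simp
  qed
  moreover have "(?K (t + T) - ?K t) + exp (- (t + T) / \<epsilon>) * (a - s\<^sup>2 * T)
      = exp (- t / \<epsilon>) * (a - 1 / 2 * s\<^sup>2 * \<epsilon> * (1 - exp (- T / \<epsilon>)))"
  proof -
    have "exp (- (t + T) / \<epsilon>) = exp (- t / \<epsilon>) * exp (- T / \<epsilon>)"
      using \<epsilon> by (simp add: exp_add[symmetric] field_simps)
    then show ?thesis
      by (simp add: field_simps)
  qed
  ultimately show "set_integrable lborel {t<..} (\<lambda>r. exp (- r / \<epsilon>) / \<epsilon> * G r)"
    "(LINT r:{t<..}|lborel. exp (- r / \<epsilon>) / \<epsilon> * G r)
      = exp (- t / \<epsilon>) * (a - 1 / 2 * s\<^sup>2 * \<epsilon> * (1 - exp (- T / \<epsilon>)))"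
    by (simp_all add: has_bochner_integral_iff set_integrable_def set_lebesgue_integral_def)
qed

text \<open>Links the Bochner integral to the two separate integrals from which
  \<open>ereal_integral\<close> is built.\<close>

lemma set_integrable_lebesgue_iff_nn:
  fixes f :: "real \<Rightarrow> real"
  assumes [measurable]: "f \<in> borel_measurable borel" "S \<in> sets borel"
  shows "set_integrable lborel S f \<longleftrightarrow>
      (\<integral>\<^sup>+t\<in>S. ennreal (f t) \<partial>lborel) < \<infinity> \<and> (\<integral>\<^sup>+t\<in>S. ennreal (- f t) \<partial>lborel) < \<infinity>"
    and "set_integrable lborel S f \<Longrightarrow> (LINT t:S|lborel. f t) =
      enn2real (\<integral>\<^sup>+t\<in>S. ennreal (f t) \<partial>lborel) - enn2real (\<integral>\<^sup>+t\<in>S. ennreal (- f t) \<partial>lborel)"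
proof -
  have 1: "(\<integral>\<^sup>+t. ennreal (indicator S t *\<^sub>R f t) \<partial>lborel) = (\<integral>\<^sup>+t\<in>S. ennreal (f t) \<partial>lborel)"
    and 2: "(\<integral>\<^sup>+t. ennreal (- (indicator S t *\<^sub>R f t)) \<partial>lborel) = (\<integral>\<^sup>+t\<in>S. ennreal (- f t) \<partial>lborel)"
    by (intro nn_integral_cong; simp add: indicator_def)+
  show "set_integrable lborel S f \<longleftrightarrow>
      (\<integral>\<^sup>+t\<in>S. ennreal (f t) \<partial>lborel) < \<infinity> \<and> (\<integral>\<^sup>+t\<in>S. ennreal (- f t) \<partial>lborel) < \<infinity>"
    unfolding set_integrable_def real_integrable_def 1 2 by (simp add: less_top)
  show "set_integrable lborel S f \<Longrightarrow> (LINT t:S|lborel. f t) =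
      enn2real (\<integral>\<^sup>+t\<in>S. ennreal (f t) \<partial>lborel) - enn2real (\<integral>\<^sup>+t\<in>S. ennreal (- f t) \<partial>lborel)"
    unfolding set_integrable_def set_lebesgue_integral_def
    by (simp only: real_lebesgue_integral_def 1 2)
qed

section \<open>The functional expressed through speeds\<close>

context lscc_space
begin

lemma phi_curve_measurable:
  assumes "has_speed u M"
  shows "(\<lambda>t. \<phi> (u (max 0 t))) \<in> borel_measurable borel"
proof -
  have "continuous_on UNIV (\<lambda>t. u (max 0 t))"
    using has_speed_isCont[OF assms] by (simp add: continuous_on_eq_continuous_at)
  then have "(\<lambda>t. u (max 0 t)) \<in> borel_measurable borel"
    by (rule borel_measurable_continuous_onI)
  from measurable_compose[OF this phi_measurable] show ?thesis .
qed

lemma wed_eq: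
  assumes M: "has_speed u M" and \<epsilon>: "0 < \<epsilon>"
  shows "wed \<phi> \<epsilon> u =
    enn2ereal (\<integral>\<^sup>+t\<in>{0<..}. ennreal (exp (- t / \<epsilon>) / \<epsilon>) * e2ennreal (ereal (\<epsilon> / 2 * (M t)\<^sup>2) + \<phi> (u (max 0 t))) \<partial>lborel)
    - enn2ereal (\<integral>\<^sup>+t\<in>{0<..}. ennreal (exp (- t / \<epsilon>) / \<epsilon>) * e2ennreal (- (ereal (\<epsilon> / 2 * (M t)\<^sup>2) + \<phi> (u (max 0 t)))) \<partial>lborel)"
proof -
  note [measurable] = has_speedD(1)[OF M] phi_curve_measurable[OF M]
  have eq: "AE t in lborel. 0 < t \<longrightarrow> ereal (\<epsilon> / 2 * (metric_deriv {0..} u t)\<^sup>2) + \<phi> (u t)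
      = ereal (\<epsilon> / 2 * (M t)\<^sup>2) + \<phi> (u (max 0 t))"
    using has_speed_metric_deriv[OF M] by eventually_elim auto
  show ?thesis
    unfolding wed_def ereal_integral_def
    by (intro arg_cong2[where f = "\<lambda>a b. enn2ereal a - enn2ereal b"] nn_integral_wed_measure)
      (use eq in \<open>auto elim: eventually_mono\<close>)
qed

text \<open>The majorant enlarges the positive part and reduces the negative part, and these are
  compared separately. Hence the estimate applies to a competitor before anything is known about
  integrability of \<phi> along it.\<close>

lemma wed_le:
  assumes M: "has_speed u M" and \<epsilon>: "0 < \<epsilon>" and [measurable]: "G \<in> borel_measurable borel"
    and le: "AE t in lborel. 0 < t \<longrightarrow> ereal (\<epsilon> / 2 * (M t)\<^sup>2) + \<phi> (u t) \<le> ereal (G t)"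
    and int: "set_integrable lborel {0<..} (\<lambda>t. exp (- t / \<epsilon>) / \<epsilon> * G t)"
  shows "wed \<phi> \<epsilon> u \<le> ereal (LINT t:{0<..}|lborel. exp (- t / \<epsilon>) / \<epsilon> * G t)"
proof -
  let ?e = "\<lambda>t. exp (- t / \<epsilon>) / \<epsilon>"
  let ?P = "\<integral>\<^sup>+t\<in>{0<..}. ennreal (?e t * G t) \<partial>lborel"
  let ?N = "\<integral>\<^sup>+t\<in>{0<..}. ennreal (- (?e t * G t)) \<partial>lborel"
  have fin: "?P < \<infinity>" "?N < \<infinity>" and eq: "(LINT t:{0<..}|lborel. ?e t * G t) = enn2real ?P - enn2real ?N"
    using int set_integrable_lebesgue_iff_nn[of "\<lambda>t. ?e t * G t" "{0<..}"] by auto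
  have P: "(\<integral>\<^sup>+t\<in>{0<..}. ennreal (?e t) * e2ennreal (ereal (\<epsilon> / 2 * (M t)\<^sup>2) + \<phi> (u (max 0 t))) \<partial>lborel) \<le> ?P"
  proof (rule nn_integral_mono_AE)
    show "AE t in lborel. ennreal (?e t) * e2ennreal (ereal (\<epsilon> / 2 * (M t)\<^sup>2) + \<phi> (u (max 0 t))) * indicator {0<..} t
        \<le> ennreal (?e t * G t) * indicator {0<..} t"
      using le
    proof eventually_elim
      case (elim t)
      show ?case
      proof (cases "0 < t")
        case True
        have "e2ennreal (ereal (\<epsilon> / 2 * (M t)\<^sup>2) + \<phi> (u (max 0 t))) \<le> e2ennreal (ereal (G t))"
          using elim True by (intro e2ennreal_mono) auto
        then have "ennreal (?e t) * e2ennreal (ereal (\<epsilon> / 2 * (M t)\<^sup>2) + \<phi> (u (max 0 t))) \<le> ennreal (?e t) * ennreal (G t)"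
          by (intro mult_left_mono) auto
        also have "\<dots> = ennreal (?e t * G t)"
          using \<epsilon> by (intro ennreal_mult'[symmetric]) auto
        finally show ?thesis using True by simp
      qed simp
    qed
  qed
  have N: "?N \<le> (\<integral>\<^sup>+t\<in>{0<..}. ennreal (?e t) * e2ennreal (- (ereal (\<epsilon> / 2 * (M t)\<^sup>2) + \<phi> (u (max 0 t)))) \<partial>lborel)"
  proof (rule nn_integral_mono_AE)
    show "AE t in lborel. ennreal (- (?e t * G t)) * indicator {0<..} t
        \<le> ennreal (?e t) * e2ennreal (- (ereal (\<epsilon> / 2 * (M t)\<^sup>2) + \<phi> (u (max 0 t)))) * indicator {0<..} t"
      using le
    proof eventually_elim
      case (elim t)
      show ?case
      proof (cases "0 < t")
        case True
        have "- ereal (G t) \<le> - (ereal (\<epsilon> / 2 * (M t)\<^sup>2) + \<phi> (u (max 0 t)))"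
          using elim True by (subst ereal_minus_le_minus) auto
        then have "ennreal (- G t) \<le> e2ennreal (- (ereal (\<epsilon> / 2 * (M t)\<^sup>2) + \<phi> (u (max 0 t))))"
          using e2ennreal_mono by fastforce
        then have "ennreal (?e t) * ennreal (- G t) \<le> ennreal (?e t) * e2ennreal (- (ereal (\<epsilon> / 2 * (M t)\<^sup>2) + \<phi> (u (max 0 t))))"
          by (intro mult_left_mono) auto
        moreover have "ennreal (?e t) * ennreal (- G t) = ennreal (- (?e t * G t))"
          using \<epsilon> ennreal_mult'[of "?e t" "- G t"] by simp
        ultimately show ?thesis using True by simp
      qed simp
    qed
  qed
  have "wed \<phi> \<epsilon> u \<le> enn2ereal ?P - enn2ereal ?N"
    unfolding wed_eq[OF M \<epsilon>] by (intro ereal_minus_mono) (use P N in \<open>simp_all add: less_eq_ennreal.rep_eq\<close>)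
  also have "\<dots> = ereal (enn2real ?P - enn2real ?N)"
    using fin by (cases ?P; cases ?N) auto
  finally show ?thesis
    unfolding eq .
qed

lemma nn_integral_weighted_distance:
  assumes M: "has_speed u M" and \<epsilon>: "0 < \<epsilon>" and t: "0 \<le> t"
  shows "(\<integral>\<^sup>+r\<in>{t<..}. ennreal (exp (- r / \<epsilon>) * (dist (u r) (u t))\<^sup>2) \<partial>lborel)
    \<le> ennreal (4 * \<epsilon>\<^sup>2) * (\<integral>\<^sup>+r\<in>{t<..}. ennreal (exp (- r / \<epsilon>) * (M r)\<^sup>2) \<partial>lborel)"
proof (rule order_trans[OF nn_integral_mono Hardy_inequality[OF has_speedD(1,2)[OF M] \<epsilon>]])
  fix r
  show "ennreal (exp (- r / \<epsilon>) * (dist (u r) (u t))\<^sup>2) * indicator {t<..} r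
      \<le> ennreal (exp (- r / \<epsilon>)) * (\<integral>\<^sup>+q\<in>{t..r}. ennreal (M q) \<partial>lborel)\<^sup>2 * indicator {t<..} r"
  proof (cases "t < r")
    case True
    have "(ennreal (dist (u t) (u r)))\<^sup>2 \<le> (\<integral>\<^sup>+q\<in>{t..r}. ennreal (M q) \<partial>lborel)\<^sup>2"
      using True t by (intro power_mono has_speedD(4)[OF M]) auto
    then have "ennreal (exp (- r / \<epsilon>)) * ennreal ((dist (u r) (u t))\<^sup>2)
        \<le> ennreal (exp (- r / \<epsilon>)) * (\<integral>\<^sup>+q\<in>{t..r}. ennreal (M q) \<partial>lborel)\<^sup>2"
      by (intro mult_left_mono) (simp_all add: ennreal_power dist_commute)
    then show ?thesis
      using True by (simp add: ennreal_mult)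
  qed simp
qed

text \<open>Bounds the energy along a curve from below by the coercivity of \<open>\<phi>\<close>; the constant
  \<open>16\<close> in \<open>wed_params\<close> lets the distance term be absorbed into the dissipation.\<close>

lemma wed_curve_lower_bound:
  assumes M: "has_speed u M" and \<epsilon>: "\<epsilon> \<in> wed_params B" and t: "0 \<le> t"
    and fin: "(\<integral>\<^sup>+r\<in>{t<..}. ennreal (exp (- r / \<epsilon>) * (M r)\<^sup>2) \<partial>lborel) < \<infinity>"
  defines "G \<equiv> \<lambda>r. \<epsilon> / 2 * (M r)\<^sup>2 - B * (dist (u (max 0 r)) (u t))\<^sup>2 - quad_bound A B ustar (u t)"
  shows "G \<in> borel_measurable borel"
    "0 \<le> r \<Longrightarrow> ereal (G r) \<le> ereal (\<epsilon> / 2 * (M r)\<^sup>2) + \<phi> (u r)"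
    "set_integrable lborel {t<..} (\<lambda>r. exp (- r / \<epsilon>) / \<epsilon> * G r)"
    "- exp (- t / \<epsilon>) * quad_bound A B ustar (u t) \<le> (LINT r:{t<..}|lborel. exp (- r / \<epsilon>) / \<epsilon> * G r)"
proof -
  have \<epsilon>0: "0 < \<epsilon>" and \<epsilon>B: "B \<le> 1 / (16 * \<epsilon>)"
    using \<epsilon> by (auto simp: wed_params_def)
  note M_meas [measurable] = has_speedD(1)[OF M]
  let ?d = "\<lambda>r. (dist (u (max 0 r)) (u t))\<^sup>2"
  let ?Q = "quad_bound A B ustar (u t)"
  have c: "continuous_on UNIV (\<lambda>t. u (max 0 t))"
    using has_speed_isCont[OF M] by (simp add: continuous_on_eq_continuous_at)
  have d_meas [measurable]: "?d \<in> borel_measurable borel"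
    by (rule borel_measurable_continuous_onI) (intro continuous_intros c)
  show "G \<in> borel_measurable borel"
    unfolding G_def by measurable
  show "ereal (G r) \<le> ereal (\<epsilon> / 2 * (M r)\<^sup>2) + \<phi> (u r)" if "0 \<le> r"
  proof -
    have "ereal (\<epsilon> / 2 * (M r)\<^sup>2) + ereal (- B * (dist (u r) (u t))\<^sup>2 - ?Q) \<le> ereal (\<epsilon> / 2 * (M r)\<^sup>2) + \<phi> (u r)"
      by (intro add_left_mono phi_lower_bound)
    then show ?thesis
      using that by (simp add: G_def max_def algebra_simps)
  qed
  have nonneg: "0 \<le> exp (- r / \<epsilon>) * (M r)\<^sup>2" "0 \<le> exp (- r / \<epsilon>) * ?d r" for r
    by simp_all
  obtain X where X: "0 \<le> X" "(\<integral>\<^sup>+r\<in>{t<..}. ennreal (exp (- r / \<epsilon>) * (M r)\<^sup>2) \<partial>lborel) = ennreal X"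
    using fin by (cases "\<integral>\<^sup>+r\<in>{t<..}. ennreal (exp (- r / \<epsilon>) * (M r)\<^sup>2) \<partial>lborel") auto
  have "(\<integral>\<^sup>+r\<in>{t<..}. ennreal (exp (- r / \<epsilon>) * ?d r) \<partial>lborel)
      = (\<integral>\<^sup>+r\<in>{t<..}. ennreal (exp (- r / \<epsilon>) * (dist (u r) (u t))\<^sup>2) \<partial>lborel)"
    using t by (intro nn_integral_cong) (auto simp: indicator_def max_def)
  also have "\<dots> \<le> ennreal (4 * \<epsilon>\<^sup>2) * ennreal X"
    using nn_integral_weighted_distance[OF M \<epsilon>0 t] X by simp
  also have "\<dots> = ennreal (4 * \<epsilon>\<^sup>2 * X)"
    using X by (simp add: ennreal_mult)
  finally have Yle: "(\<integral>\<^sup>+r\<in>{t<..}. ennreal (exp (- r / \<epsilon>) * ?d r) \<partial>lborel) \<le> ennreal (4 * \<epsilon>\<^sup>2 * X)" .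
  then obtain Y where Y: "0 \<le> Y" "(\<integral>\<^sup>+r\<in>{t<..}. ennreal (exp (- r / \<epsilon>) * ?d r) \<partial>lborel) = ennreal Y"
    by (cases "\<integral>\<^sup>+r\<in>{t<..}. ennreal (exp (- r / \<epsilon>) * ?d r) \<partial>lborel") (auto simp: top_unique)
  have YX: "Y \<le> 4 * \<epsilon>\<^sup>2 * X"
    using Yle Y X by simp
  have iX: "set_integrable lborel {t<..} (\<lambda>r. exp (- r / \<epsilon>) * (M r)\<^sup>2)"
    and lX: "(LINT r:{t<..}|lborel. exp (- r / \<epsilon>) * (M r)\<^sup>2) = X"
    using nn_integral_Icc_imp_LINT[OF _ nonneg(1) X] by simp_all
  have iY: "set_integrable lborel {t<..} (\<lambda>r. exp (- r / \<epsilon>) * ?d r)"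
    and lY: "(LINT r:{t<..}|lborel. exp (- r / \<epsilon>) * ?d r) = Y"
    using nn_integral_Icc_imp_LINT[OF _ nonneg(2) Y] by simp_all
  have eq: "exp (- r / \<epsilon>) / \<epsilon> * G r = 1 / 2 * (exp (- r / \<epsilon>) * (M r)\<^sup>2)
      - B / \<epsilon> * (exp (- r / \<epsilon>) * ?d r) - ?Q * (exp (- r / \<epsilon>) / \<epsilon>)" for r
    using \<epsilon>0 by (simp add: G_def field_simps)
  have i: "set_integrable lborel {t<..} (\<lambda>r. 1 / 2 * (exp (- r / \<epsilon>) * (M r)\<^sup>2))"
    "set_integrable lborel {t<..} (\<lambda>r. B / \<epsilon> * (exp (- r / \<epsilon>) * ?d r))"
    "set_integrable lborel {t<..} (\<lambda>r. ?Q * (exp (- r / \<epsilon>) / \<epsilon>))"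
    using iX iY set_integrable_Ioi_exp(1)[OF \<epsilon>0, of t] by (auto intro: set_integrable_mult_right)
  show "set_integrable lborel {t<..} (\<lambda>r. exp (- r / \<epsilon>) / \<epsilon> * G r)"
    unfolding eq by (intro set_integral_diff i)
  have "(LINT r:{t<..}|lborel. exp (- r / \<epsilon>) / \<epsilon> * G r) = 1 / 2 * X - B / \<epsilon> * Y - ?Q * exp (- t / \<epsilon>)"
    unfolding eq
    by (simp only: set_integral_diff(2)[OF set_integral_diff(1)[OF i(1,2)] i(3)] set_integral_diff(2)[OF i(1,2)]
        set_integral_mult_right lX lY set_integrable_Ioi_exp(2)[OF \<epsilon>0])
  \<comment> \<open>Hardy's inequality gives Y \<le> 4 \<epsilon>^2 X, and 16 \<epsilon> B \<le> 1
    makes the distance term at most X / 4.\<close>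
  moreover have "B / \<epsilon> * Y \<le> 1 / 2 * X"
  proof -
    have "B / \<epsilon> * Y \<le> B / \<epsilon> * (4 * \<epsilon>\<^sup>2 * X)"
      using YX B_nonneg \<epsilon>0 by (intro mult_left_mono) auto
    also have "\<dots> = B * (4 * \<epsilon> * X)"
      using \<epsilon>0 by (simp add: power2_eq_square)
    also have "\<dots> \<le> 1 / (16 * \<epsilon>) * (4 * \<epsilon> * X)"
      using \<epsilon>B \<epsilon>0 X by (intro mult_right_mono) auto
    also have "\<dots> \<le> 1 / 2 * X"
      using \<epsilon>0 X by simp
    finally show ?thesis .
  qed
  ultimately show "- exp (- t / \<epsilon>) * ?Q \<le> (LINT r:{t<..}|lborel. exp (- r / \<epsilon>) / \<epsilon> * G r)"
    by simp
qed

lemma wed_curves_iff: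
  assumes M: "has_speed u M" and \<epsilon>: "0 < \<epsilon>"
  shows "u \<in> wed_curves \<epsilon> x \<longleftrightarrow> u 0 = x \<and> (\<integral>\<^sup>+r\<in>{0<..}. ennreal (exp (- r / \<epsilon>) * (M r)\<^sup>2) \<partial>lborel) < \<infinity>"
proof -
  note [measurable] = has_speedD(1)[OF M]
  have "(\<integral>\<^sup>+t. ennreal ((metric_deriv {0..} u t)\<^sup>2) \<partial>wed_measure \<epsilon>)
      = (\<integral>\<^sup>+t\<in>{0<..}. ennreal (exp (- t / \<epsilon>) / \<epsilon>) * ennreal ((M t)\<^sup>2) \<partial>lborel)"
    using has_speed_metric_deriv[OF M]
    by (intro nn_integral_wed_measure) (auto elim: eventually_mono)
  also have "\<dots> = (\<integral>\<^sup>+t. ennreal (1 / \<epsilon>) * (ennreal (exp (- t / \<epsilon>) * (M t)\<^sup>2) * indicator {0<..} t) \<partial>lborel)"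
    using \<epsilon> by (intro nn_integral_cong) (auto simp: indicator_def ennreal_mult[symmetric])
  also have "\<dots> = ennreal (1 / \<epsilon>) * (\<integral>\<^sup>+r\<in>{0<..}. ennreal (exp (- r / \<epsilon>) * (M r)\<^sup>2) \<partial>lborel)"
    by (rule nn_integral_cmult) measurable
  finally have eq: "(\<integral>\<^sup>+t. ennreal ((metric_deriv {0..} u t)\<^sup>2) \<partial>wed_measure \<epsilon>)
      = ennreal (1 / \<epsilon>) * (\<integral>\<^sup>+r\<in>{0<..}. ennreal (exp (- r / \<epsilon>) * (M r)\<^sup>2) \<partial>lborel)" .
  show ?thesis
    unfolding wed_curves_def using has_speed_imp_AC_loc_2[OF M] \<epsilon>
    by (auto simp: eq ennreal_mult_less_top ennreal_zero_less_divide)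
qed

text \<open>Coercivity bounds the negative part, so finiteness of the functional forces the positive
  part to be finite. From here on the extended valued energy can be replaced by the real function
  \<open>p\<close>, which agrees with it almost everywhere.\<close>

lemma wed_finite:
  assumes M: "has_speed u M" and \<epsilon>: "\<epsilon> \<in> wed_params B"
    and u: "u \<in> wed_curves \<epsilon> x" and fin: "wed \<phi> \<epsilon> u < \<infinity>"
  defines "p \<equiv> \<lambda>t. real_of_ereal (\<phi> (u (max 0 t)))"
  shows "p \<in> borel_measurable borel" "AE t in lborel. 0 \<le> t \<longrightarrow> \<phi> (u t) = ereal (p t)"
    "set_integrable lborel {0<..} (\<lambda>t. exp (- t / \<epsilon>) / \<epsilon> * (\<epsilon> / 2 * (M t)\<^sup>2 + p t))"
    "wed \<phi> \<epsilon> u = ereal (LINT t:{0<..}|lborel. exp (- t / \<epsilon>) / \<epsilon> * (\<epsilon> / 2 * (M t)\<^sup>2 + p t))"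
proof -
  have \<epsilon>0: "0 < \<epsilon>"
    using \<epsilon> by (auto simp: wed_params_def)
  note [measurable] = has_speedD(1)[OF M] phi_curve_measurable[OF M]
  let ?e = "\<lambda>t. exp (- t / \<epsilon>) / \<epsilon>"
  let ?F = "\<lambda>t. ereal (\<epsilon> / 2 * (M t)\<^sup>2) + \<phi> (u (max 0 t))"
  let ?P = "\<integral>\<^sup>+t\<in>{0<..}. ennreal (?e t) * e2ennreal (?F t) \<partial>lborel"
  let ?N = "\<integral>\<^sup>+t\<in>{0<..}. ennreal (?e t) * e2ennreal (- ?F t) \<partial>lborel"
  show [measurable]: "p \<in> borel_measurable borel"
    unfolding p_def by measurable
  have fin0: "(\<integral>\<^sup>+r\<in>{0<..}. ennreal (exp (- r / \<epsilon>) * (M r)\<^sup>2) \<partial>lborel) < \<infinity>"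
    using u wed_curves_iff[OF M \<epsilon>0] by simp
  define G where "G r = \<epsilon> / 2 * (M r)\<^sup>2 - B * (dist (u (max 0 r)) (u 0))\<^sup>2 - quad_bound A B ustar (u 0)" for r
  note lb = wed_curve_lower_bound[OF M \<epsilon> order_refl fin0, folded G_def]
  have [measurable]: "G \<in> borel_measurable borel" by (rule lb(1))
  have N: "?N < \<infinity>"
  proof -
    have "?N \<le> (\<integral>\<^sup>+t\<in>{0<..}. ennreal (- (?e t * G t)) \<partial>lborel)"
    proof (rule nn_integral_mono)
      fix t
      show "ennreal (?e t) * e2ennreal (- ?F t) * indicator {0<..} t \<le> ennreal (- (?e t * G t)) * indicator {0<..} t"
      proof (cases "0 < t")
        case True
        have "ereal (G t) \<le> ?F t"
          using lb(2)[of t] True by simp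
        then have "- ?F t \<le> - ereal (G t)"
          by (subst ereal_minus_le_minus)
        then have "e2ennreal (- ?F t) \<le> e2ennreal (- ereal (G t))"
          by (rule e2ennreal_mono)
        then have "ennreal (?e t) * e2ennreal (- ?F t) \<le> ennreal (?e t) * ennreal (- G t)"
          by (intro mult_left_mono) auto
        also have "\<dots> = ennreal (- (?e t * G t))"
          using \<epsilon>0 ennreal_mult'[of "?e t" "- G t"] by simp
        finally show ?thesis using True by simp
      qed simp
    qed
    also have "\<dots> < \<infinity>"
      using lb(3) set_integrable_lebesgue_iff_nn(1)[of "\<lambda>t. ?e t * G t" "{0<..}"] by simp
    finally show ?thesis .
  qed
  have wed: "wed \<phi> \<epsilon> u = enn2ereal ?P - enn2ereal ?N"
    by (rule wed_eq[OF M \<epsilon>0])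
  have P: "?P < \<infinity>"
  proof (rule ccontr)
    assume "\<not> ?P < \<infinity>"
    then have "?P = \<infinity>" by (simp only: infinity_ennreal_def less_top[symmetric] not_not)
    then have "enn2ereal ?P - enn2ereal ?N = \<infinity>"
      by (simp add: enn2ereal_top)
    with fin wed show False by simp
  qed
  have "AE t in lborel. ennreal (?e t) * e2ennreal (?F t) * indicator {0<..} t \<noteq> \<infinity>"
    using P by (intro nn_integral_noteq_infinite) auto
  then show pp: "AE t in lborel. 0 \<le> t \<longrightarrow> \<phi> (u t) = ereal (p t)"
    using AE_lborel_singleton[of 0]
  proof eventually_elim
    case (elim t)
    show ?case
    proof
      assume "0 \<le> t"
      then have t: "0 < t" using elim by simp
      have "\<phi> (u t) \<noteq> \<infinity>"
      proof
        assume "\<phi> (u t) = \<infinity>"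
        then have "ennreal (?e t) * e2ennreal (?F t) = \<infinity>"
          using t \<epsilon>0 by (simp add: ennreal_mult_top e2ennreal_infty)
        then show False using elim t by simp
      qed
      then show "\<phi> (u t) = ereal (p t)"
        using t by (cases "\<phi> (u t)") (auto simp: p_def)
    qed
  qed
  let ?g = "\<lambda>t. ?e t * (\<epsilon> / 2 * (M t)\<^sup>2 + p t)"
  have em: "ennreal (?e t) * ennreal y = ennreal (?e t * y)" for t y
    by (rule ennreal_mult'[symmetric]) (use \<epsilon>0 in simp)
  have Pe: "?P = (\<integral>\<^sup>+t\<in>{0<..}. ennreal (?g t) \<partial>lborel)"
  proof (rule nn_integral_cong_AE)
    show "AE t in lborel. ennreal (?e t) * e2ennreal (?F t) * indicator {0<..} t = ennreal (?g t) * indicator {0<..} t"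
      using pp
    proof eventually_elim
      case (elim t)
      show ?case
      proof (cases "0 < t")
        case True
        then have "?F t = ereal (\<epsilon> / 2 * (M t)\<^sup>2 + p t)"
          using elim by simp
        then show ?thesis
          by (simp only: e2ennreal_ereal em)
      qed simp
    qed
  qed
  have Ne: "?N = (\<integral>\<^sup>+t\<in>{0<..}. ennreal (- ?g t) \<partial>lborel)"
  proof (rule nn_integral_cong_AE)
    show "AE t in lborel. ennreal (?e t) * e2ennreal (- ?F t) * indicator {0<..} t = ennreal (- ?g t) * indicator {0<..} t"
      using pp
    proof eventually_elim
      case (elim t)
      show ?case
      proof (cases "0 < t")
        case True
        then have "- ?F t = ereal (- (\<epsilon> / 2 * (M t)\<^sup>2 + p t))"
          using elim by simp
        then show ?thesis
          by (simp only: e2ennreal_ereal em mult_minus_right)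
      qed simp
    qed
  qed
  have gm: "?g \<in> borel_measurable borel" "{0<..} \<in> sets (borel :: real measure)"
    by measurable
  show gi: "set_integrable lborel {0<..} ?g"
    unfolding set_integrable_lebesgue_iff_nn(1)[OF gm] Pe[symmetric] Ne[symmetric] using P N by (rule conjI)
  have "(LINT t:{0<..}|lborel. ?g t) = enn2real ?P - enn2real ?N"
    unfolding Pe Ne by (rule set_integrable_lebesgue_iff_nn(2)[OF gm gi])
  moreover have "enn2ereal ?P - enn2ereal ?N = ereal (enn2real ?P - enn2real ?N)"
    using P N by (cases ?P; cases ?N) auto
  ultimately show "wed \<phi> \<epsilon> u = ereal (LINT t:{0<..}|lborel. ?g t)"
    unfolding wed by simp
qed

end

section \<open>The energy identity for minimizers\<close>

lemma has_speed_const: "has_speed (\<lambda>_. x) (\<lambda>_. 0)"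
  unfolding has_speed_def by simp

locale wed_minimizer = lscc_space \<sigma> \<phi> ustar A B
  for \<sigma> :: "'a::complete_space topology" and \<phi> :: "'a \<Rightarrow> ereal" and ustar :: 'a and A B :: real +
  fixes \<epsilon> :: real and x :: 'a and u :: "real \<Rightarrow> 'a" and M :: "real \<Rightarrow> real"
  assumes eps: "\<epsilon> \<in> wed_params B" and x: "\<phi> x < \<infinity>" and u: "u \<in> wed_minimizers \<phi> \<epsilon> x"
    and M: "has_speed u M"
begin

definition p :: "real \<Rightarrow> real" where "p t = real_of_ereal (\<phi> (u (max 0 t)))"

definition F :: "real \<Rightarrow> real" where "F t = \<epsilon> / 2 * (M t)\<^sup>2 + p t"

text \<open>The WED energy of the curve \<open>u\<close> restarted at time \<open>t\<close>; since \<open>u\<close> is minimal, this is the value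
  function at \<open>u t\<close>.\<close>

definition W :: "real \<Rightarrow> real" where
  "W t = exp (t / \<epsilon>) * (LINT r:{t<..}|lborel. exp (- r / \<epsilon>) / \<epsilon> * F r)"

lemma eps_pos: "0 < \<epsilon>"
  using eps by (simp add: wed_params_def)

lemma u_curve: "u \<in> wed_curves \<epsilon> x"
  using u by (simp add: wed_minimizers_def)

lemma u_0: "u 0 = x"
  using u_curve by (simp add: wed_curves_def)

lemma dissipation_finite: "(\<integral>\<^sup>+r\<in>{0<..}. ennreal (exp (- r / \<epsilon>) * (M r)\<^sup>2) \<partial>lborel) < \<infinity>"
  using u_curve wed_curves_iff[OF M eps_pos] by simp

text \<open>Resting at the initial point is a competitor of finite cost.\<close>

lemma wed_u_finite: "wed \<phi> \<epsilon> u < \<infinity>"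
proof -
  obtain a where a: "\<phi> x = ereal a"
    using x by (cases "\<phi> x") auto
  have "(\<lambda>_. x) \<in> wed_curves \<epsilon> x"
    using wed_curves_iff[OF has_speed_const[of x] eps_pos, of x] by simp
  then have "wed \<phi> \<epsilon> u \<le> wed \<phi> \<epsilon> (\<lambda>_. x)"
    using u by (simp add: wed_minimizers_def)
  also have "\<dots> \<le> ereal (LINT t:{0<..}|lborel. exp (- t / \<epsilon>) / \<epsilon> * a)"
  proof (rule wed_le[OF has_speed_const eps_pos])
    show "set_integrable lborel {0<..} (\<lambda>t. exp (- t / \<epsilon>) / \<epsilon> * a)"
      using set_integrable_Ioi_exp(1)[OF eps_pos] by (intro set_integrable_mult_left) 
  qed (use a in auto)
  also have "\<dots> < \<infinity>" by simp
  finally show ?thesis .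
qed

lemma p_measurable [measurable]: "p \<in> borel_measurable borel"
  unfolding p_def[abs_def] by (rule wed_finite(1)[OF M eps u_curve wed_u_finite])

lemma phi_u: "AE t in lborel. 0 \<le> t \<longrightarrow> \<phi> (u t) = ereal (p t)"
  unfolding p_def by (rule wed_finite(2)[OF M eps u_curve wed_u_finite])

lemma M_measurable [measurable]: "M \<in> borel_measurable borel"
  by (rule has_speedD(1)[OF M])

lemma F_measurable [measurable]: "F \<in> borel_measurable borel"
  unfolding F_def[abs_def] by measurable

lemma F_integrable: "0 \<le> t \<Longrightarrow> set_integrable lborel {t<..} (\<lambda>r. exp (- r / \<epsilon>) / \<epsilon> * F r)"
  by (rule set_integrable_subset[OF wed_finite(3)[OF M eps u_curve wed_u_finite, folded p_def, folded F_def]]) auto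

lemma wed_u: "wed \<phi> \<epsilon> u = ereal (LINT t:{0<..}|lborel. exp (- t / \<epsilon>) / \<epsilon> * F t)"
  unfolding F_def p_def by (rule wed_finite(4)[OF M eps u_curve wed_u_finite])

section \<open>Competitors and bounds on the value\<close>

text \<open>Dynamic programming: the competitor follows \<open>u\<close> until time t and
  \<open>v\<close> afterwards. The costs before t coincide, so minimality of \<open>u\<close>
  compares the tails, and \<open>competitor_integral\<close> evaluates the tail of the
  competitor.\<close>

lemma tail_le:
  assumes t: "0 \<le> t" and T: "0 \<le> T" and s: "0 \<le> s" and v0: "v 0 = u t"
    and vd: "\<And>a b. 0 \<le> a \<Longrightarrow> 0 \<le> b \<Longrightarrow> dist (v a) (v b) \<le> s * \<bar>min a T - min b T\<bar>"
    and vp: "\<And>r. 0 \<le> r \<Longrightarrow> \<phi> (v r) + ereal (s\<^sup>2 * min r T) \<le> ereal a"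
  shows "(LINT r:{t<..}|lborel. exp (- r / \<epsilon>) / \<epsilon> * F r)
    \<le> exp (- t / \<epsilon>) * (a - 1 / 2 * s\<^sup>2 * \<epsilon> * (1 - exp (- T / \<epsilon>)))"
proof -
  define w where "w r = (if r \<le> t then u r else v (r - t))" for r
  \<comment> \<open>The two speeds live on disjoint time intervals, so the square of their sum has
    no cross term.\<close>
  define m1 m2 where "m1 r = M r * indicator {..t} r" and "m2 r = s * indicator {t<..t + T} r" for r :: real
  define m where "m r = m1 r + m2 r" for r
  have [measurable]: "m1 \<in> borel_measurable borel" "m2 \<in> borel_measurable borel" "m \<in> borel_measurable borel"
    unfolding m_def m1_def m2_def by measurable
  have m10: "0 \<le> m1 r" and m20: "0 \<le> m2 r" and m0: "0 \<le> m r" for r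
    using has_speedD(2)[OF M, of r] s by (simp_all add: m_def m1_def m2_def)
  have m_sq: "(m r)\<^sup>2 \<le> (M r)\<^sup>2 + s\<^sup>2" for r
    by (auto simp: m_def m1_def m2_def indicator_def)
  have w_dist: "ennreal (dist (w b) (w c)) \<le> (\<integral>\<^sup>+r\<in>{b..c}. ennreal (m r) \<partial>lborel)" if bc: "0 \<le> b" "b \<le> c" for b c
  proof -
    \<comment> \<open>The times b and c clipped to the window {t..t + T} in which \<open>v\<close>
      moves.\<close>
    define \<alpha> \<beta> where "\<alpha> = t + min (max 0 (b - t)) T" and "\<beta> = t + min (max 0 (c - t)) T"
    have \<alpha>\<beta>: "\<alpha> \<le> \<beta>" using bc by (auto simp: \<alpha>_def \<beta>_def)
    have 1: "ennreal (dist (u (min b t)) (u (min c t))) \<le> (\<integral>\<^sup>+r\<in>{b..c}. ennreal (m1 r) \<partial>lborel)"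
    proof (cases "b \<le> t")
      case True
      have "ennreal (dist (u (min b t)) (u (min c t))) \<le> (\<integral>\<^sup>+r\<in>{min b t..min c t}. ennreal (M r) \<partial>lborel)"
        using bc t by (intro has_speedD(4)[OF M]) auto
      also have "\<dots> \<le> (\<integral>\<^sup>+r\<in>{b..c}. ennreal (m1 r) \<partial>lborel)"
        using True by (intro nn_integral_mono) (auto simp: indicator_def m1_def)
      finally show ?thesis .
    next
      case False
      then show ?thesis using bc by simp
    qed
    have "dist (v (max 0 (b - t))) (v (max 0 (c - t))) \<le> s * \<bar>min (max 0 (b - t)) T - min (max 0 (c - t)) T\<bar>"
      by (intro vd) auto
    also have "\<dots> = s * (\<beta> - \<alpha>)"
      using \<alpha>\<beta> by (simp add: \<alpha>_def \<beta>_def)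
    finally have "ennreal (dist (v (max 0 (b - t))) (v (max 0 (c - t)))) \<le> ennreal (s * (\<beta> - \<alpha>))"
      by (rule ennreal_leI)
    also have "\<dots> = (\<integral>\<^sup>+r. ennreal s * indicator {\<alpha><..\<beta>} r \<partial>lborel)"
      using s \<alpha>\<beta> by (simp add: nn_integral_cmult_indicator ennreal_mult)
    also have "\<dots> \<le> (\<integral>\<^sup>+r\<in>{b..c}. ennreal (m2 r) \<partial>lborel)"
    proof (rule nn_integral_mono)
      fix r
      show "ennreal s * indicator {\<alpha><..\<beta>} r \<le> ennreal (m2 r) * indicator {b..c} r"
      proof (cases "r \<in> {\<alpha><..\<beta>}")
        case True
        then have "r \<in> {b..c}" "r \<in> {t<..t + T}"
          using T by (auto simp: \<alpha>_def \<beta>_def min_def max_def split: if_splits)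
        then show ?thesis using True by (auto simp: m2_def indicator_def)
      qed simp
    qed
    finally have 2: "ennreal (dist (v (max 0 (b - t))) (v (max 0 (c - t)))) \<le> (\<integral>\<^sup>+r\<in>{b..c}. ennreal (m2 r) \<partial>lborel)" .
    have "dist (w b) (w c) \<le> dist (u (min b t)) (u (min c t)) + dist (v (max 0 (b - t))) (v (max 0 (c - t)))"
    proof (cases "b \<le> t \<and> t < c")
      case True
      then show ?thesis
        using dist_triangle[of "u b" "v (c - t)" "u t"] by (simp add: w_def v0)
    next
      case False
      then show ?thesis using bc by (auto simp: w_def)
    qed
    then have "ennreal (dist (w b) (w c))
        \<le> ennreal (dist (u (min b t)) (u (min c t))) + ennreal (dist (v (max 0 (b - t))) (v (max 0 (c - t))))"
      by (simp add: ennreal_leI flip: ennreal_plus)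
    also have "\<dots> \<le> (\<integral>\<^sup>+r\<in>{b..c}. ennreal (m1 r) \<partial>lborel) + (\<integral>\<^sup>+r\<in>{b..c}. ennreal (m2 r) \<partial>lborel)"
      by (rule add_mono[OF 1 2])
    also have "\<dots> = (\<integral>\<^sup>+r. ennreal (m1 r) * indicator {b..c} r + ennreal (m2 r) * indicator {b..c} r \<partial>lborel)"
      by (rule nn_integral_add[symmetric]) measurable
    also have "\<dots> = (\<integral>\<^sup>+r\<in>{b..c}. ennreal (m r) \<partial>lborel)"
      by (intro nn_integral_cong) (auto simp: m_def indicator_def ennreal_plus m10 m20)
    finally show ?thesis .
  qed
  have m_fin: "(\<integral>\<^sup>+r\<in>{0..real n}. ennreal ((m r)\<^sup>2) \<partial>lborel) < \<infinity>" for n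
  proof -
    have "(\<integral>\<^sup>+r\<in>{0..real n}. ennreal ((m r)\<^sup>2) \<partial>lborel)
        \<le> (\<integral>\<^sup>+r. ennreal ((M r)\<^sup>2) * indicator {0..real n} r + ennreal (s\<^sup>2) * indicator {0..real n} r \<partial>lborel)"
      using m_sq by (intro nn_integral_mono) (auto simp: indicator_def ennreal_leI simp flip: ennreal_plus)
    also have "\<dots> = (\<integral>\<^sup>+r\<in>{0..real n}. ennreal ((M r)\<^sup>2) \<partial>lborel) + (\<integral>\<^sup>+r\<in>{0..real n}. ennreal (s\<^sup>2) \<partial>lborel)"
      by (rule nn_integral_add) measurable
    also have "\<dots> < \<infinity>"
      using has_speedD(3)[OF M, of "real n"] by (simp add: nn_integral_cmult_indicator ennreal_mult_less_top)
    finally show ?thesis .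
  qed
  \<comment> \<open>The functional sees the metric speed \<open>N\<close> of the glued curve; that
    it is below the explicit bound \<open>m\<close> is what allows the comparison. The same
    \<open>m\<close> serves for every n.\<close>
  obtain N where N: "has_speed w N" "\<And>r. N r \<le> m r"
    by (rule ex_has_speed[of "\<lambda>_. m" w]) (use m0 m_fin w_dist in auto)
  have N_sq: "(N r)\<^sup>2 \<le> (m r)\<^sup>2" for r
    using N(2)[of r] has_speedD(2)[OF N(1), of r] by (intro power_mono) auto
  have w_curve: "w \<in> wed_curves \<epsilon> x"
    unfolding wed_curves_iff[OF N(1) eps_pos]
  proof
    show "w 0 = x" using t u_0 by (simp add: w_def)
    have "(\<integral>\<^sup>+r\<in>{0<..}. ennreal (exp (- r / \<epsilon>) * (N r)\<^sup>2) \<partial>lborel)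
        \<le> (\<integral>\<^sup>+r. ennreal (exp (- r / \<epsilon>) * (M r)\<^sup>2) * indicator {0<..} r
            + ennreal (s\<^sup>2) * (ennreal (exp (- r / \<epsilon>)) * indicator {0<..} r) \<partial>lborel)"
    proof (rule nn_integral_mono)
      fix r
      have "exp (- r / \<epsilon>) * (N r)\<^sup>2 \<le> exp (- r / \<epsilon>) * ((M r)\<^sup>2 + s\<^sup>2)"
        using N_sq[of r] m_sq[of r] by (intro mult_left_mono) auto
      then have "ennreal (exp (- r / \<epsilon>) * (N r)\<^sup>2) \<le> ennreal (exp (- r / \<epsilon>) * (M r)\<^sup>2) + ennreal (s\<^sup>2) * ennreal (exp (- r / \<epsilon>))"
        by (simp add: ennreal_leI distrib_left mult.commute flip: ennreal_plus ennreal_mult)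
      then show "ennreal (exp (- r / \<epsilon>) * (N r)\<^sup>2) * indicator {0<..} r
          \<le> ennreal (exp (- r / \<epsilon>) * (M r)\<^sup>2) * indicator {0<..} r + ennreal (s\<^sup>2) * (ennreal (exp (- r / \<epsilon>)) * indicator {0<..} r)"
        by (auto simp: indicator_def)
    qed
    also have "\<dots> = (\<integral>\<^sup>+r\<in>{0<..}. ennreal (exp (- r / \<epsilon>) * (M r)\<^sup>2) \<partial>lborel)
        + (\<integral>\<^sup>+r. ennreal (s\<^sup>2) * (ennreal (exp (- r / \<epsilon>)) * indicator {0<..} r) \<partial>lborel)"
      by (rule nn_integral_add) measurable
    also have "(\<integral>\<^sup>+r. ennreal (s\<^sup>2) * (ennreal (exp (- r / \<epsilon>)) * indicator {0<..} r) \<partial>lborel) = ennreal (s\<^sup>2) * ennreal (\<epsilon> * exp (- 0 / \<epsilon>))"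
      unfolding nn_integral_exp_Ioi[OF eps_pos, symmetric] by (rule nn_integral_cmult) measurable
    also have "(\<integral>\<^sup>+r\<in>{0<..}. ennreal (exp (- r / \<epsilon>) * (M r)\<^sup>2) \<partial>lborel) + ennreal (s\<^sup>2) * ennreal (\<epsilon> * exp (- 0 / \<epsilon>)) < \<infinity>"
      using dissipation_finite by (simp add: ennreal_mult_less_top)
    finally show "(\<integral>\<^sup>+r\<in>{0<..}. ennreal (exp (- r / \<epsilon>) * (N r)\<^sup>2) \<partial>lborel) < \<infinity>" .
  qed
  define H where "H r = (if r \<le> t + T then \<epsilon> / 2 * s\<^sup>2 else 0) + a - s\<^sup>2 * min (r - t) T" for r
  define G where "G r = (if r \<le> t then F r else H r)" for r
  have [measurable]: "H \<in> borel_measurable borel" "G \<in> borel_measurable borel"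
    unfolding G_def H_def by measurable
  note cH = competitor_integral[OF eps_pos T, of t s a, folded H_def]
  let ?e = "\<lambda>r. exp (- r / \<epsilon>) / \<epsilon>"
  have split: "{0<..} = {0<..t} \<union> {t<..}" "{0<..t} \<inter> {t<..} = {}"
    using t by auto
  have F1: "set_integrable lborel {0<..t} (\<lambda>r. ?e r * F r)"
    by (rule set_integrable_subset[OF F_integrable[OF order_refl]]) auto
  have G1: "set_integrable lborel {0<..t} (\<lambda>r. ?e r * G r)" "(LINT r:{0<..t}|lborel. ?e r * G r) = (LINT r:{0<..t}|lborel. ?e r * F r)"
  proof -
    have *: "(\<lambda>r. indicator {0<..t} r *\<^sub>R (?e r * G r)) = (\<lambda>r. indicator {0<..t} r *\<^sub>R (?e r * F r))"
      by (auto simp: fun_eq_iff G_def indicator_def)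
    show "set_integrable lborel {0<..t} (\<lambda>r. ?e r * G r)" "(LINT r:{0<..t}|lborel. ?e r * G r) = (LINT r:{0<..t}|lborel. ?e r * F r)"
      using F1 unfolding set_integrable_def set_lebesgue_integral_def * by auto
  qed
  have G2: "set_integrable lborel {t<..} (\<lambda>r. ?e r * G r)" "(LINT r:{t<..}|lborel. ?e r * G r) = (LINT r:{t<..}|lborel. ?e r * H r)"
  proof -
    have *: "(\<lambda>r. indicator {t<..} r *\<^sub>R (?e r * G r)) = (\<lambda>r. indicator {t<..} r *\<^sub>R (?e r * H r))"
      by (auto simp: fun_eq_iff G_def indicator_def)
    show "set_integrable lborel {t<..} (\<lambda>r. ?e r * G r)" "(LINT r:{t<..}|lborel. ?e r * G r) = (LINT r:{t<..}|lborel. ?e r * H r)"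
      using cH(1) unfolding set_integrable_def set_lebesgue_integral_def * by auto
  qed
  have "ereal (LINT r:{0<..}|lborel. ?e r * F r) \<le> wed \<phi> \<epsilon> w"
    using u w_curve wed_u by (auto simp: wed_minimizers_def)
  also have "\<dots> \<le> ereal (LINT r:{0<..}|lborel. ?e r * G r)"
  proof (rule wed_le[OF N(1) eps_pos])
    show "set_integrable lborel {0<..} (\<lambda>r. ?e r * G r)"
      unfolding split(1) by (rule set_integrable_Un[OF G1(1) G2(1)]) auto
    show "AE r in lborel. 0 < r \<longrightarrow> ereal (\<epsilon> / 2 * (N r)\<^sup>2) + \<phi> (w r) \<le> ereal (G r)"
      using phi_u
    proof eventually_elim
      case (elim r)
      show ?case
      proof
        assume r: "0 < r"
        have Nr: "\<epsilon> / 2 * (N r)\<^sup>2 \<le> \<epsilon> / 2 * (m r)\<^sup>2"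
          using N_sq[of r] eps_pos by (intro mult_left_mono) auto
        show "ereal (\<epsilon> / 2 * (N r)\<^sup>2) + \<phi> (w r) \<le> ereal (G r)"
        proof (cases "r \<le> t")
          case True
          then show ?thesis
            using Nr elim r by (simp add: w_def G_def F_def m_def m1_def m2_def)
        next
          case False
          have le: "\<phi> (v (r - t)) + ereal (s\<^sup>2 * min (r - t) T) \<le> ereal a"
            using False by (intro vp) simp
          then obtain b where b: "\<phi> (v (r - t)) = ereal b"
            by (cases "\<phi> (v (r - t))") auto
          have "\<epsilon> / 2 * (m r)\<^sup>2 = (if r \<le> t + T then \<epsilon> / 2 * s\<^sup>2 else 0)"
            using False by (simp add: m_def m1_def m2_def)
          then show ?thesis
            using le b Nr False by (simp add: w_def G_def H_def)
        qed
      qed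
    qed
  qed simp
  finally have "(LINT r:{0<..}|lborel. ?e r * F r) \<le> (LINT r:{0<..}|lborel. ?e r * G r)"
    by simp
  also have "(LINT r:{0<..}|lborel. ?e r * G r) = (LINT r:{0<..t}|lborel. ?e r * G r) + (LINT r:{t<..}|lborel. ?e r * G r)"
    unfolding split(1) by (rule set_integral_Un[OF split(2) G1(1) G2(1)])
  also have "(LINT r:{0<..}|lborel. ?e r * F r) = (LINT r:{0<..t}|lborel. ?e r * F r) + (LINT r:{t<..}|lborel. ?e r * F r)"
    unfolding split(1) by (rule set_integral_Un[OF split(2) F1 F_integrable[OF t]])
  finally show ?thesis
    unfolding G1(2) G2(2) cH(2) by (simp only: add_le_cancel_left)
qed

lemma W_le_of_tail_le:
  assumes "(LINT r:{t<..}|lborel. exp (- r / \<epsilon>) / \<epsilon> * F r) \<le> exp (- t / \<epsilon>) * c"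
  shows "W t \<le> c"
proof -
  have "W t \<le> exp (t / \<epsilon>) * (exp (- t / \<epsilon>) * c)"
    unfolding W_def using assms by (intro mult_left_mono) auto
  also have "\<dots> = c"
    by (simp add: exp_minus)
  finally show ?thesis .
qed

text \<open>The competitor rests at \<open>u t\<close>, that is, T = 0 and s = 0. Only an upper
  bound for the energy is asked, which is what is available at time 0.\<close>

lemma W_le_phi:
  assumes t: "0 \<le> t" and a: "\<phi> (u t) \<le> ereal a"
  shows "W t \<le> a"
proof -
  have "(LINT r:{t<..}|lborel. exp (- r / \<epsilon>) / \<epsilon> * F r)
      \<le> exp (- t / \<epsilon>) * (a - 1 / 2 * 0\<^sup>2 * \<epsilon> * (1 - exp (- 0 / \<epsilon>)))"
    by (rule tail_le[OF t order_refl order_refl, of "\<lambda>_. u t"]) (use a in \<open>auto simp: zero_ereal_def[symmetric]\<close>)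
  then show ?thesis
    by (intro W_le_of_tail_le) simp
qed

text \<open>The competitor is the descending curve: at speed s it needs time R / s to cover the
  length R, and this duration appears in the exponential.\<close>

lemma W_slope:
  assumes t: "0 \<le> t" and a: "\<phi> (u t) = ereal a" and R: "0 < R" and s: "0 < s"
    and slope: "\<And>y. dist (u t) y \<le> R \<Longrightarrow> \<phi> y \<le> \<phi> (u t) \<Longrightarrow> ennreal s < local_slope \<phi> y"
  shows "1 / 2 * s\<^sup>2 * \<epsilon> * (1 - exp (- (R / s) / \<epsilon>)) \<le> a - W t"
proof -
  have "\<phi> (u t) < \<infinity>" using a by simp
  then obtain v where v: "v 0 = u t"
    "\<And>a b. 0 \<le> a \<Longrightarrow> 0 \<le> b \<Longrightarrow> dist (v a) (v b) \<le> s * \<bar>min a (R / s) - min b (R / s)\<bar>"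
    "\<And>r. 0 \<le> r \<Longrightarrow> \<phi> (v r) + ereal (s\<^sup>2 * min r (R / s)) \<le> \<phi> (u t)"
    using ex_descending_curve[OF _ R s slope] by metis
  have "(LINT r:{t<..}|lborel. exp (- r / \<epsilon>) / \<epsilon> * F r)
      \<le> exp (- t / \<epsilon>) * (a - 1 / 2 * s\<^sup>2 * \<epsilon> * (1 - exp (- (R / s) / \<epsilon>)))"
    using R s v a by (intro tail_le[OF t, of "R / s" s v a]) auto
  then have "W t \<le> a - 1 / 2 * s\<^sup>2 * \<epsilon> * (1 - exp (- (R / s) / \<epsilon>))"
    by (rule W_le_of_tail_le)
  then show ?thesis by simp
qed

text \<open>The coercivity estimate applied to the tail. The bound depends on the point
  \<open>u t\<close> but not on \<epsilon>, which makes it usable uniformly along the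
  sequence.\<close>

lemma W_lower_bound:
  assumes t: "0 \<le> t"
  shows "- quad_bound A B ustar (u t) \<le> W t"
proof -
  have fin: "(\<integral>\<^sup>+r\<in>{t<..}. ennreal (exp (- r / \<epsilon>) * (M r)\<^sup>2) \<partial>lborel) < \<infinity>"
    using t by (intro le_less_trans[OF nn_integral_mono dissipation_finite]) (auto simp: indicator_def)
  define G where "G r = \<epsilon> / 2 * (M r)\<^sup>2 - B * (dist (u (max 0 r)) (u t))\<^sup>2 - quad_bound A B ustar (u t)" for r
  note lb = wed_curve_lower_bound[OF M eps t fin, folded G_def]
  have "- exp (- t / \<epsilon>) * quad_bound A B ustar (u t) \<le> (LINT r:{t<..}|lborel. exp (- r / \<epsilon>) / \<epsilon> * G r)"
    by (rule lb(4))
  also have "\<dots> \<le> (LINT r:{t<..}|lborel. exp (- r / \<epsilon>) / \<epsilon> * F r)"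
  proof (rule set_integral_mono_AE[OF lb(3) F_integrable[OF t]])
    show "AE r \<in> {t<..} in lborel. exp (- r / \<epsilon>) / \<epsilon> * G r \<le> exp (- r / \<epsilon>) / \<epsilon> * F r"
      using phi_u
    proof eventually_elim
      case (elim r)
      show ?case
      proof
        assume "r \<in> {t<..}"
        then have r: "0 \<le> r" using t by simp
        have "ereal (G r) \<le> ereal (F r)"
          using lb(2)[OF r] elim r by (simp add: F_def)
        then show "exp (- r / \<epsilon>) / \<epsilon> * G r \<le> exp (- r / \<epsilon>) / \<epsilon> * F r"
          using eps_pos by (intro mult_left_mono) auto
      qed
    qed
  qed
  finally have "exp (t / \<epsilon>) * (- exp (- t / \<epsilon>) * quad_bound A B ustar (u t)) \<le> W t"
    unfolding W_def by (intro mult_left_mono) auto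
  moreover have "exp (t / \<epsilon>) * (- exp (- t / \<epsilon>) * quad_bound A B ustar (u t))
      = - ((exp (t / \<epsilon>) * exp (- t / \<epsilon>)) * quad_bound A B ustar (u t))"
    by (simp only: mult_minus_left mult_minus_right mult.assoc)
  moreover have "exp (t / \<epsilon>) * exp (- t / \<epsilon>) = 1"
    by (simp add: exp_minus)
  ultimately show ?thesis
    by (simp only: mult_1)
qed

section \<open>Integration of the value in time\<close>

definition g :: "real \<Rightarrow> real" where "g q = indicator {0<..} q * (exp (- q / \<epsilon>) / \<epsilon> * F q)"

lemma g_measurable [measurable]: "g \<in> borel_measurable borel"
  unfolding g_def[abs_def] by measurable

lemma g_integrable: "integrable lborel g"
  using F_integrable[of 0] unfolding set_integrable_def g_def[abs_def] by simp

lemma W_eq_g: "0 \<le> t \<Longrightarrow> W t = exp (t / \<epsilon>) * (\<integral>q. indicator {t<..} q * g q \<partial>lborel)"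
  unfolding W_def set_lebesgue_integral_def g_def
  by (intro arg_cong2[where f = "(*)"] refl Bochner_Integration.integral_cong) (auto simp: indicator_def)

lemma W_measurable [measurable]: "W \<in> borel_measurable borel"
proof -
  have "(\<lambda>t. \<integral>r. indicator {x. fst x < snd x} (t, r) * (exp (- r / \<epsilon>) / \<epsilon> * F r) \<partial>lborel) \<in> borel_measurable borel"
    by (rule lborel.borel_measurable_lebesgue_integral) measurable
  also have "(\<lambda>t. \<integral>r. indicator {x. fst x < snd x} (t, r) * (exp (- r / \<epsilon>) / \<epsilon> * F r) \<partial>lborel)
      = (\<lambda>t. LINT r:{t<..}|lborel. exp (- r / \<epsilon>) / \<epsilon> * F r)"
    unfolding set_lebesgue_integral_def
    by (intro ext Bochner_Integration.integral_cong) (auto simp: indicator_def)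
  finally have [measurable]: "(\<lambda>t. LINT r:{t<..}|lborel. exp (- r / \<epsilon>) / \<epsilon> * F r) \<in> borel_measurable borel" .
  show ?thesis
    unfolding W_def[abs_def] by measurable
qed

text \<open>Up to time t the weight is at least exp (- t / \<epsilon>) / \<epsilon>, so it can be
  removed at the price of a constant.\<close>

lemma F_integrable_Icc:
  assumes "0 \<le> t"
  shows "set_integrable lborel {0<..t} (\<lambda>r. F r / \<epsilon>)"
  unfolding set_integrable_def
proof (rule Bochner_Integration.integrable_bound)
  show "integrable lborel (\<lambda>r. exp (t / \<epsilon>) * g r)"
    using g_integrable by simp
  show "AE r in lborel. norm (indicator {0<..t} r *\<^sub>R (F r / \<epsilon>)) \<le> norm (exp (t / \<epsilon>) * g r)"
  proof (intro AE_I2)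
    fix r
    show "norm (indicator {0<..t} r *\<^sub>R (F r / \<epsilon>)) \<le> norm (exp (t / \<epsilon>) * g r)"
    proof (cases "r \<in> {0<..t}")
      case True
      have "1 \<le> exp (t / \<epsilon>) * exp (- r / \<epsilon>)"
        using True eps_pos by (simp add: exp_add[symmetric] diff_divide_distrib[symmetric])
      then have "1 * \<bar>F r / \<epsilon>\<bar> \<le> (exp (t / \<epsilon>) * exp (- r / \<epsilon>)) * \<bar>F r / \<epsilon>\<bar>"
        by (intro mult_right_mono) auto
      also have "\<dots> = norm (exp (t / \<epsilon>) * g r)"
        using True by (simp add: g_def abs_mult)
      finally show ?thesis
        using True by simp
    qed simp
  qed
qed measurable

text \<open>The integrated form of W' = (W - F) / \<epsilon>. Instead of differentiating,
  \<open>W\<close> is written as an integral over q > r and Fubini's theorem is applied on 0 < r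
  \<le> t: the inner integral of exp (r / \<epsilon>) / \<epsilon> up to the minimum of t and q is
  an explicit exponential minus 1.\<close>

lemma W_integral:
  assumes t: "0 \<le> t"
  shows "set_integrable lborel {0<..t} (\<lambda>r. W r / \<epsilon>)"
    "(LINT r:{0<..t}|lborel. W r / \<epsilon>) = (LINT r:{0<..t}|lborel. F r / \<epsilon>) + W t - W 0"
proof -
  let ?f = "\<lambda>(r, q). indicator {0<..t} r * (exp (r / \<epsilon>) / \<epsilon>) * (indicator {x. fst x < snd x} (r, q) * g q)"
  have fm: "?f \<in> borel_measurable (lborel \<Otimes>\<^sub>M lborel)"
    by measurable
  define C where "C = exp (t / \<epsilon>) / \<epsilon>"
  have C: "0 \<le> C" using eps_pos by (simp add: C_def)
  have bound: "norm (?f (r, q)) \<le> indicator {0<..t} r * C * \<bar>g q\<bar>" for r q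
  proof (cases "r \<in> {0<..t}")
    case True
    have "exp (r / \<epsilon>) / \<epsilon> \<le> C"
      using True eps_pos by (simp add: C_def divide_right_mono)
    moreover have "\<bar>indicator {x. fst x < snd x} (r, q) * g q\<bar> \<le> \<bar>g q\<bar>"
      by (simp add: indicator_def)
    ultimately have "exp (r / \<epsilon>) / \<epsilon> * \<bar>indicator {x. fst x < snd x} (r, q) * g q\<bar> \<le> C * \<bar>g q\<bar>"
      using C by (intro mult_mono) auto
    moreover have "norm (?f (r, q)) = exp (r / \<epsilon>) / \<epsilon> * \<bar>indicator {x. fst x < snd x} (r, q) * g q\<bar>"
      using True eps_pos by (simp add: abs_mult)
    ultimately show ?thesis
      using True by simp
  qed simp
  have row: "integrable lborel (\<lambda>q. ?f (r, q))" for r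
  proof (rule Bochner_Integration.integrable_bound)
    show "integrable lborel (\<lambda>q. indicator {0<..t} r * C * g q)"
      using g_integrable by simp
    show "AE q in lborel. norm (?f (r, q)) \<le> norm (indicator {0<..t} r * C * g q)"
      using bound[of r] C by (intro AE_I2) (simp add: abs_mult)
    show "(\<lambda>q. ?f (r, q)) \<in> borel_measurable lborel"
      by (rule measurable_Pair2[OF fm]) simp
  qed
  have "integrable lborel (\<lambda>r. \<integral>q. norm (?f (r, q)) \<partial>lborel)"
  proof (rule Bochner_Integration.integrable_bound)
    show "integrable lborel (\<lambda>r. indicator {0<..t} r * (C * (\<integral>q. \<bar>g q\<bar> \<partial>lborel)) :: real)"
      using t by simp
    show "(\<lambda>r. \<integral>q. norm (?f (r, q)) \<partial>lborel) \<in> borel_measurable lborel"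
      using fm by (intro lborel.borel_measurable_lebesgue_integral) (simp add: case_prod_unfold)
    show "AE r in lborel. norm (\<integral>q. norm (?f (r, q)) \<partial>lborel) \<le> norm (indicator {0<..t} r * (C * (\<integral>q. \<bar>g q\<bar> \<partial>lborel)))"
    proof (intro AE_I2)
      fix r
      have "(\<integral>q. norm (?f (r, q)) \<partial>lborel) \<le> (\<integral>q. indicator {0<..t} r * C * \<bar>g q\<bar> \<partial>lborel)"
        using row[of r] g_integrable bound by (intro integral_mono integrable_norm integrable_mult_right integrable_abs) auto
      also have "\<dots> = indicator {0<..t} r * (C * (\<integral>q. \<bar>g q\<bar> \<partial>lborel))"
        by simp
      finally show "norm (\<integral>q. norm (?f (r, q)) \<partial>lborel) \<le> norm (indicator {0<..t} r * (C * (\<integral>q. \<bar>g q\<bar> \<partial>lborel)))"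
        by simp
    qed
  qed
  then have fi: "integrable (lborel \<Otimes>\<^sub>M lborel) ?f"
    by (intro lborel_pair.Fubini_integrable fm) (use row in simp_all)
  have inner1: "(\<integral>q. ?f (r, q) \<partial>lborel) = indicator {0<..t} r *\<^sub>R (W r / \<epsilon>)" for r
  proof (cases "r \<in> {0<..t}")
    case True
    have "(\<integral>q. ?f (r, q) \<partial>lborel) = (\<integral>q. exp (r / \<epsilon>) / \<epsilon> * (indicator {r<..} q * g q) \<partial>lborel)"
      using True by (intro Bochner_Integration.integral_cong) (auto simp: indicator_def)
    also have "\<dots> = exp (r / \<epsilon>) / \<epsilon> * (\<integral>q. indicator {r<..} q * g q \<partial>lborel)"
      by (rule integral_mult_right_zero)
    also have "\<dots> = W r / \<epsilon>"
      using True by (simp add: W_eq_g)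
    finally show ?thesis using True by simp
  qed simp
  have inner2: "(\<integral>r. ?f (r, q) \<partial>lborel) = g q * (exp (min t q / \<epsilon>) - 1)" for q
  proof (cases "0 < q")
    case True
    have hb: "has_bochner_integral lborel (\<lambda>r. exp (r / \<epsilon>) / \<epsilon> * indicator {0..min t q} r) (exp (min t q / \<epsilon>) - exp (0 / \<epsilon>))"
    proof (rule has_bochner_integral_FTC_Icc_real)
      show "0 \<le> min t q" using t True by simp
      show "((\<lambda>r. exp (r / \<epsilon>)) has_real_derivative exp (r / \<epsilon>) / \<epsilon>) (at r)" for r
        using eps_pos by (auto intro!: derivative_eq_intros)
      show "isCont (\<lambda>r. exp (r / \<epsilon>) / \<epsilon>) r" for r
        using eps_pos by (intro continuous_intros) auto
    qed
    have "(\<integral>r. ?f (r, q) \<partial>lborel) = (\<integral>r. indicator {0<..t} r * (exp (r / \<epsilon>) / \<epsilon>) * (indicator {..<q} r * g q) \<partial>lborel)"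
      by (intro Bochner_Integration.integral_cong) (auto simp: indicator_def)
    also have "\<dots> = (\<integral>r. g q * (exp (r / \<epsilon>) / \<epsilon> * indicator {0..min t q} r) \<partial>lborel)"
    proof (rule integral_cong_AE)
      show "AE r in lborel. indicator {0<..t} r * (exp (r / \<epsilon>) / \<epsilon>) * (indicator {..<q} r * g q) = g q * (exp (r / \<epsilon>) / \<epsilon> * indicator {0..min t q} r)"
        using AE_lborel_singleton[of 0] AE_lborel_singleton[of q]
        by eventually_elim (auto simp: indicator_def)
    qed measurable
    also have "\<dots> = g q * (\<integral>r. exp (r / \<epsilon>) / \<epsilon> * indicator {0..min t q} r \<partial>lborel)"
      by (rule integral_mult_right_zero)
    also have "(\<integral>r. exp (r / \<epsilon>) / \<epsilon> * indicator {0..min t q} r \<partial>lborel) = exp (min t q / \<epsilon>) - exp (0 / \<epsilon>)"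
      using hb by (rule has_bochner_integral_integral_eq)
    finally show ?thesis by simp
  next
    case False
    then have "g q = 0" by (simp add: g_def)
    then show ?thesis by simp
  qed
  have "integrable lborel (\<lambda>r. \<integral>q. ?f (r, q) \<partial>lborel)"
    using lborel_pair.integrable_fst'[OF fi] .
  then show "set_integrable lborel {0<..t} (\<lambda>r. W r / \<epsilon>)"
    unfolding inner1 set_integrable_def .
  \<comment> \<open>For q \<le> t the exponentials cancel and leave F / \<epsilon>; for q > t the
    factor exp (t / \<epsilon>) produces \<open>W t\<close>; the term - g integrates to - W
    0.\<close>
  have split: "g q * (exp (min t q / \<epsilon>) - 1) = indicator {0<..t} q *\<^sub>R (F q / \<epsilon>) + exp (t / \<epsilon>) * (indicator {t<..} q * g q) - g q" for q
  proof (cases "q \<le> t")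
    case True
    have "g q * exp (q / \<epsilon>) = indicator {0<..t} q *\<^sub>R (F q / \<epsilon>)"
    proof (cases "0 < q")
      case q: True
      have "exp (- q / \<epsilon>) * exp (q / \<epsilon>) = 1"
        by (simp add: exp_minus)
      moreover have "exp (- q / \<epsilon>) / \<epsilon> * F q * exp (q / \<epsilon>) = (exp (- q / \<epsilon>) * exp (q / \<epsilon>)) * (F q / \<epsilon>)"
        by simp
      ultimately have "exp (- q / \<epsilon>) / \<epsilon> * F q * exp (q / \<epsilon>) = F q / \<epsilon>"
        by (simp only: mult_1)
      then show ?thesis using q True by (simp add: g_def)
    qed (simp add: g_def)
    then show ?thesis
      using True by (simp add: right_diff_distrib min_def)
  qed (simp add: algebra_simps min_def)
  have iF: "integrable lborel (\<lambda>q. indicator {0<..t} q *\<^sub>R (F q / \<epsilon>))"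
    using F_integrable_Icc[OF t] by (simp add: set_integrable_def)
  have ig: "integrable lborel (\<lambda>q. exp (t / \<epsilon>) * (indicator {t<..} q * g q))"
    using integrable_mult_indicator[OF _ g_integrable, of "{t<..}"] by simp
  have "(LINT r:{0<..t}|lborel. W r / \<epsilon>) = (\<integral>r. \<integral>q. ?f (r, q) \<partial>lborel \<partial>lborel)"
    unfolding inner1 set_lebesgue_integral_def ..
  also have "\<dots> = (\<integral>q. \<integral>r. ?f (r, q) \<partial>lborel \<partial>lborel)"
    by (rule lborel_pair.Fubini_integral[of "\<lambda>r q. ?f (r, q)", symmetric]) (use fi in \<open>simp add: case_prod_unfold\<close>)
  also have "\<dots> = (\<integral>q. indicator {0<..t} q *\<^sub>R (F q / \<epsilon>) + exp (t / \<epsilon>) * (indicator {t<..} q * g q) - g q \<partial>lborel)"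
    unfolding inner2 split ..
  also have "\<dots> = (\<integral>q. indicator {0<..t} q *\<^sub>R (F q / \<epsilon>) \<partial>lborel) + (\<integral>q. exp (t / \<epsilon>) * (indicator {t<..} q * g q) \<partial>lborel)
      - (\<integral>q. g q \<partial>lborel)"
    by (simp only: Bochner_Integration.integral_diff[OF Bochner_Integration.integrable_add[OF iF ig] g_integrable]
        Bochner_Integration.integral_add[OF iF ig])
  also have "(\<integral>q. exp (t / \<epsilon>) * (indicator {t<..} q * g q) \<partial>lborel) = W t"
    unfolding W_eq_g[OF t] by (rule integral_mult_right_zero)
  also have "(\<integral>q. g q \<partial>lborel) = W 0"
  proof -
    have "(\<integral>q. g q \<partial>lborel) = (\<integral>q. indicator {0<..} q * g q \<partial>lborel)"
      by (intro Bochner_Integration.integral_cong) (auto simp: g_def indicator_def)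
    then show ?thesis by (simp add: W_eq_g[OF order_refl])
  qed
  finally show "(LINT r:{0<..t}|lborel. W r / \<epsilon>) = (LINT r:{0<..t}|lborel. F r / \<epsilon>) + W t - W 0"
    by (simp add: set_lebesgue_integral_def)
qed

lemma W_le_p: "AE t in lborel. 0 \<le> t \<longrightarrow> W t \<le> p t"
  using phi_u by eventually_elim (auto intro: W_le_phi)

text \<open>By \<open>W_integral\<close> the integral of (F - W) / \<epsilon> is W 0 - W t. The
  integrand is M^2 / 2 + (p - W) / \<epsilon>, nonnegative because W \<le> p almost everywhere; the
  first claim ensures that \<open>ennreal\<close> does not truncate the right-hand side of the
  second.\<close>

lemma energy_identity:
  assumes t: "0 \<le> t"
  shows "W t \<le> W 0"
    "(\<integral>\<^sup>+r\<in>{0..t}. (ennreal (1 / 2 * (M r)\<^sup>2) + ennreal ((p r - W r) / \<epsilon>)) \<partial>lborel) = ennreal (W 0 - W t)"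
proof -
  let ?h = "\<lambda>r. indicator {0<..t} r *\<^sub>R (F r / \<epsilon> - W r / \<epsilon>)"
  have hi: "integrable lborel ?h"
    using set_integral_diff(1)[OF F_integrable_Icc[OF t] W_integral(1)[OF t]] unfolding set_integrable_def .
  have hl: "(\<integral>r. ?h r \<partial>lborel) = W 0 - W t"
    using set_integral_diff(2)[OF F_integrable_Icc[OF t] W_integral(1)[OF t]] W_integral(2)[OF t]
    unfolding set_lebesgue_integral_def by simp
  have eq: "F r / \<epsilon> - W r / \<epsilon> = 1 / 2 * (M r)\<^sup>2 + (p r - W r) / \<epsilon>" for r
    using eps_pos by (simp add: F_def field_simps)
  have nonneg: "AE r in lborel. 0 \<le> ?h r"
    using W_le_p
  proof eventually_elim
    case (elim r)
    then show ?case
      unfolding eq using eps_pos by (auto simp: indicator_def)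
  qed
  show "W t \<le> W 0"
    using integral_nonneg_AE[OF nonneg] hl by simp
  have "(\<integral>\<^sup>+r\<in>{0..t}. (ennreal (1 / 2 * (M r)\<^sup>2) + ennreal ((p r - W r) / \<epsilon>)) \<partial>lborel) = (\<integral>\<^sup>+r. ennreal (?h r) \<partial>lborel)"
  proof (rule nn_integral_cong_AE)
    show "AE r in lborel. (ennreal (1 / 2 * (M r)\<^sup>2) + ennreal ((p r - W r) / \<epsilon>)) * indicator {0..t} r = ennreal (?h r)"
      using W_le_p AE_lborel_singleton[of 0]
    proof eventually_elim
      case (elim r)
      show ?case
      proof (cases "r \<in> {0<..t}")
        case True
        have "0 \<le> 1 / 2 * (M r)\<^sup>2" "0 \<le> (p r - W r) / \<epsilon>"
          using elim True eps_pos by auto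
        then have "ennreal (1 / 2 * (M r)\<^sup>2) + ennreal ((p r - W r) / \<epsilon>) = ennreal (1 / 2 * (M r)\<^sup>2 + (p r - W r) / \<epsilon>)"
          by (rule ennreal_plus[symmetric])
        then show ?thesis
          unfolding eq using True by simp
      next
        case False
        then show ?thesis
          using elim by (auto simp: indicator_def)
      qed
    qed
  qed
  also have "\<dots> = ennreal (W 0 - W t)"
    unfolding nn_integral_eq_integral[OF hi nonneg] hl ..
  finally show "(\<integral>\<^sup>+r\<in>{0..t}. (ennreal (1 / 2 * (M r)\<^sup>2) + ennreal ((p r - W r) / \<epsilon>)) \<partial>lborel) = ennreal (W 0 - W t)" .
qed

end

section \<open>The limit of vanishing parameter\<close>

lemma ennreal_liminf_add:
  fixes f g :: "nat \<Rightarrow> ennreal"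
  shows "liminf f + liminf g \<le> liminf (\<lambda>n. f n + g n)"
proof -
  have inc: "incseq (\<lambda>n. INF m\<in>{n..}. h m)" for h :: "nat \<Rightarrow> ennreal"
    by (auto simp: incseq_def intro!: INF_superset_mono)
  have "liminf f + liminf g = (SUP n. (INF m\<in>{n..}. f m) + (INF m\<in>{n..}. g m))"
    unfolding liminf_SUP_INF by (rule ennreal_SUP_add[symmetric]) (rule inc)+
  also have "\<dots> \<le> (SUP n. INF m\<in>{n..}. f m + g m)"
    by (intro SUP_mono) (auto intro!: INF_greatest add_mono INF_lower)
  finally show ?thesis
    unfolding liminf_SUP_INF .
qed

lemma AE_lborel_Ioo_ex:
  fixes a b :: real
  assumes "AE t in lborel. P t" "a < b"
  shows "\<exists>t. a < t \<and> t < b \<and> P t"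
proof (rule ccontr)
  assume no: "\<not> ?thesis"
  have "AE t in lborel. t \<notin> {a<..<b}"
    using assms(1) by eventually_elim (use no in auto)
  then have "{a<..<b} \<in> null_sets lborel"
    by (subst (asm) AE_iff_null_sets[symmetric]) auto
  then have "emeasure lborel {a<..<b} = 0"
    by auto
  then show False
    using assms(2) by simp
qed

text \<open>One point is chosen in every rational interval. This provides the times for the diagonal
  argument when energy bounds hold only almost everywhere.\<close>

lemma countable_dense_of_AE:
  assumes "AE t in lborel. 0 < t \<longrightarrow> P (t :: real)"
  obtains D where "countable D" "D \<subseteq> {0..}" "\<And>t. t \<in> D \<Longrightarrow> P t"
    "\<And>t e. 0 \<le> t \<Longrightarrow> 0 < e \<Longrightarrow> \<exists>q\<in>D. \<bar>q - t\<bar> < e"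
proof -
  have "\<forall>x::real \<times> real. \<exists>t. fst x < snd x \<longrightarrow> fst x < t \<and> t < snd x \<and> (0 < t \<longrightarrow> P t)"
    using AE_lborel_Ioo_ex[OF assms] by blast
  from choice[OF this] obtain f where f: "\<forall>x::real \<times> real. fst x < snd x \<longrightarrow> fst x < f x \<and> f x < snd x \<and> (0 < f x \<longrightarrow> P (f x))"
    by (elim exE)
  define S where "S = {x \<in> \<rat> \<times> \<rat> :: (real \<times> real) set. 0 \<le> fst x \<and> fst x < snd x}"
  show thesis
  proof (rule that)
    have "countable (\<rat> \<times> \<rat> :: (real \<times> real) set)"
      using countable_rat by (intro countable_SIGMA) auto
    then show "countable (f ` S)"
      by (intro countable_image countable_subset[of S "\<rat> \<times> \<rat>"]) (auto simp: S_def)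
    have fS: "0 \<le> fst x \<and> fst x < f x \<and> P (f x)" if "x \<in> S" for x
      using f[THEN spec, of x] that by (simp add: S_def)
    show "f ` S \<subseteq> {0..}"
    proof (rule image_subsetI)
      fix x assume "x \<in> S"
      then show "f x \<in> {0..}" using fS[of x] by simp
    qed
    show "P t" if tS: "t \<in> f ` S" for t
      using tS fS by blast
    show "\<exists>q\<in>f ` S. \<bar>q - t\<bar> < e" if te: "0 \<le> t" "0 < e" for t e
    proof -
      obtain a where a: "a \<in> \<rat>" "t < a" "a < t + e"
        using Rats_dense_in_real[of t "t + e"] te by auto
      obtain b where b: "b \<in> \<rat>" "a < b" "b < t + e"
        using Rats_dense_in_real[OF a(3)] by auto
      have "(a, b) \<in> S"
        using a b te by (simp add: S_def)
      moreover have "a < f (a, b)" "f (a, b) < b"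
        using f b by auto
      ultimately show ?thesis
        using a b by (intro bexI[of _ "f (a, b)"]) auto
    qed
  qed
qed

text \<open>Minimality is reduced to three facts for the passage to the limit: \<open>W\<close> lies
  below \<open>p\<close>, its decrease accounts for the dissipation, and the gap between them
  controls slopes. \<open>c0\<close> and \<open>R\<close> bound the initial energies and distances
  uniformly, and \<open>a0\<close> is the limiting initial energy.\<close>

locale wed_sequence = lscc_space \<sigma> \<phi> ustar A B
  for \<sigma> :: "'a::complete_space topology" and \<phi> :: "'a \<Rightarrow> ereal" and ustar :: 'a and A B :: real +
  fixes e :: "nat \<Rightarrow> real" and u :: "nat \<Rightarrow> real \<Rightarrow> 'a" and M p W :: "nat \<Rightarrow> real \<Rightarrow> real"
    and ubar :: 'a and a0 c0 R :: real
  assumes e_pos: "\<And>k. 0 < e k" and e_lim: "e \<longlonglongrightarrow> 0"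
    and M: "\<And>k. has_speed (u k) (M k)"
    and p_meas [measurable]: "\<And>k. p k \<in> borel_measurable borel"
    and W_meas [measurable]: "\<And>k. W k \<in> borel_measurable borel"
    and phi_p: "\<And>k. AE t in lborel. 0 \<le> t \<longrightarrow> \<phi> (u k t) = ereal (p k t)"
    and W_le_p: "\<And>k. AE t in lborel. 0 \<le> t \<longrightarrow> W k t \<le> p k t"
    and W_antimono: "\<And>k t. 0 \<le> t \<Longrightarrow> W k t \<le> W k 0"
    and energy: "\<And>k t. 0 \<le> t \<Longrightarrow>
      (\<integral>\<^sup>+r\<in>{0..t}. (ennreal (1 / 2 * (M k r)\<^sup>2) + ennreal ((p k r - W k r) / e k)) \<partial>lborel) = ennreal (W k 0 - W k t)"
    and W_lower: "\<And>k t. 0 \<le> t \<Longrightarrow> - quad_bound A B ustar (u k t) \<le> W k t"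
    and W_slope: "\<And>k t a r s. 0 \<le> t \<Longrightarrow> \<phi> (u k t) = ereal a \<Longrightarrow> 0 < r \<Longrightarrow> 0 < s \<Longrightarrow>
      (\<And>y. dist (u k t) y \<le> r \<Longrightarrow> \<phi> y \<le> \<phi> (u k t) \<Longrightarrow> ennreal s < local_slope \<phi> y) \<Longrightarrow>
      1 / 2 * s\<^sup>2 * e k * (1 - exp (- (r / s) / e k)) \<le> a - W k t"
    and W_0: "\<And>k b. \<phi> (u k 0) \<le> ereal b \<Longrightarrow> W k 0 \<le> b"
    and init_lim: "limitin \<sigma> (\<lambda>k. u k 0) ubar sequentially"
    and init_dist: "\<And>k. dist (u k 0) ubar \<le> R"
    and init_phi: "\<And>k. \<phi> (u k 0) \<le> ereal c0"
    and phi_ubar: "\<phi> ubar = ereal a0"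
    and init_phi_lim: "(\<lambda>k. \<phi> (u k 0)) \<longlonglongrightarrow> ereal a0"
begin

lemma M_meas [measurable]: "M k \<in> borel_measurable borel"
  by (rule has_speedD(1)[OF M])

lemma W_0_le: "W k 0 \<le> c0"
  by (rule W_0[OF init_phi])

lemma energy_parts:
  assumes "0 \<le> t"
  shows "(\<integral>\<^sup>+r\<in>{0..t}. ennreal (1 / 2 * (M k r)\<^sup>2) \<partial>lborel) + (\<integral>\<^sup>+r\<in>{0..t}. ennreal ((p k r - W k r) / e k) \<partial>lborel)
    = ennreal (W k 0 - W k t)"
proof -
  have "(\<integral>\<^sup>+r\<in>{0..t}. ennreal (1 / 2 * (M k r)\<^sup>2) \<partial>lborel) + (\<integral>\<^sup>+r\<in>{0..t}. ennreal ((p k r - W k r) / e k) \<partial>lborel)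
      = (\<integral>\<^sup>+r. ennreal (1 / 2 * (M k r)\<^sup>2) * indicator {0..t} r + ennreal ((p k r - W k r) / e k) * indicator {0..t} r \<partial>lborel)"
    by (rule nn_integral_add[symmetric]) measurable
  also have "\<dots> = ennreal (W k 0 - W k t)"
    unfolding energy[OF assms, symmetric] by (intro nn_integral_cong) (simp add: distrib_right)
  finally show ?thesis .
qed

section \<open>Bounds uniform along the sequence\<close>

text \<open>The identity bounds half the dissipation X on {0..t} by c0 - W t, and the lower bound on
  W t is quadratic in the distance of \<open>u k t\<close> from \<open>ustar\<close>. The
  displacement over the last step of length \<tau> has square at most \<tau> X, so its contribution
  is absorbed; the displacement before is bounded by induction on the number of steps. All constants
  are independent of k.\<close>

lemma dissipation_bound: "\<exists>K\<ge>0. \<forall>k. (\<integral>\<^sup>+r\<in>{0..T}. ennreal ((M k r)\<^sup>2) \<partial>lborel) \<le> ennreal K"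
proof -
  \<comment> \<open>Chosen so that 2 B \<tau> \<le> 1 / 8; B + 1 replaces B to allow B = 0.\<close>
  define \<tau> where "\<tau> = 1 / (16 * (B + 1))"
  have \<tau>: "0 < \<tau>" "2 * B * \<tau> \<le> 1 / 8"
    using B_nonneg by (auto simp: \<tau>_def field_simps)
  have "\<exists>K\<ge>0. \<forall>k. (\<integral>\<^sup>+r\<in>{0..real n * \<tau>}. ennreal ((M k r)\<^sup>2) \<partial>lborel) \<le> ennreal K" for n
  proof (induction n)
    case 0
    have "(\<integral>\<^sup>+r\<in>{0..0}. ennreal ((M k r)\<^sup>2) \<partial>lborel) = 0" for k
      using AE_lborel_singleton[of 0]
      by (subst nn_integral_0_iff_AE) (auto elim!: eventually_mono simp: indicator_def)
    then show ?case by (intro exI[of _ 0]) simp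
  next
    case (Suc n)
    then obtain K where K: "0 \<le> K" "\<And>k. (\<integral>\<^sup>+r\<in>{0..real n * \<tau>}. ennreal ((M k r)\<^sup>2) \<partial>lborel) \<le> ennreal K"
      by auto
    define t where "t = real (Suc n) * \<tau>"
    define t' where "t' = real n * \<tau>"
    have t: "0 \<le> t'" "t' \<le> t" "t - t' = \<tau>"
      using \<tau> by (auto simp: t_def t'_def algebra_simps)
    \<comment> \<open>Bounds the distance from \<open>u k t'\<close> to \<open>ustar\<close>:
      displacement since time 0 by induction, initial distance to \<open>ubar\<close>, and from
      there to \<open>ustar\<close>.\<close>
    define c where "c = sqrt (t' * K) + R + dist ubar ustar"
    define S where "S = \<bar>c0\<bar> + A + 2 * B * c\<^sup>2"
    have S: "0 \<le> S" using A_nonneg B_nonneg by (simp add: S_def)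
    have "(\<integral>\<^sup>+r\<in>{0..t}. ennreal ((M k r)\<^sup>2) \<partial>lborel) \<le> ennreal (3 * S)" for k
    proof -
      obtain X where X: "0 \<le> X" "(\<integral>\<^sup>+r\<in>{0..t}. ennreal ((M k r)\<^sup>2) \<partial>lborel) = ennreal X"
        using has_speedD(3)[OF M, of k t] by (cases "\<integral>\<^sup>+r\<in>{0..t}. ennreal ((M k r)\<^sup>2) \<partial>lborel") auto
      have em: "ennreal (1 / 2 * (M k r)\<^sup>2) = ennreal (1 / 2) * ennreal ((M k r)\<^sup>2)" for r
        by (rule ennreal_mult) auto
      have "ennreal (1 / 2 * X) = ennreal (1 / 2) * (\<integral>\<^sup>+r\<in>{0..t}. ennreal ((M k r)\<^sup>2) \<partial>lborel)"
        unfolding X(2) using X(1) by (intro ennreal_mult) auto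
      also have "\<dots> = (\<integral>\<^sup>+r. ennreal (1 / 2) * (ennreal ((M k r)\<^sup>2) * indicator {0..t} r) \<partial>lborel)"
        by (rule nn_integral_cmult[symmetric]) measurable
      also have "\<dots> = (\<integral>\<^sup>+r\<in>{0..t}. ennreal (1 / 2 * (M k r)\<^sup>2) \<partial>lborel)"
        by (intro nn_integral_cong) (simp only: em mult.assoc)
      also have "\<dots> \<le> ennreal (W k 0 - W k t)"
        unfolding energy_parts[OF order_trans[OF t(1,2)], symmetric] by simp
      finally have "1 / 2 * X \<le> W k 0 - W k t"
        using W_antimono[of t k] t by simp
      also have "\<dots> \<le> c0 + quad_bound A B ustar (u k t)"
        using W_0_le[of k] W_lower[of t k] t by simp
      finally have 1: "1 / 2 * X \<le> c0 + A + B * (dist (u k t) ustar)\<^sup>2"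
        by (simp add: quad_bound_def)
      define d where "d = dist (u k t) (u k t')"
      have d2: "d\<^sup>2 \<le> \<tau> * X"
        using has_speed_holder[OF M, of t t t' X k] t X by (simp add: d_def abs_minus_commute)
      have "dist (u k t') (u k 0) \<le> sqrt (t' * K)"
        using has_speed_holder[OF M, of t' t' 0 K k] t K by (intro real_le_rsqrt) (simp add: t'_def)
      then have "dist (u k t) ustar \<le> d + c"
        using dist_triangle[of "u k t" ustar "u k t'"] dist_triangle[of "u k t'" ustar "u k 0"]
          dist_triangle[of "u k 0" ustar ubar] init_dist[of k] by (simp add: d_def c_def)
      then have "(dist (u k t) ustar)\<^sup>2 \<le> (d + c)\<^sup>2"
        by (intro power_mono) auto
      also have "\<dots> \<le> 2 * d\<^sup>2 + 2 * c\<^sup>2"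
        using sum_squares_bound[of d c] by (simp add: power2_sum)
      also have "\<dots> \<le> 2 * (\<tau> * X) + 2 * c\<^sup>2"
        using d2 by simp
      finally have "B * (dist (u k t) ustar)\<^sup>2 \<le> B * (2 * (\<tau> * X) + 2 * c\<^sup>2)"
        using B_nonneg by (rule mult_left_mono)
      also have "\<dots> = 2 * B * \<tau> * X + 2 * B * c\<^sup>2"
        by (simp add: algebra_simps)
      also have "2 * B * \<tau> * X \<le> 1 / 8 * X"
        using \<tau>(2) X(1) by (rule mult_right_mono)
      finally have "B * (dist (u k t) ustar)\<^sup>2 \<le> 1 / 8 * X + 2 * B * c\<^sup>2"
        by simp
      \<comment> \<open>Subtracting X / 8 from X / 2 leaves 3 X / 8 \<le> S, and 8 / 3 is rounded up
        to 3.\<close>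
      with 1 have "X \<le> 3 * S"
        using S unfolding S_def by (simp add: abs_if split: if_splits)
      then show ?thesis
        using X by (simp add: ennreal_leI)
    qed
    then show ?case
      using S unfolding t_def by (intro exI[of _ "3 * S"]) simp
  qed
  moreover obtain n where "T / \<tau> < real n"
    using reals_Archimedean2 by blast
  then have n: "T \<le> real n * \<tau>"
    using \<tau> by (simp add: pos_divide_less_eq less_imp_le)
  ultimately obtain K where K: "0 \<le> K" "\<And>k. (\<integral>\<^sup>+r\<in>{0..real n * \<tau>}. ennreal ((M k r)\<^sup>2) \<partial>lborel) \<le> ennreal K"
    by blast
  have "(\<integral>\<^sup>+r\<in>{0..T}. ennreal ((M k r)\<^sup>2) \<partial>lborel) \<le> ennreal K" for k
    by (rule order_trans[OF nn_integral_mono K(2)[of k]]) (use n in \<open>auto simp: indicator_def\<close>)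
  with K(1) show ?thesis by blast
qed

lemma curves_bounded: "\<exists>C. \<forall>k. \<forall>t\<in>{0..T}. dist (u k t) ubar \<le> C"
proof -
  obtain K where K: "0 \<le> K" "\<And>k. (\<integral>\<^sup>+r\<in>{0..T}. ennreal ((M k r)\<^sup>2) \<partial>lborel) \<le> ennreal K"
    using dissipation_bound[of T] by auto
  have "dist (u k t) ubar \<le> sqrt (T * K) + R" if t: "t \<in> {0..T}" for k t
  proof -
    have "(dist (u k t) (u k 0))\<^sup>2 \<le> \<bar>0 - t\<bar> * K"
      using t by (intro has_speed_holder[OF M _ _ K]) auto
    also have "\<dots> \<le> T * K"
      using t K by (intro mult_right_mono) auto
    finally have "dist (u k t) (u k 0) \<le> sqrt (T * K)"
      by (rule real_le_rsqrt)
    then show ?thesis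
      using dist_triangle[of "u k t" ubar "u k 0"] init_dist[of k] by simp
  qed
  then show ?thesis by blast
qed

text \<open>Through the energy identity this bounds the integral of (p - W) / e uniformly, so the
  integral of p - W over {0..T} is of order \<open>e k\<close>.\<close>

lemma value_decrease_bounded:
  assumes "0 \<le> T"
  shows "\<exists>C\<ge>0. \<forall>k. W k 0 - W k T \<le> C"
proof -
  obtain C where C: "\<And>k t. t \<in> {0..T} \<Longrightarrow> dist (u k t) ubar \<le> C"
    using curves_bounded[of T] by blast
  have "W k 0 - W k T \<le> \<bar>c0\<bar> + A + B * (C + dist ubar ustar)\<^sup>2" for k
  proof -
    have "dist (u k T) ustar \<le> C + dist ubar ustar"
      using C[of T k] assms dist_triangle[of "u k T" ustar ubar] by simp
    then have "B * (dist (u k T) ustar)\<^sup>2 \<le> B * (C + dist ubar ustar)\<^sup>2"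
      using B_nonneg by (intro mult_left_mono power_mono) auto
    then show ?thesis
      using W_0_le[of k] W_lower[OF assms, of k] by (simp add: quad_bound_def)
  qed
  moreover have "0 \<le> \<bar>c0\<bar> + A + B * (C + dist ubar ustar)\<^sup>2"
    using A_nonneg B_nonneg by simp
  ultimately show ?thesis by blast
qed

text \<open>Truncating the gap at 1 and weighting it by exp (- t) turns the bounds on all {0..T}
  into a single L1 convergence on the half-line: the part up to T is at most \<open>e k * C\<close>
  and the rest at most exp (- T). One subsequence then works for almost every time, and truncation
  and weight are removed pointwise.\<close>

lemma ex_AE_convergent_subseq:
  obtains r :: "nat \<Rightarrow> nat" where "strict_mono r"
    "AE t in lborel. 0 < t \<longrightarrow> (\<lambda>k. p (r k) t - W (r k) t) \<longlonglongrightarrow> 0"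
proof -
  define f where "f k t = min 1 \<bar>p k t - W k t\<bar> * (exp (- t) * indicator {0<..} t)" for k t
  have [measurable]: "f k \<in> borel_measurable borel" for k
    unfolding f_def by measurable
  have f0: "0 \<le> f k t" for k t
    by (simp add: f_def)
  have exp1: "(\<integral>\<^sup>+t\<in>{T<..}. ennreal (exp (- t)) \<partial>lborel) = ennreal (exp (- T))" for T :: real
    using nn_integral_exp_Ioi[of 1 T] by simp
  have bound: "(\<integral>\<^sup>+t. ennreal (f k t) \<partial>lborel) \<le> ennreal (e k * C + exp (- T))"
    if T: "0 \<le> T" and C: "0 \<le> C" "W k 0 - W k T \<le> C" for k T C
  proof -
    have "(\<integral>\<^sup>+t. ennreal (f k t) \<partial>lborel)
        \<le> (\<integral>\<^sup>+t. ennreal (e k) * (ennreal ((p k t - W k t) / e k) * indicator {0..T} t) + ennreal (exp (- t)) * indicator {T<..} t \<partial>lborel)"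
    proof (rule nn_integral_mono_AE)
      show "AE t in lborel. ennreal (f k t)
          \<le> ennreal (e k) * (ennreal ((p k t - W k t) / e k) * indicator {0..T} t) + ennreal (exp (- t)) * indicator {T<..} t"
        using W_le_p[of k]
      proof eventually_elim
        case (elim t)
        consider "t \<le> 0" | "0 < t" "t \<le> T" | "T < t" by linarith
        then show ?case
        proof cases
          case 1
          then show ?thesis by (simp add: f_def)
        next
          case 2
          have "f k t \<le> \<bar>p k t - W k t\<bar> * 1"
            unfolding f_def using 2 by (intro mult_mono) auto
          also have "\<dots> = e k * ((p k t - W k t) / e k)"
            using elim 2 e_pos[of k] by simp
          finally have "ennreal (f k t) \<le> ennreal (e k * ((p k t - W k t) / e k))"
            by (rule ennreal_leI)
          also have "\<dots> = ennreal (e k) * ennreal ((p k t - W k t) / e k)"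
            using e_pos[of k] by (intro ennreal_mult') simp
          finally show ?thesis using 2 by simp
        next
          case 3
          have "f k t \<le> 1 * exp (- t)"
            unfolding f_def using 3 by (intro mult_mono) (auto simp: indicator_def)
          then show ?thesis using 3 by (simp add: ennreal_leI)
        qed
      qed
    qed
    also have "\<dots> = ennreal (e k) * (\<integral>\<^sup>+t\<in>{0..T}. ennreal ((p k t - W k t) / e k) \<partial>lborel) + (\<integral>\<^sup>+t\<in>{T<..}. ennreal (exp (- t)) \<partial>lborel)"
      by (subst nn_integral_add) (auto simp: nn_integral_cmult)
    also have "\<dots> \<le> ennreal (e k) * ennreal C + ennreal (exp (- T))"
    proof (intro add_mono mult_left_mono)
      have "(\<integral>\<^sup>+t\<in>{0..T}. ennreal ((p k t - W k t) / e k) \<partial>lborel) \<le> ennreal (W k 0 - W k T)"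
        unfolding energy_parts[OF T, symmetric] by simp
      also have "\<dots> \<le> ennreal C"
        using C by (intro ennreal_leI)
      finally show "(\<integral>\<^sup>+t\<in>{0..T}. ennreal ((p k t - W k t) / e k) \<partial>lborel) \<le> ennreal C" .
    qed (simp_all add: exp1)
    also have "\<dots> = ennreal (e k * C + exp (- T))"
      using C e_pos[of k] by (simp add: ennreal_mult)
    finally show ?thesis .
  qed
  have int: "integrable lborel (f k)" for k
  proof -
    have "(\<integral>\<^sup>+t. ennreal (f k t) \<partial>lborel) < \<infinity>"
      by (rule le_less_trans[OF bound[of 0 "max 0 (W k 0 - W k 0)" k]]) auto
    then show ?thesis
      using f0 by (intro integrableI_nonneg) auto
  qed
  have lim: "(\<lambda>k. \<integral>t. norm (f k t) \<partial>lborel) \<longlonglongrightarrow> 0"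
  proof (rule LIMSEQ_I)
    fix \<eta> :: real assume \<eta>: "0 < \<eta>"
    define T where "T = \<bar>ln (\<eta> / 2)\<bar>"
    have T: "0 \<le> T" "exp (- T) \<le> \<eta> / 2"
    proof -
      have "exp (- T) \<le> exp (ln (\<eta> / 2))"
        by (simp only: exp_le_cancel_iff) (simp add: T_def)
      then show "exp (- T) \<le> \<eta> / 2" using \<eta> by simp
    qed (simp add: T_def)
    obtain C where C: "0 \<le> C" "\<And>k. W k 0 - W k T \<le> C"
      using value_decrease_bounded[OF T(1)] by auto
    have "(\<lambda>k. e k * C) \<longlonglongrightarrow> 0"
      using tendsto_mult_left_zero[OF e_lim] .
    then have "\<forall>\<^sub>F k in sequentially. e k * C < \<eta> / 2"
      using \<eta> by (intro order_tendstoD) auto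
    then obtain k0 where k0: "\<And>k. k0 \<le> k \<Longrightarrow> e k * C < \<eta> / 2"
      by (auto simp: eventually_sequentially)
    show "\<exists>k0. \<forall>k\<ge>k0. norm ((\<integral>t. norm (f k t) \<partial>lborel) - 0) < \<eta>"
    proof (intro exI allI impI)
      fix k assume "k0 \<le> k"
      have eq: "(\<integral>t. norm (f k t) \<partial>lborel) = (\<integral>t. f k t \<partial>lborel)"
        using f0 by simp
      have "ennreal (\<integral>t. f k t \<partial>lborel) = (\<integral>\<^sup>+t. ennreal (f k t) \<partial>lborel)"
        using int f0 by (intro nn_integral_eq_integral[symmetric]) auto
      also have "\<dots> \<le> ennreal (e k * C + exp (- T))"
        by (rule bound[OF T(1) C])
      finally have "(\<integral>t. f k t \<partial>lborel) \<le> e k * C + exp (- T)"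
        using C e_pos[of k] by (subst (asm) ennreal_le_iff) auto
      then have "(\<integral>t. f k t \<partial>lborel) < \<eta>"
        using k0[OF \<open>k0 \<le> k\<close>] T(2) by simp
      moreover have "0 \<le> (\<integral>t. f k t \<partial>lborel)"
        using f0 by simp
      ultimately show "norm ((\<integral>t. norm (f k t) \<partial>lborel) - 0) < \<eta>"
        unfolding eq by simp
    qed
  qed
  obtain r :: "nat \<Rightarrow> nat" where r: "strict_mono r" "AE t in lborel. (\<lambda>k. f (r k) t) \<longlonglongrightarrow> 0"
    using tendsto_L1_AE_subseq[OF int lim] by blast
  have "AE t in lborel. 0 < t \<longrightarrow> (\<lambda>k. p (r k) t - W (r k) t) \<longlonglongrightarrow> 0"
    using r(2)
  proof eventually_elim
    case (elim t)
    show ?case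
    proof
      assume t: "0 < t"
      have "(\<lambda>k. f (r k) t * exp t) \<longlonglongrightarrow> 0 * exp t"
        using elim by (intro tendsto_intros)
      moreover have "f (r k) t * exp t = min 1 \<bar>p (r k) t - W (r k) t\<bar>" for k
        using t by (simp add: f_def exp_minus)
      ultimately have m: "(\<lambda>k. min 1 \<bar>p (r k) t - W (r k) t\<bar>) \<longlonglongrightarrow> 0"
        by simp
      then have "\<forall>\<^sub>F k in sequentially. min 1 \<bar>p (r k) t - W (r k) t\<bar> < 1"
        by (intro order_tendstoD) auto
      then have "\<forall>\<^sub>F k in sequentially. min 1 \<bar>p (r k) t - W (r k) t\<bar> = \<bar>p (r k) t - W (r k) t\<bar>"
        by eventually_elim auto
      with m have "(\<lambda>k. \<bar>p (r k) t - W (r k) t\<bar>) \<longlonglongrightarrow> 0"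
        by (rule Lim_transform_eventually)
      then show "(\<lambda>k. p (r k) t - W (r k) t) \<longlonglongrightarrow> 0"
        by (rule tendsto_rabs_zero_cancel)
    qed
  qed
  with r(1) show thesis by (rule that)
qed

end

lemma ennreal_cmult_liminf_le:
  fixes f :: "nat \<Rightarrow> ennreal"
  shows "c * liminf f \<le> liminf (\<lambda>n. c * f n)"
proof -
  have "c * liminf f = (SUP n. c * (INF m\<in>{n..}. f m))"
    unfolding liminf_SUP_INF by (rule SUP_mult_left_ennreal)
  also have "\<dots> \<le> (SUP n. INF m\<in>{n..}. c * f m)"
    by (intro SUP_mono) (auto intro!: INF_greatest mult_left_mono INF_lower)
  finally show ?thesis
    unfolding liminf_SUP_INF .
qed

context wed_sequence
begin

section \<open>The slope of the limit curve\<close>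

text \<open>The contrapositive of \<open>W_slope\<close>: if the gap divided by e is below s^2 / 2,
  there is a point of slope at most s within distance sqrt e of \<open>u t\<close> and below its
  level. The radius vanishes, so these points converge to the same limit, while (sqrt e / s) / e
  tends to infinity and removes the exponential. They have bounded energy because
  \<open>conv\<close> keeps \<phi> close to W \<le> c0, hence they are admissible in the definition
  of \<open>relaxed_slope\<close>.\<close>

lemma relaxed_slope_le_liminf:
  assumes r: "strict_mono (r :: nat \<Rightarrow> nat)" and t: "0 \<le> t"
    and z: "limitin \<sigma> (\<lambda>k. u (r k) t) z sequentially"
    and phi: "\<And>k. \<phi> (u (r k) t) = ereal (p (r k) t)"
    and conv: "(\<lambda>k. p (r k) t - W (r k) t) \<longlonglongrightarrow> 0"
  shows "(relaxed_slope \<sigma> \<phi> z)\<^sup>2 / 2 \<le> liminf (\<lambda>k. ennreal ((p (r k) t - W (r k) t) / e (r k)))"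
    (is "_ \<le> liminf ?d")
proof (cases "liminf ?d")
  case top
  then show ?thesis by (simp only: top_greatest)
next
  case (real L)
  have main: "relaxed_slope \<sigma> \<phi> z \<le> ennreal s" if s: "0 < s" "L < 1 / 2 * s\<^sup>2" for s
  proof -
    \<comment> \<open>The midpoint leaves room on both sides: below for the convergence of the
      quotients to L, above for the exponential correction to s^2 / 2.\<close>
    define L' where "L' = (L + 1 / 2 * s\<^sup>2) / 2"
    have L': "L < L'" "L' < 1 / 2 * s\<^sup>2"
      using s by (auto simp: L'_def)
    obtain q :: "nat \<Rightarrow> nat" where q: "strict_mono q" "(?d \<circ> q) \<longlonglongrightarrow> ennreal L"
      using liminf_subseq_lim[of ?d] unfolding real by blast
    define k where "k = r \<circ> q"
    have k: "strict_mono k"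
      unfolding k_def by (rule strict_mono_o[OF r q(1)])
    have "ennreal L < ennreal L'"
      using L' real by (simp add: ennreal_less_iff)
    with q(2) have ev1: "\<forall>\<^sub>F j in sequentially. (?d \<circ> q) j < ennreal L'"
      by (rule order_tendstoD)
    have ek: "(\<lambda>j. e (k j)) \<longlonglongrightarrow> 0"
      using LIMSEQ_subseq_LIMSEQ[OF e_lim k] by (simp add: o_def)
    then have ek': "filterlim (\<lambda>j. e (k j)) (at_right 0) sequentially"
      using e_pos by (auto simp: filterlim_at less_imp_neq[symmetric])
    have "((\<lambda>x::real. 1 / 2 * s\<^sup>2 * (1 - exp (- (sqrt x / s) / x))) \<longlongrightarrow> 1 / 2 * s\<^sup>2 * (1 - 0)) (at_right 0)"
    proof (intro tendsto_intros)
      have "filterlim (\<lambda>x::real. - (sqrt x / s) / x) at_bot (at_right 0)"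
      proof -
        have "filterlim (\<lambda>x::real. sqrt x) (at_right 0) (at_right 0)"
          unfolding filterlim_at
          by (auto intro!: tendsto_eq_intros simp: eventually_at_filter)
        then have "filterlim (\<lambda>x::real. inverse (sqrt x)) at_top (at_right 0)"
          by (rule filterlim_compose[OF filterlim_inverse_at_top_right])
        then have "filterlim (\<lambda>x::real. (- 1 / s) * inverse (sqrt x)) at_bot (at_right 0)"
          using s(1) by (intro filterlim_tendsto_neg_mult_at_bot[OF tendsto_const]) auto
        moreover have "\<forall>\<^sub>F x in at_right (0::real). - (sqrt x / s) / x = (- 1 / s) * inverse (sqrt x)"
          using eventually_at_right_less[of 0]
          by eventually_elim (simp add: divide_simps)
        ultimately show ?thesis
          by (rule filterlim_cong[THEN iffD2, OF refl refl, rotated])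
      qed
      then show "((\<lambda>x::real. exp (- (sqrt x / s) / x)) \<longlongrightarrow> 0) (at_right 0)"
        by (rule filterlim_compose[OF exp_at_bot])
    qed
    then have "(\<lambda>j. 1 / 2 * s\<^sup>2 * (1 - exp (- (sqrt (e (k j)) / s) / e (k j)))) \<longlonglongrightarrow> 1 / 2 * s\<^sup>2 * (1 - 0)"
      by (rule filterlim_compose[OF _ ek'])
    then have ev2: "\<forall>\<^sub>F j in sequentially. L' < 1 / 2 * s\<^sup>2 * (1 - exp (- (sqrt (e (k j)) / s) / e (k j)))"
      using L'(2) by (intro order_tendstoD) auto
    have ev3: "\<forall>\<^sub>F j in sequentially. p (k j) t - W (k j) t < 1"
      using LIMSEQ_subseq_LIMSEQ[OF conv q(1)] unfolding k_def o_def by (rule order_tendstoD) simp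
    have "\<forall>\<^sub>F j in sequentially. (\<exists>y. dist (u (k j) t) y \<le> sqrt (e (k j)) \<and> \<phi> y \<le> \<phi> (u (k j) t) \<and> local_slope \<phi> y \<le> ennreal s)
        \<and> \<phi> (u (k j) t) \<le> ereal (c0 + 1)"
      using ev1 ev2 ev3
    proof eventually_elim
      case (elim j)
      have ep: "0 < e (k j)" by (rule e_pos)
      have pk: "\<phi> (u (k j) t) = ereal (p (k j) t)"
        unfolding k_def o_def by (rule phi)
      have "ennreal ((p (k j) t - W (k j) t) / e (k j)) < ennreal L'"
        using elim(1) by (simp add: k_def)
      then have "(p (k j) t - W (k j) t) / e (k j) < L'"
        using L' real by (metis ennreal_leI not_less)
      also note elim(2)
      finally have less: "p (k j) t - W (k j) t < 1 / 2 * s\<^sup>2 * e (k j) * (1 - exp (- (sqrt (e (k j)) / s) / e (k j)))"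
        using ep by (simp add: pos_divide_less_eq mult_ac)
      have "\<exists>y. dist (u (k j) t) y \<le> sqrt (e (k j)) \<and> \<phi> y \<le> \<phi> (u (k j) t) \<and> local_slope \<phi> y \<le> ennreal s"
      proof (rule ccontr)
        assume no: "\<not> ?thesis"
        have "1 / 2 * s\<^sup>2 * e (k j) * (1 - exp (- (sqrt (e (k j)) / s) / e (k j))) \<le> p (k j) t - W (k j) t"
        proof (rule W_slope[OF t pk _ s(1)])
          show "0 < sqrt (e (k j))" using ep by simp
          show "ennreal s < local_slope \<phi> y" if "dist (u (k j) t) y \<le> sqrt (e (k j))" "\<phi> y \<le> \<phi> (u (k j) t)" for y
            using no that not_le by blast
        qed
        with less show False by simp
      qed
      moreover have "\<phi> (u (k j) t) \<le> ereal (c0 + 1)"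
        using elim(3) W_antimono[OF t, of "k j"] W_0_le[of "k j"] by (simp add: pk)
      ultimately show ?case by blast
    qed
    then obtain N where N: "\<And>j. N \<le> j \<Longrightarrow> (\<exists>y. dist (u (k j) t) y \<le> sqrt (e (k j)) \<and> \<phi> y \<le> \<phi> (u (k j) t) \<and> local_slope \<phi> y \<le> ennreal s)
        \<and> \<phi> (u (k j) t) \<le> ereal (c0 + 1)"
      by (auto simp: eventually_sequentially)
    define l where "l j = k (j + N)" for j
    have l: "strict_mono l"
      using k by (simp add: strict_mono_def l_def)
    have "\<forall>j. \<exists>y. dist (u (l j) t) y \<le> sqrt (e (l j)) \<and> \<phi> y \<le> \<phi> (u (l j) t) \<and> local_slope \<phi> y \<le> ennreal s"
      using N unfolding l_def by (metis le_add2)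
    from choice[OF this] obtain y where y: "\<forall>j. dist (u (l j) t) (y j) \<le> sqrt (e (l j)) \<and> \<phi> (y j) \<le> \<phi> (u (l j) t) \<and> local_slope \<phi> (y j) \<le> ennreal s"
      by (elim exE)
    have el: "(\<lambda>j. e (l j)) \<longlonglongrightarrow> 0"
      using LIMSEQ_subseq_LIMSEQ[OF e_lim l] by (simp add: o_def)
    then have sl: "(\<lambda>j. sqrt (e (l j))) \<longlonglongrightarrow> 0"
      using tendsto_real_sqrt by fastforce
    have dl: "(\<lambda>j. dist (u (l j) t) (y j)) \<longlonglongrightarrow> 0"
      by (rule Lim_null_comparison[OF _ sl]) (use y in auto)
    have "limitin \<sigma> (\<lambda>j. u (l j) t) z sequentially"
    proof -
      have "strict_mono (\<lambda>j. q (j + N))"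
        using q(1) by (simp add: strict_mono_def)
      from limitin_subsequence[OF this z] show ?thesis
        by (simp add: l_def k_def o_def)
    qed
    then have yz: "limitin \<sigma> y z sequentially"
      by (rule limitin_perturb[OF _ dl])
    have "bdd_above (range (\<lambda>j. dist (y j) z))"
    proof -
      obtain C where C: "\<forall>k. \<forall>t'\<in>{0..t}. dist (u k t') ubar \<le> C"
        using curves_bounded[of t] by blast
      obtain S where S: "\<forall>j. norm (dist (u (l j) t) (y j)) \<le> S"
        using convergent_imp_Bseq[OF convergentI[OF dl]] unfolding Bseq_def by blast
      have "dist (y j) z \<le> S + C + dist ubar z" for j
      proof -
        have "dist (y j) z \<le> dist (u (l j) t) (y j) + dist (u (l j) t) ubar + dist ubar z"
          using dist_triangle[of "y j" z "u (l j) t"] dist_triangle[of "u (l j) t" z ubar] by (simp add: dist_commute)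
        then show ?thesis
          using S[THEN spec, of j] C[THEN spec, of "l j"] t by force
      qed
      then show ?thesis by (intro bdd_aboveI) auto
    qed
    moreover have "(SUP j. \<phi> (y j)) < \<infinity>"
    proof -
      have "(SUP j. \<phi> (y j)) \<le> ereal (c0 + 1)"
      proof (rule SUP_least)
        fix j
        have "\<phi> (y j) \<le> \<phi> (u (l j) t)" using y by blast
        also have "\<dots> \<le> ereal (c0 + 1)"
          using N[of "j + N"] by (simp add: l_def)
        finally show "\<phi> (y j) \<le> ereal (c0 + 1)" .
      qed
      then show ?thesis by (rule le_less_trans) simp
    qed
    ultimately have "relaxed_slope \<sigma> \<phi> z \<le> liminf (\<lambda>j. local_slope \<phi> (y j))"
      unfolding relaxed_slope_def using yz by (intro Inf_lower) blast
    also have "\<dots> \<le> liminf (\<lambda>j::nat. ennreal s)"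
      using y by (intro Liminf_mono always_eventually) auto
    also have "\<dots> = ennreal s"
      by (simp add: Liminf_const)
    finally show ?thesis .
  qed
  \<comment> \<open>\<open>main\<close> needs s positive and s^2 / 2 strictly above L, which s =
    sqrt (2 L) + \<eta> satisfies even for L = 0.\<close>
  have "relaxed_slope \<sigma> \<phi> z \<le> ennreal (sqrt (2 * L)) + ennreal \<eta>" if "0 < \<eta>" for \<eta>
  proof -
    have "2 * L = (sqrt (2 * L))\<^sup>2"
      using real by simp
    also have "\<dots> < (sqrt (2 * L) + \<eta>)\<^sup>2"
      using that real by (intro power_strict_mono) auto
    finally have "relaxed_slope \<sigma> \<phi> z \<le> ennreal (sqrt (2 * L) + \<eta>)"
      using that real by (intro main) (auto intro: add_nonneg_pos)
    then show ?thesis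
      using that real by (simp add: ennreal_plus)
  qed
  then have "relaxed_slope \<sigma> \<phi> z \<le> ennreal (sqrt (2 * L))"
    by (rule ennreal_le_epsilon)
  then have "(relaxed_slope \<sigma> \<phi> z)\<^sup>2 / 2 \<le> (ennreal (sqrt (2 * L)))\<^sup>2 / 2"
    by (intro divide_right_mono_ennreal power_mono) auto
  also have "(ennreal (sqrt (2 * L)))\<^sup>2 = ennreal (2 * L)"
    using real by (simp add: ennreal_power)
  also have "ennreal (2 * L) / 2 = ennreal L"
    using divide_ennreal[of "2 * L" 2] real by simp
  finally show ?thesis
    unfolding real .
qed

section \<open>Passage to the limit in the energy identity\<close>

text \<open>\<open>\<Lambda>\<close> is the lower limit of the quotients (p - W) / e and hence
  measurable, so Fatou's lemma and additivity of the integral apply to it; it stands in for half the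
  squared relaxed slope along the limit. The inequality is proved first at almost every time, where
  the gap vanishes, and then extended to all times.\<close>

lemma limit_curve:
  obtains r v N \<Lambda> where "strict_mono (r :: nat \<Rightarrow> nat)" "has_speed v N" "v 0 = ubar"
    "\<And>t. 0 \<le> t \<Longrightarrow> limitin \<sigma> (\<lambda>k. u (r k) t) (v t) sequentially"
    "\<Lambda> \<in> borel_measurable borel"
    "AE t in lborel. 0 < t \<longrightarrow> (relaxed_slope \<sigma> \<phi> (v t))\<^sup>2 / 2 \<le> \<Lambda> t"
    "\<And>t. 0 \<le> t \<Longrightarrow> enn2ereal (\<integral>\<^sup>+s\<in>{0..t}. (ennreal (1 / 2 * (N s)\<^sup>2) + \<Lambda> s) \<partial>lborel) + \<phi> (v t) \<le> \<phi> ubar"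
proof -
  obtain r1 :: "nat \<Rightarrow> nat" where r1: "strict_mono r1"
    "AE t in lborel. 0 < t \<longrightarrow> (\<lambda>k. p (r1 k) t - W (r1 k) t) \<longlonglongrightarrow> 0"
    by (rule ex_AE_convergent_subseq) (rule that)
  \<comment> \<open>At good times the energies are real and, along \<open>r1\<close>, eventually at
    most c0 + 1, so compactness is available. At other times the energy along the curves may be
    infinite.\<close>
  define good where "good t \<longleftrightarrow> (\<forall>k. \<phi> (u k t) = ereal (p k t)) \<and> (\<lambda>k. p (r1 k) t - W (r1 k) t) \<longlonglongrightarrow> 0" for t
  have good: "AE t in lborel. 0 < t \<longrightarrow> good t"
  proof -
    have "AE t in lborel. \<forall>k. 0 \<le> t \<longrightarrow> \<phi> (u k t) = ereal (p k t)"
      unfolding AE_all_countable using phi_p by blast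
    with r1(2) show ?thesis
      by eventually_elim (simp add: good_def)
  qed
  obtain D where D: "countable D" "D \<subseteq> {0..}" "\<And>t. t \<in> D \<Longrightarrow> good t"
    "\<And>t e. 0 \<le> t \<Longrightarrow> 0 < e \<Longrightarrow> \<exists>q\<in>D. \<bar>q - t\<bar> < e"
    by (rule countable_dense_of_AE[OF good]) (rule that)
  obtain r2 v where r2: "strict_mono (r2 :: nat \<Rightarrow> nat)"
    "\<And>t. 0 \<le> t \<Longrightarrow> limitin \<sigma> (\<lambda>k. u (r1 (r2 k)) t) (v t) sequentially"
  proof (rule ex_pointwise_limit[OF D(1,2,4), of "\<lambda>k. u (r1 k)"])
    show "\<exists>C. \<forall>\<^sub>F k in sequentially. \<phi> (u (r1 k) q) \<le> ereal C" if q: "q \<in> D" for q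
    proof
      have "\<forall>\<^sub>F k in sequentially. p (r1 k) q - W (r1 k) q < 1"
        using D(3)[OF q] unfolding good_def by (intro order_tendstoD) auto
      then show "\<forall>\<^sub>F k in sequentially. \<phi> (u (r1 k) q) \<le> ereal (c0 + 1)"
      proof eventually_elim
        case (elim k)
        have "W (r1 k) q \<le> c0"
          using W_antimono[of q "r1 k"] W_0_le[of "r1 k"] D(2) q by force
        then show ?case
          using elim D(3)[OF q] by (simp add: good_def)
      qed
    qed
    show "bounded (range (\<lambda>k. u (r1 k) q))" if "q \<in> D" for q
    proof -
      obtain C where C: "\<forall>k. \<forall>t\<in>{0..q}. dist (u k t) ubar \<le> C"
        using curves_bounded[of q] by blast
      show ?thesis
        by (rule bounded_subset[OF bounded_cball[of ubar C]]) (use C D(2) that in \<open>auto simp: dist_commute\<close>)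
    qed
    show "\<exists>d>0. \<forall>\<^sub>F k in sequentially. \<forall>s\<in>{0..T}. \<forall>t\<in>{0..T}. \<bar>s - t\<bar> < d \<longrightarrow> dist (u (r1 k) s) (u (r1 k) t) < \<eta>"
      if \<eta>: "0 < \<eta>" for T \<eta>
    proof -
      obtain K where K: "0 \<le> K" "\<And>k. (\<integral>\<^sup>+r\<in>{0..T}. ennreal ((M k r)\<^sup>2) \<partial>lborel) \<le> ennreal K"
        using dissipation_bound[of T] by auto
      show ?thesis
      proof (intro exI conjI always_eventually allI ballI impI)
        show "0 < \<eta>\<^sup>2 / (K + 1)" using \<eta> K by simp
        fix k s t assume st: "s \<in> {0..T}" "t \<in> {0..T}" "\<bar>s - t\<bar> < \<eta>\<^sup>2 / (K + 1)"
        have "(dist (u (r1 k) s) (u (r1 k) t))\<^sup>2 \<le> \<bar>t - s\<bar> * K"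
          by (rule has_speed_holder[OF M st(1,2) K])
        also have "\<dots> \<le> \<bar>s - t\<bar> * (K + 1)"
          by (simp add: abs_minus_commute mult_left_mono)
        also have "\<dots> < \<eta>\<^sup>2"
          using st(3) K by (simp add: pos_less_divide_eq)
        finally show "dist (u (r1 k) s) (u (r1 k) t) < \<eta>"
          using \<eta> by (simp add: power_less_imp_less_base)
      qed
    qed
  qed (assumption | rule that)+
  define r where "r = r1 \<circ> r2"
  have r: "strict_mono r"
    unfolding r_def by (rule strict_mono_o[OF r1(1) r2(1)])
  have v: "limitin \<sigma> (\<lambda>k. u (r k) t) (v t) sequentially" if "0 \<le> t" for t
    using r2(2)[OF that] by (simp add: r_def)
  \<comment> \<open>The initial points converge to both \<open>v 0\<close> and \<open>ubar\<close>;
    if these differed, (MT1) would make the distance of a point to itself eventually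
    positive.\<close>
  have v0: "v 0 = ubar"
  proof (rule ccontr)
    assume "v 0 \<noteq> ubar"
    then have "\<forall>\<^sub>F k in sequentially. 0 < dist (u (r k) 0) (u (r k) 0)"
      using limitin_subsequence[OF r init_lim] by (intro eventually_dist_greater[OF v]) (auto simp: o_def)
    then show False by simp
  qed
  have lim: "\<forall>\<^sub>F k in sequentially. c < dist (u (r k) s) (u (r k) t)" if "0 \<le> s" "0 \<le> t" "c < dist (v s) (v t)" for s t c
    by (rule eventually_dist_greater[OF v v]) (use that in auto)
  obtain N where N: "has_speed v N"
  proof (rule ex_has_speed_limit[of "\<lambda>k. u (r k)" "\<lambda>k. M (r k)" v])
    show "\<exists>K\<ge>0. \<forall>k. (\<integral>\<^sup>+x\<in>{0..T}. ennreal ((M (r k) x)\<^sup>2) \<partial>lborel) \<le> ennreal K" for T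
      using dissipation_bound[of T] by blast
  qed (use M lim that in auto)
  note [measurable] = has_speedD(1)[OF N]
  define \<Lambda> where "\<Lambda> t = liminf (\<lambda>k. ennreal ((p (r k) t - W (r k) t) / e (r k)))" for t
  have \<Lambda> [measurable]: "\<Lambda> \<in> borel_measurable borel"
    unfolding \<Lambda>_def by measurable
  have conv: "(\<lambda>k. p (r k) t - W (r k) t) \<longlonglongrightarrow> 0" if "good t" for t
    using that LIMSEQ_subseq_LIMSEQ[OF _ r2(1), of "\<lambda>k. p (r1 k) t - W (r1 k) t" 0]
    unfolding good_def r_def o_def by blast
  have slope: "AE t in lborel. 0 < t \<longrightarrow> (relaxed_slope \<sigma> \<phi> (v t))\<^sup>2 / 2 \<le> \<Lambda> t"
    using good
  proof eventually_elim
    case (elim t)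
    then show ?case
      unfolding \<Lambda>_def using conv by (auto simp: good_def intro!: relaxed_slope_le_liminf[OF r _ v])
  qed
  define I where "I t = (\<integral>\<^sup>+s\<in>{0..t}. (ennreal (1 / 2 * (N s)\<^sup>2) + \<Lambda> s) \<partial>lborel)" for t
  have I_mono: "I s \<le> I t" if "s \<le> t" for s t
    unfolding I_def using that by (intro nn_integral_mono) (auto simp: indicator_def)
  have I_le: "I t \<le> liminf (\<lambda>k. ennreal (W (r k) 0 - W (r k) t))" if t: "0 \<le> t" for t
  proof -
    have half: "(\<integral>\<^sup>+s\<in>{0..t}. ennreal (1 / 2 * (m s)\<^sup>2) \<partial>lborel) = ennreal (1 / 2) * (\<integral>\<^sup>+s\<in>{0..t}. ennreal ((m s)\<^sup>2) \<partial>lborel)"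
      if [measurable]: "m \<in> borel_measurable borel" for m :: "real \<Rightarrow> real"
    proof -
      have em: "ennreal (1 / 2 * (m s)\<^sup>2) = ennreal (1 / 2) * ennreal ((m s)\<^sup>2)" for s
        by (rule ennreal_mult) auto
      show ?thesis
        unfolding em mult.assoc by (rule nn_integral_cmult) measurable
    qed
    have "I t = (\<integral>\<^sup>+s. ennreal (1 / 2 * (N s)\<^sup>2) * indicator {0..t} s + \<Lambda> s * indicator {0..t} s \<partial>lborel)"
      unfolding I_def by (intro nn_integral_cong) (simp add: distrib_right)
    also have "\<dots> = (\<integral>\<^sup>+s\<in>{0..t}. ennreal (1 / 2 * (N s)\<^sup>2) \<partial>lborel) + (\<integral>\<^sup>+s\<in>{0..t}. \<Lambda> s \<partial>lborel)"
      by (rule nn_integral_add) measurable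
    also have "\<dots> \<le> liminf (\<lambda>k. \<integral>\<^sup>+s\<in>{0..t}. ennreal (1 / 2 * (M (r k) s)\<^sup>2) \<partial>lborel)
        + liminf (\<lambda>k. \<integral>\<^sup>+s\<in>{0..t}. ennreal ((p (r k) s - W (r k) s) / e (r k)) \<partial>lborel)"
    proof (rule add_mono)
      have "(\<integral>\<^sup>+s\<in>{0..t}. ennreal ((N s)\<^sup>2) \<partial>lborel) \<le> liminf (\<lambda>k. \<integral>\<^sup>+s\<in>{0..t}. ennreal ((M (r k) s)\<^sup>2) \<partial>lborel)"
        by (rule has_speed_lower_semicontinuous[OF N M lim])
      then have "ennreal (1 / 2) * (\<integral>\<^sup>+s\<in>{0..t}. ennreal ((N s)\<^sup>2) \<partial>lborel)
          \<le> ennreal (1 / 2) * liminf (\<lambda>k. \<integral>\<^sup>+s\<in>{0..t}. ennreal ((M (r k) s)\<^sup>2) \<partial>lborel)"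
        by (rule mult_left_mono) simp
      also have "\<dots> \<le> liminf (\<lambda>k. ennreal (1 / 2) * (\<integral>\<^sup>+s\<in>{0..t}. ennreal ((M (r k) s)\<^sup>2) \<partial>lborel))"
        by (rule ennreal_cmult_liminf_le)
      finally show "(\<integral>\<^sup>+s\<in>{0..t}. ennreal (1 / 2 * (N s)\<^sup>2) \<partial>lborel)
          \<le> liminf (\<lambda>k. \<integral>\<^sup>+s\<in>{0..t}. ennreal (1 / 2 * (M (r k) s)\<^sup>2) \<partial>lborel)"
        using half[OF M_meas] half[OF has_speedD(1)[OF N]] by simp
      have "(\<integral>\<^sup>+s\<in>{0..t}. \<Lambda> s \<partial>lborel)
          = (\<integral>\<^sup>+s. liminf (\<lambda>k. ennreal ((p (r k) s - W (r k) s) / e (r k)) * indicator {0..t} s) \<partial>lborel)"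
        unfolding \<Lambda>_def by (intro nn_integral_cong) (simp add: indicator_def Liminf_const)
      also have "\<dots> \<le> liminf (\<lambda>k. \<integral>\<^sup>+s\<in>{0..t}. ennreal ((p (r k) s - W (r k) s) / e (r k)) \<partial>lborel)"
        by (rule nn_integral_liminf) measurable
      finally show "(\<integral>\<^sup>+s\<in>{0..t}. \<Lambda> s \<partial>lborel)
          \<le> liminf (\<lambda>k. \<integral>\<^sup>+s\<in>{0..t}. ennreal ((p (r k) s - W (r k) s) / e (r k)) \<partial>lborel)" .
    qed
    also have "\<dots> \<le> liminf (\<lambda>k. ennreal (W (r k) 0 - W (r k) t))"
      using ennreal_liminf_add by (simp only: energy_parts[OF t, symmetric])
    finally show ?thesis .
  qed
  have vb: "bounded (range (\<lambda>k. u (r k) t))" if "0 \<le> t" for t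
  proof -
    obtain C where C: "\<forall>k. \<forall>s\<in>{0..t}. dist (u k s) ubar \<le> C"
      using curves_bounded[of t] by blast
    show ?thesis
      by (rule bounded_subset[OF bounded_cball[of ubar C]]) (use C that in \<open>auto simp: dist_commute\<close>)
  qed
  \<comment> \<open>At a good time p - W tends to 0, so lower semicontinuity of \<phi> becomes a
    lower bound for the limiting values \<open>W\<close>, while \<open>W\<close> at time 0 is at
    most \<phi> of the initial points, which converges to \<open>a0\<close>.\<close>
  have ineq_good: "\<exists>b. \<phi> (v t) = ereal b \<and> b \<le> a0 \<and> I t \<le> ennreal (a0 - b)" if t: "0 \<le> t" "good t" for t
  proof -
    have lsc: "\<phi> (v t) \<le> liminf (\<lambda>k. ereal (p (r k) t))"
      using phi_lsc[OF vb[OF t(1)] v[OF t(1)]] t(2) by (simp add: good_def)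
    have close: "\<forall>\<^sub>F k in sequentially. p (r k) t - W (r k) t < \<eta>" if "0 < \<eta>" for \<eta>
      using conv[OF t(2)] that by (rule order_tendstoD)
    have start: "\<forall>\<^sub>F k in sequentially. W (r k) 0 < a0 + \<eta>" if "0 < \<eta>" for \<eta>
    proof -
      have "(\<lambda>k. \<phi> (u (r k) 0)) \<longlonglongrightarrow> ereal a0"
        using LIMSEQ_subseq_LIMSEQ[OF init_phi_lim r] by (simp add: o_def)
      moreover have "ereal a0 < ereal (a0 + \<eta> / 2)" using that by simp
      ultimately have "\<forall>\<^sub>F k in sequentially. \<phi> (u (r k) 0) < ereal (a0 + \<eta> / 2)"
        by (rule order_tendstoD)
      then show ?thesis
      proof eventually_elim
        case (elim k)
        then have "W (r k) 0 \<le> a0 + \<eta> / 2"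
          by (intro W_0 less_imp_le)
        then show ?case using that by simp
      qed
    qed
    have "\<forall>\<^sub>F k in sequentially. ereal (p (r k) t) \<le> ereal (c0 + 1)"
      using close[OF zero_less_one]
    proof eventually_elim
      case (elim k)
      then show ?case
        using W_antimono[OF t(1), of "r k"] W_0_le[of "r k"] by simp
    qed
    then have "liminf (\<lambda>k. ereal (p (r k) t)) \<le> liminf (\<lambda>k::nat. ereal (c0 + 1))"
      by (rule Liminf_mono)
    with lsc have "\<phi> (v t) \<le> ereal (c0 + 1)"
      by (simp add: Liminf_const)
    then obtain b where b: "\<phi> (v t) = ereal b"
      by (cases "\<phi> (v t)") auto
    \<comment> \<open>Three errors \<eta>: W 0 < a0 + \<eta>, the gap p - W < \<eta>, and p > b -
      \<eta>.\<close>
    have upper: "0 \<le> a0 - b + 3 * \<eta> \<and> I t \<le> ennreal (a0 - b + 3 * \<eta>)" if \<eta>: "0 < \<eta>" for \<eta>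
    proof -
      have "ereal (b - \<eta>) < liminf (\<lambda>k. ereal (p (r k) t))"
        by (rule less_le_trans[OF _ lsc]) (use b \<eta> in simp)
      then have "\<forall>\<^sub>F k in sequentially. ereal (b - \<eta>) < ereal (p (r k) t)"
        by (rule less_LiminfD)
      with close[OF \<eta>] start[OF \<eta>] have ev: "\<forall>\<^sub>F k in sequentially. W (r k) 0 - W (r k) t \<le> a0 - b + 3 * \<eta>"
        by eventually_elim simp
      then obtain k where "W (r k) 0 - W (r k) t \<le> a0 - b + 3 * \<eta>"
        by (auto simp: eventually_sequentially)
      then have "0 \<le> a0 - b + 3 * \<eta>"
        using W_antimono[OF t(1), of "r k"] by simp
      moreover have "liminf (\<lambda>k. ennreal (W (r k) 0 - W (r k) t)) \<le> liminf (\<lambda>k::nat. ennreal (a0 - b + 3 * \<eta>))"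
        by (rule Liminf_mono) (use ev in \<open>auto elim!: eventually_mono intro: ennreal_leI\<close>)
      then have "I t \<le> ennreal (a0 - b + 3 * \<eta>)"
        using I_le[OF t(1)] by (simp add: Liminf_const)
      ultimately show ?thesis by blast
    qed
    have ba: "b \<le> a0"
    proof (rule field_le_epsilon)
      fix \<eta> :: real assume "0 < \<eta>"
      then show "b \<le> a0 + \<eta>"
        using upper[of "\<eta> / 3"] by simp
    qed
    have "I t \<le> ennreal (a0 - b)"
    proof (rule ennreal_le_epsilon)
      fix \<eta> :: real assume \<eta>: "0 < \<eta>"
      then show "I t \<le> ennreal (a0 - b) + ennreal \<eta>"
        using upper[of "\<eta> / 3"] ba by (simp flip: ennreal_plus)
    qed
    with b ba show ?thesis by blast
  qed
  \<comment> \<open>An arbitrary time is approached by good times from the right: the accumulated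
    integral is nondecreasing in time, and \<phi> is lower semicontinuous along the metrically
    continuous curve \<open>v\<close>.\<close>
  have ineq: "enn2ereal (I t) + \<phi> (v t) \<le> \<phi> ubar" if t: "0 \<le> t" for t
  proof -
    have "\<forall>j. \<exists>s. t < s \<and> s < t + inverse (real (Suc j)) \<and> (0 < s \<longrightarrow> good s)"
      using AE_lborel_Ioo_ex[OF good, of t] by (auto simp: inverse_positive_iff_positive)
    from choice[OF this] obtain s where s: "\<forall>j. t < s j \<and> s j < t + inverse (real (Suc j)) \<and> (0 < s j \<longrightarrow> good (s j))"
      by (elim exE)
    have st: "0 \<le> s j" "t \<le> s j" "good (s j)" for j
      using s[THEN spec, of j] t by auto
    have "s \<longlonglongrightarrow> t"
    proof (rule tendsto_sandwich[of "\<lambda>_. t" _ _ "\<lambda>j. t + inverse (real (Suc j))"])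
      show "(\<lambda>j. t + inverse (real (Suc j))) \<longlonglongrightarrow> t"
        using tendsto_add[OF tendsto_const LIMSEQ_inverse_real_of_nat, of t] by simp
    qed (use s in \<open>auto intro!: always_eventually less_imp_le\<close>)
    then have "(\<lambda>j. v (max 0 (s j))) \<longlonglongrightarrow> v (max 0 t)"
      by (rule isCont_tendsto_compose[OF has_speed_isCont[OF N]])
    then have "(\<lambda>j. v (s j)) \<longlonglongrightarrow> v t"
      using st(1) t by (simp add: max_def)
    then have "\<phi> (v t) \<le> liminf (\<lambda>j. \<phi> (v (s j)))"
      by (rule phi_lsc_dist)
    obtain b0 where "I (s 0) \<le> ennreal (a0 - b0)"
      using ineq_good[OF st(1,3)] by blast
    then have "I t < \<infinity>"
      using I_mono[OF st(2)[of 0]] by (simp add: order_le_less_trans[OF order_trans])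
    then obtain i where i: "I t = ennreal i" "0 \<le> i"
      by (cases "I t") auto
    have le: "\<phi> (v (s j)) \<le> ereal (a0 - i)" for j
    proof -
      obtain b where b: "\<phi> (v (s j)) = ereal b" "b \<le> a0" "I (s j) \<le> ennreal (a0 - b)"
        using ineq_good[OF st(1,3)] by blast
      have "ennreal i \<le> ennreal (a0 - b)"
        using I_mono[OF st(2), of j] b(3) i by simp
      then show ?thesis
        using b i by simp
    qed
    have "\<phi> (v t) \<le> liminf (\<lambda>j::nat. ereal (a0 - i))"
      by (rule order_trans[OF \<open>\<phi> (v t) \<le> liminf (\<lambda>j. \<phi> (v (s j)))\<close> Liminf_mono]) (simp add: le)
    then have "\<phi> (v t) \<le> ereal (a0 - i)"
      by (simp add: Liminf_const)
    then show ?thesis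
      unfolding i(1) phi_ubar using i(2) by (cases "\<phi> (v t)") (auto simp: enn2ereal_ennreal)
  qed
  show thesis
    by (rule that[OF r N v0 v \<Lambda> slope ineq[unfolded I_def]])
qed

end

section \<open>Curves of maximal slope\<close>

text \<open>Here \<open>h\<close> need not be measurable: its integral is the lower integral, which is attained by a
  measurable minorant.\<close>

lemma AE_eq_of_nn_integral_eq:
  fixes h H :: "'b \<Rightarrow> ennreal"
  assumes [measurable]: "H \<in> borel_measurable M" and le: "AE x in M. h x \<le> H x"
    and eq: "integral\<^sup>N M H \<le> integral\<^sup>N M h" and fin: "integral\<^sup>N M H < \<infinity>"
  shows "AE x in M. h x = H x"
proof -
  let ?S = "{s. simple_function M s \<and> s \<le> h}"
  have "?S \<noteq> {}"
    by (auto intro!: exI[of _ "\<lambda>_. 0"] simp: le_fun_def)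
  then have "integral\<^sup>S M ` ?S \<noteq> {}" by simp
  from ennreal_Sup_countable_SUP[OF this] obtain f :: "nat \<Rightarrow> ennreal" where
    f: "incseq f" "range f \<subseteq> integral\<^sup>S M ` ?S" "Sup (integral\<^sup>S M ` ?S) = (SUP i. f i)"
    by blast
  have "\<forall>i. \<exists>s. s \<in> ?S \<and> f i = integral\<^sup>S M s"
    using f(2) by blast
  from choice[OF this] obtain s where s: "\<forall>i. s i \<in> ?S \<and> f i = integral\<^sup>S M (s i)"
    by (elim exE)
  have [measurable]: "s i \<in> borel_measurable M" for i
    using s by (auto intro: borel_measurable_simple_function)
  define h0 where "h0 x = (SUP i. s i x)" for x
  have [measurable]: "h0 \<in> borel_measurable M"
    unfolding h0_def by measurable
  have h0: "h0 x \<le> h x" for x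
    unfolding h0_def using s by (intro SUP_least) (auto simp: le_fun_def)
  have "integral\<^sup>N M h = (SUP i. f i)"
    unfolding nn_integral_def f(3)[symmetric] ..
  also have "\<dots> \<le> integral\<^sup>N M h0"
  proof (rule SUP_least)
    fix i
    have "f i = integral\<^sup>N M (s i)"
      using s by (simp add: nn_integral_eq_simple_integral)
    also have "\<dots> \<le> integral\<^sup>N M h0"
      by (intro nn_integral_mono) (auto simp: h0_def intro: SUP_upper)
    finally show "f i \<le> integral\<^sup>N M h0" .
  qed
  finally have ge: "integral\<^sup>N M H \<le> integral\<^sup>N M h0"
    using eq by simp
  have h0H: "AE x in M. h0 x \<le> H x"
    using le by eventually_elim (rule order_trans[OF h0])
  have fin0: "integral\<^sup>N M h0 \<noteq> \<infinity>"
    using nn_integral_mono_AE[OF h0H] fin by (simp add: less_top[symmetric] top_unique) (auto simp: top_unique)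
  have "(\<integral>\<^sup>+x. H x - h0 x \<partial>M) = integral\<^sup>N M H - integral\<^sup>N M h0"
    by (rule nn_integral_diff[OF _ _ fin0 h0H]) measurable
  also have "\<dots> = 0"
    using ge fin by (simp add: diff_eq_0_iff_ennreal)
  finally have "AE x in M. H x - h0 x = 0"
    by (subst (asm) nn_integral_0_iff_AE) auto
  moreover have "AE x in M. H x \<noteq> \<infinity>"
    using fin by (intro nn_integral_noteq_infinite) auto
  ultimately show ?thesis
    using le
  proof eventually_elim
    case (elim x)
    have "H x \<le> h0 x"
      using elim by (simp add: diff_eq_0_iff_ennreal less_top)
    then show ?case
      using h0[of x] elim(3) by (simp add: antisym)
  qed
qed

lemma ennreal_mult_le_half_squares:
  fixes a b :: ennreal
  shows "a * b \<le> b\<^sup>2 / 2 + a\<^sup>2 / 2"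
proof (cases a; cases b)
  fix x y :: real assume xy: "0 \<le> x" "a = ennreal x" "0 \<le> y" "b = ennreal y"
  have "x * y \<le> y\<^sup>2 / 2 + x\<^sup>2 / 2"
    using sum_squares_bound[of x y] by simp
  then have "ennreal (x * y) \<le> ennreal (y\<^sup>2 / 2) + ennreal (x\<^sup>2 / 2)"
    by (simp add: ennreal_leI flip: ennreal_plus)
  then show ?thesis
    using xy by (simp add: ennreal_mult ennreal_power divide_ennreal[of _ 2, simplified])
qed (simp_all add: power2_eq_square ennreal_top_divide ennreal_mult_top ennreal_top_mult)

lemma has_speed_imp_AC_1:
  assumes M: "has_speed u M"
  shows "AC 1 {0..T} u"
  unfolding AC_def
proof (intro exI conjI ballI impI)
  note [measurable] = has_speedD(1)[OF M]
  have "M \<in> borel_measurable lebesgue"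
    by (rule measurable_completion) measurable
  then have "M \<in> borel_measurable (lebesgue_on {0..T})"
    by (rule measurable_restrict_space1)
  moreover have "(\<integral>\<^sup>+x. ennreal (\<bar>M x\<bar> powr 1) \<partial>lebesgue_on {0..T}) < \<infinity>"
  proof -
    have "(\<integral>\<^sup>+x. ennreal (\<bar>M x\<bar> powr 1) \<partial>lebesgue_on {0..T}) = (\<integral>\<^sup>+x\<in>{0..T}. ennreal (\<bar>M x\<bar> powr 1) \<partial>lborel)"
      by (subst nn_integral_restrict_space) (auto simp: nn_integral_completion)
    also have "\<dots> = (\<integral>\<^sup>+x\<in>{0..T}. ennreal (M x) \<partial>lborel)"
      using has_speedD(2)[OF M] by (intro nn_integral_cong) simp
    also have "\<dots> < \<infinity>"
      unfolding has_speed_set_integrable(2)[OF M order_refl] by simp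
    finally show ?thesis .
  qed
  ultimately show "in_Lp 1 (lebesgue_on {0..T}) (\<lambda>r. ereal (M r))"
    unfolding in_Lp_def by simp
next
  note [measurable] = has_speedD(1)[OF M]
  fix s t assume st: "s \<in> {0..T}" "t \<in> {0..T}" "s \<le> t"
  have "(LINT r:{s..t}|lebesgue. M r) = (LINT r:{s..t}|lborel. M r)"
    unfolding set_lebesgue_integral_def by (rule integral_completion) measurable
  then show "dist (u s) (u t) \<le> (LINT r:{s..t}|lebesgue. M r)"
    using has_speed_dist_le[OF M _ st(3)] st by simp
qed

context lscc_space
begin

text \<open>The upper gradient property bounds the energy drop by the integral of g times speed,
  Young's inequality bounds this by the integral of N^2 / 2 + \<Lambda>, and \<open>ineq\<close>
  bounds that by the energy drop again. All are therefore equal, so Young's inequality is an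
  equality almost everywhere and g = N; then the energy drop is the integral of N^2 and can be
  differentiated.\<close>

lemma curve_of_maximal_slopeI:
  assumes N: "has_speed v N" and phi0: "\<phi> (v 0) = ereal a0"
    and [measurable]: "\<Lambda> \<in> borel_measurable borel"
    and slope: "AE t in lborel. 0 < t \<longrightarrow> (g (v t))\<^sup>2 / 2 \<le> \<Lambda> t"
    and ineq: "\<And>t. 0 \<le> t \<Longrightarrow> enn2ereal (\<integral>\<^sup>+s\<in>{0..t}. (ennreal (1 / 2 * (N s)\<^sup>2) + \<Lambda> s) \<partial>lborel) + \<phi> (v t) \<le> \<phi> (v 0)"
    and ug: "moderated_upper_gradient \<infinity> \<phi> g"
  shows "curve_of_maximal_slope \<phi> g v"
proof -
  note [measurable] = has_speedD(1)[OF N]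
  define I where "I t = (\<integral>\<^sup>+s\<in>{0..t}. (ennreal (1 / 2 * (N s)\<^sup>2) + \<Lambda> s) \<partial>lborel)" for t
  define f where "f t = real_of_ereal (\<phi> (v t))" for t
  have f: "\<phi> (v t) = ereal (f t)" "f t \<le> a0" "I t \<le> ennreal (a0 - f t)" if t: "0 \<le> t" for t
  proof -
    have 1: "enn2ereal (I t) + \<phi> (v t) \<le> ereal a0"
      using ineq[OF t] by (simp add: I_def phi0)
    have ne: "\<phi> (v t) \<noteq> - \<infinity>" by simp
    obtain i where i: "0 \<le> i" "I t = ennreal i"
      using 1 ne by (cases "I t"; cases "\<phi> (v t)") auto
    show ft: "\<phi> (v t) = ereal (f t)"
      using 1 ne by (cases "\<phi> (v t)") (auto simp: f_def i)
    have "i + f t \<le> a0"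
      using 1 unfolding ft i(2) using i(1) by (simp add: enn2ereal_ennreal)
    then show "f t \<le> a0" "I t \<le> ennreal (a0 - f t)"
      using i by (auto intro: ennreal_leI)
  qed
  have f0: "f 0 = a0"
    using phi0 by (simp add: f_def)
  \<comment> \<open>Above by the energy inequality, below by coercivity on a bounded piece of the
    curve. This is also the membership in L-infinity demanded by the upper gradient
    property.\<close>
  have bounded: "\<exists>C::real. \<forall>t\<in>{0..T}. \<bar>\<phi> (v t)\<bar> \<le> ereal C" if T: "0 \<le> T" for T
  proof -
    obtain K where K: "0 \<le> K" "(\<integral>\<^sup>+r\<in>{0..T}. ennreal ((N r)\<^sup>2) \<partial>lborel) = ennreal K"
      using has_speedD(3)[OF N, of T] by (cases "\<integral>\<^sup>+r\<in>{0..T}. ennreal ((N r)\<^sup>2) \<partial>lborel") auto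
    have "\<bar>\<phi> (v t)\<bar> \<le> ereal (\<bar>a0\<bar> + B * (T * K) + quad_bound A B ustar (v 0))" if t: "t \<in> {0..T}" for t
    proof -
      have "(dist (v t) (v 0))\<^sup>2 \<le> \<bar>0 - t\<bar> * K"
        using t T K by (intro has_speed_holder[OF N, of _ T]) auto
      also have "\<dots> \<le> T * K"
        using t K by (intro mult_right_mono) auto
      finally have "B * (dist (v t) (v 0))\<^sup>2 \<le> B * (T * K)"
        using B_nonneg by (rule mult_left_mono)
      moreover have "0 \<le> B * (T * K)"
        using B_nonneg T K by simp
      moreover have "ereal (- B * (dist (v t) (v 0))\<^sup>2 - quad_bound A B ustar (v 0)) \<le> \<phi> (v t)"
        by (rule phi_lower_bound)
      moreover have "\<phi> (v t) = ereal (f t)" "f t \<le> a0"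
        using f(1,2)[of t] t by auto
      ultimately have "f t \<le> \<bar>a0\<bar> + B * (T * K) + quad_bound A B ustar (v 0)"
          "- f t \<le> \<bar>a0\<bar> + B * (T * K) + quad_bound A B ustar (v 0)"
        using quad_bound_nonneg[of "v 0"] by auto
      then show ?thesis
        using \<open>\<phi> (v t) = ereal (f t)\<close> by (simp add: abs_le_iff)
    qed
    then show ?thesis by blast
  qed
  \<comment> \<open>The upper gradient property is applied on {0..T}, where
    \<open>metric_deriv\<close> is relative to that interval; it agrees with the speed at interior
    points, and the endpoints are null.\<close>
  have md: "AE r in lborel. 0 < r \<and> r < T \<longrightarrow> metric_deriv {0..T} v r = N r" for T
    using has_speedD(5)[OF N]
  proof eventually_elim
    case (elim r)
    then show ?case
      using metric_deriv_eq[of v r "N r" "{0..T}"] by simp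
  qed
  define h where "h r = g (v r) * ennreal (N r)" for r
  have hH: "AE r in lborel. 0 < r \<longrightarrow> h r \<le> ennreal (1 / 2 * (N r)\<^sup>2) + \<Lambda> r"
    using slope
  proof eventually_elim
    case (elim r)
    show ?case
    proof
      assume "0 < r"
      have "h r \<le> (ennreal (N r))\<^sup>2 / 2 + (g (v r))\<^sup>2 / 2"
        unfolding h_def by (rule ennreal_mult_le_half_squares)
      also have "(ennreal (N r))\<^sup>2 / 2 = ennreal (1 / 2 * (N r)\<^sup>2)"
        using divide_ennreal[of "(N r)\<^sup>2" 2] has_speedD(2)[OF N, of r] by (simp add: ennreal_power)
      finally show "h r \<le> ennreal (1 / 2 * (N r)\<^sup>2) + \<Lambda> r"
        using elim \<open>0 < r\<close> by (meson add_left_mono order_trans)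
    qed
  qed
  have hI: "(\<integral>\<^sup>+r\<in>{0..T}. h r \<partial>lborel) \<le> I T" for T
    unfolding I_def
  proof (rule nn_integral_mono_AE)
    show "AE r in lborel. h r * indicator {0..T} r \<le> (ennreal (1 / 2 * (N r)\<^sup>2) + \<Lambda> r) * indicator {0..T} r"
      using hH AE_lborel_singleton[of 0]
      by eventually_elim (auto simp: indicator_def)
  qed
  have I_fin: "I T < \<infinity>" if "0 \<le> T" for T
    by (rule le_less_trans[OF f(3)[OF that]]) simp
  have eqJ: "(\<integral>\<^sup>+r\<in>S. g (v r) * ennreal (metric_deriv {0..T} v r) \<partial>lebesgue) = (\<integral>\<^sup>+r\<in>S. h r \<partial>lborel)"
    if S: "S \<subseteq> {0..T}" for S T
    unfolding nn_integral_completion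
  proof (rule nn_integral_cong_AE)
    show "AE r in lborel. g (v r) * ennreal (metric_deriv {0..T} v r) * indicator S r = h r * indicator S r"
      using md[of T] AE_lborel_singleton[of 0] AE_lborel_singleton[of T]
    proof eventually_elim
      case (elim r)
      show ?case
      proof (cases "r \<in> S")
        case True
        then have "0 < r" "r < T"
          using S elim by (auto simp: less_le)
        then show ?thesis using elim by (simp add: h_def)
      qed simp
    qed
  qed
  have upper: "f s \<le> f t + enn2real (\<integral>\<^sup>+r\<in>{s..t}. h r \<partial>lborel)" if st: "0 \<le> s" "s \<le> t" for s t
  proof -
    let ?D = "density (lebesgue_on {0..t}) (\<lambda>r. ennreal (metric_deriv {0..t} v r))"
    have t: "0 \<le> t" using st by simp
    have "in_Lp \<infinity> (completion ?D) (\<lambda>r. \<phi> (v r))"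
    proof -
      have "(\<lambda>r. \<phi> (v (max 0 r))) \<in> borel_measurable (lebesgue_on {0..t})"
        by (intro measurable_restrict_space1 measurable_completion) (simp add: phi_curve_measurable[OF N])
      then have "(\<lambda>r. \<phi> (v r)) \<in> borel_measurable (lebesgue_on {0..t})"
        by (rule measurable_cong[THEN iffD1, rotated]) (auto simp: space_restrict_space max_def)
      then have "(\<lambda>r. \<phi> (v r)) \<in> borel_measurable (completion ?D)"
        by (intro measurable_completion) simp
      moreover obtain C where "\<forall>r\<in>{0..t}. \<bar>\<phi> (v r)\<bar> \<le> ereal C"
        using bounded[OF t] by blast
      then have "AE r in completion ?D. \<bar>\<phi> (v r)\<bar> \<le> ereal C"
        by (intro AE_I2) (simp add: space_restrict_space)
      ultimately show ?thesis
        unfolding in_Lp_def by auto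
    qed
    moreover have "(\<integral>\<^sup>+r\<in>{0..t}. g (v r) * ennreal (metric_deriv {0..t} v r) \<partial>lebesgue) < \<infinity>"
      unfolding eqJ[OF order_refl] by (rule le_less_trans[OF hI I_fin[OF t]])
    moreover have "is_interval {0..t}" by simp
    ultimately have "\<phi> (v s) \<le> \<phi> (v t) + enn2ereal (\<integral>\<^sup>+r\<in>{s..t}. g (v r) * ennreal (metric_deriv {0..t} v r) \<partial>lebesgue)"
      using ug has_speed_imp_AC_1[OF N, of t] st t unfolding moderated_upper_gradient_def Let_def by auto
    also have "(\<integral>\<^sup>+r\<in>{s..t}. g (v r) * ennreal (metric_deriv {0..t} v r) \<partial>lebesgue) = (\<integral>\<^sup>+r\<in>{s..t}. h r \<partial>lborel)"
      using st by (intro eqJ) auto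
    finally have 1: "ereal (f s) \<le> ereal (f t) + enn2ereal (\<integral>\<^sup>+r\<in>{s..t}. h r \<partial>lborel)"
      using f(1)[OF st(1)] f(1)[OF t] by simp
    have "(\<integral>\<^sup>+r\<in>{s..t}. h r \<partial>lborel) \<le> (\<integral>\<^sup>+r\<in>{0..t}. h r \<partial>lborel)"
      using st by (intro nn_integral_mono) (auto simp: indicator_def)
    also have "\<dots> < \<infinity>"
      by (rule le_less_trans[OF hI I_fin[OF t]])
    finally show ?thesis
      using 1 by (cases "\<integral>\<^sup>+r\<in>{s..t}. h r \<partial>lborel") (auto simp: enn2ereal_ennreal)
  qed
  \<comment> \<open>The circle of inequalities a0 - f T \<le> integral of h \<le> I T \<le> a0 - f
    T.\<close>
  have hT: "(\<integral>\<^sup>+r\<in>{0..T}. h r \<partial>lborel) = ennreal (a0 - f T)" "I T = ennreal (a0 - f T)" if T: "0 \<le> T" for T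
  proof -
    have "a0 - f T \<le> enn2real (\<integral>\<^sup>+r\<in>{0..T}. h r \<partial>lborel)"
      using upper[OF order_refl T] f0 by simp
    then have "ennreal (a0 - f T) \<le> (\<integral>\<^sup>+r\<in>{0..T}. h r \<partial>lborel)"
      by (metis ennreal_enn2real_if ennreal_leI top_greatest)
    then show "(\<integral>\<^sup>+r\<in>{0..T}. h r \<partial>lborel) = ennreal (a0 - f T)" "I T = ennreal (a0 - f T)"
      using hI[of T] f(3)[OF T] by (auto intro: antisym order_trans)
  qed
  have gN: "AE r in lborel. 0 < r \<and> r \<le> T \<longrightarrow> g (v r) = ennreal (N r)" if T: "0 \<le> T" for T
  proof -
    have "AE r in lborel. h r * indicator {0..T} r = (ennreal (1 / 2 * (N r)\<^sup>2) + \<Lambda> r) * indicator {0..T} r"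
    proof (rule AE_eq_of_nn_integral_eq)
      show "AE r in lborel. h r * indicator {0..T} r \<le> (ennreal (1 / 2 * (N r)\<^sup>2) + \<Lambda> r) * indicator {0..T} r"
        using hH AE_lborel_singleton[of 0]
        by eventually_elim (auto simp: indicator_def)
      show "(\<integral>\<^sup>+r\<in>{0..T}. (ennreal (1 / 2 * (N r)\<^sup>2) + \<Lambda> r) \<partial>lborel) \<le> (\<integral>\<^sup>+r\<in>{0..T}. h r \<partial>lborel)"
        using hT[OF T] by (simp add: I_def)
      show "(\<integral>\<^sup>+r\<in>{0..T}. (ennreal (1 / 2 * (N r)\<^sup>2) + \<Lambda> r) \<partial>lborel) < \<infinity>"
        using I_fin[OF T] by (simp add: I_def)
    qed measurable
    moreover have "AE r in lborel. (ennreal (1 / 2 * (N r)\<^sup>2) + \<Lambda> r) * indicator {0..T} r \<noteq> \<infinity>"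
      using I_fin[OF T] unfolding I_def by (intro nn_integral_noteq_infinite) auto
    ultimately show ?thesis
      using slope
    proof eventually_elim
      case (elim r)
      show ?case
      proof
        assume r: "0 < r \<and> r \<le> T"
        have eq: "g (v r) * ennreal (N r) = ennreal (1 / 2 * (N r)\<^sup>2) + \<Lambda> r"
          using elim(1) r by (simp add: h_def)
        have "\<Lambda> r \<noteq> \<infinity>"
          using elim(2) r by simp
        then obtain l where l: "0 \<le> l" "\<Lambda> r = ennreal l"
          by (cases "\<Lambda> r") auto
        have "g (v r) \<noteq> \<infinity>"
        proof
          assume "g (v r) = \<infinity>"
          then have "\<infinity> \<le> \<Lambda> r"
            using elim(3) r by (simp add: power2_eq_square ennreal_top_divide)
          with l show False by (simp add: top_unique)
        qed
        then obtain y where y: "0 \<le> y" "g (v r) = ennreal y"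
          by (cases "g (v r)") auto
        have "(g (v r))\<^sup>2 / 2 = ennreal (y\<^sup>2 / 2)"
          using y divide_ennreal[of "y\<^sup>2" 2] by (simp add: ennreal_power)
        then have "ennreal (y\<^sup>2 / 2) \<le> ennreal l"
          using elim(3) r l by simp
        then have 1: "y\<^sup>2 / 2 \<le> l"
          using l by simp
        have N0: "0 \<le> N r" by (rule has_speedD(2)[OF N])
        have "ennreal (y * N r) = ennreal (1 / 2 * (N r)\<^sup>2 + l)"
          using eq y l N0 by (simp add: ennreal_mult ennreal_plus)
        then have "y * N r = 1 / 2 * (N r)\<^sup>2 + l"
          using y l N0 by (subst (asm) ennreal_inj) auto
        \<comment> \<open>Equality y N = N^2 / 2 + l together with y^2 / 2 \<le> l leaves no room in
          Young's inequality.\<close>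
        with 1 have "(y - N r)\<^sup>2 \<le> 0"
          by (simp add: power2_diff)
        then have "y = N r" by simp
        then show "g (v r) = ennreal (N r)" using y by simp
      qed
    qed
  qed
  have N2: "(\<integral>\<^sup>+r\<in>{0..T}. ennreal ((N r)\<^sup>2) \<partial>lborel) = ennreal (a0 - f T)" if T: "0 \<le> T" for T
  proof -
    have "(\<integral>\<^sup>+r\<in>{0..T}. ennreal ((N r)\<^sup>2) \<partial>lborel) = (\<integral>\<^sup>+r\<in>{0..T}. h r \<partial>lborel)"
    proof (rule nn_integral_cong_AE)
      show "AE r in lborel. ennreal ((N r)\<^sup>2) * indicator {0..T} r = h r * indicator {0..T} r"
        using gN[OF T] AE_lborel_singleton[of 0]
      proof eventually_elim
        case (elim r)
        then show ?case
          using has_speedD(2)[OF N, of r]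
          by (cases "r \<in> {0..T}") (auto simp: h_def ennreal_mult power2_eq_square)
      qed
    qed
    then show ?thesis using hT[OF T] by simp
  qed
  define q where "q r = indicator {0..} r * (N r)\<^sup>2" for r
  \<comment> \<open>The energy drop, extended by 0 to negative times just as \<open>q\<close> is, so
    that differentiation of indefinite integrals applies on the whole line.\<close>
  define F where "F t = a0 - f (max 0 t)" for t
  have [measurable]: "q \<in> borel_measurable borel"
    unfolding q_def by measurable
  have q0: "0 \<le> q r" for r by (simp add: q_def)
  have F_le: "F s \<le> F t" and F_int: "(\<integral>\<^sup>+r\<in>{s..t}. ennreal (q r) \<partial>lborel) = ennreal (F t - F s)" if "s \<le> t" for s t
  proof -
    define s' t' where "s' = max 0 s" and "t' = max 0 t"
    have st: "0 \<le> s'" "s' \<le> t'"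
      using that by (auto simp: s'_def t'_def)
    have F: "F s = a0 - f s'" "F t = a0 - f t'"
      by (simp_all add: F_def s'_def t'_def)
    have "ennreal (F t) = (\<integral>\<^sup>+r. ennreal ((N r)\<^sup>2) * indicator {0..s'} r + ennreal (q r) * indicator {s..t} r \<partial>lborel)"
    proof -
      have "ennreal (F t) = (\<integral>\<^sup>+r\<in>{0..t'}. ennreal ((N r)\<^sup>2) \<partial>lborel)"
        unfolding F using st by (intro N2[symmetric]) simp
      also have "\<dots> = (\<integral>\<^sup>+r. ennreal ((N r)\<^sup>2) * indicator {0..s'} r + ennreal (q r) * indicator {s..t} r \<partial>lborel)"
      proof (rule nn_integral_cong_AE)
        show "AE r in lborel. ennreal ((N r)\<^sup>2) * indicator {0..t'} r
            = ennreal ((N r)\<^sup>2) * indicator {0..s'} r + ennreal (q r) * indicator {s..t} r"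
          using AE_lborel_singleton[of s'] AE_lborel_singleton[of 0]
          by eventually_elim (use that in \<open>auto simp: q_def indicator_def s'_def t'_def max_def split: if_splits\<close>)
      qed
      finally show ?thesis .
    qed
    also have "\<dots> = (\<integral>\<^sup>+r\<in>{0..s'}. ennreal ((N r)\<^sup>2) \<partial>lborel) + (\<integral>\<^sup>+r\<in>{s..t}. ennreal (q r) \<partial>lborel)"
      by (rule nn_integral_add) measurable
    also have "(\<integral>\<^sup>+r\<in>{0..s'}. ennreal ((N r)\<^sup>2) \<partial>lborel) = ennreal (F s)"
      unfolding F using st by (intro N2)
    finally have eq: "ennreal (F t) = ennreal (F s) + (\<integral>\<^sup>+r\<in>{s..t}. ennreal (q r) \<partial>lborel)" .
    have Fpos: "0 \<le> F s" "0 \<le> F t"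
      using f(2)[of s'] f(2)[of t'] st by (auto simp: F)
    obtain i where i: "0 \<le> i" "(\<integral>\<^sup>+r\<in>{s..t}. ennreal (q r) \<partial>lborel) = ennreal i"
      using eq by (cases "\<integral>\<^sup>+r\<in>{s..t}. ennreal (q r) \<partial>lborel") auto
    have "ennreal (F t) = ennreal (F s + i)"
      using eq i Fpos by (simp add: ennreal_plus)
    then have "F t = F s + i"
      using Fpos i by (subst (asm) ennreal_inj) auto
    then show "F s \<le> F t" "(\<integral>\<^sup>+r\<in>{s..t}. ennreal (q r) \<partial>lborel) = ennreal (F t - F s)"
      using i by auto
  qed
  have qi: "set_integrable lborel {s..t} q" for s t
  proof (cases "s \<le> t")
    case True
    show ?thesis
      by (rule nn_integral_Icc_imp_LINT(1)[OF _ q0 _ F_int[OF True]]) (use F_le[OF True] in auto)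
  qed (simp add: set_integrable_def)
  have ql: "F t - F s = (LINT r:{s..t}|lborel. q r)" if "s \<le> t" for s t
    by (rule nn_integral_Icc_imp_LINT(2)[OF _ q0 _ F_int[OF that], symmetric]) (use F_le[OF that] in auto)
  have "AE t in lborel. (F has_real_derivative q t) (at t)"
    by (rule AE_has_real_derivative_indefinite_integral[OF qi ql])
  moreover have "AE t in lborel. \<forall>n::nat. 0 < t \<and> t \<le> real n \<longrightarrow> g (v t) = ennreal (N t)"
    unfolding AE_all_countable using gN by simp
  moreover note has_speed_metric_deriv[OF N]
  ultimately have "AE t in lborel. 0 < t \<longrightarrow>
      ((\<lambda>s. real_of_ereal (\<phi> (v s))) has_real_derivative - (metric_deriv {0..} v t)\<^sup>2) (at t) \<and>
      ennreal ((metric_deriv {0..} v t)\<^sup>2) = (g (v t))\<^sup>2"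
  proof eventually_elim
    case (elim t)
    show ?case
    proof (intro impI conjI)
      assume t: "0 < t"
      have "((\<lambda>s. a0 - F s) has_real_derivative - q t) (at t)"
        using elim(1) by (auto intro!: derivative_eq_intros)
      then have "((\<lambda>s. a0 - F s) has_real_derivative - (metric_deriv {0..} v t)\<^sup>2) (at t)"
        using elim(3) t by (simp add: q_def)
      then show "((\<lambda>s. real_of_ereal (\<phi> (v s))) has_real_derivative - (metric_deriv {0..} v t)\<^sup>2) (at t)"
        by (rule has_field_derivative_transform_within_open[of _ _ _ "{0<..}"]) (use t in \<open>auto simp: F_def f_def\<close>)
      obtain n :: nat where "t \<le> real n"
        using real_arch_simple by blast
      then have "g (v t) = ennreal (N t)"
        using elim(2) t by blast
      then show "ennreal ((metric_deriv {0..} v t)\<^sup>2) = (g (v t))\<^sup>2"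
        using elim(3) t has_speedD(2)[OF N, of t] by (simp add: ennreal_power)
    qed
  qed
  then have "AE t in lebesgue_on {0<..}.
      ((\<lambda>s. real_of_ereal (\<phi> (v s))) has_real_derivative - (metric_deriv {0..} v t)\<^sup>2) (at t) \<and>
      ennreal ((metric_deriv {0..} v t)\<^sup>2) = (g (v t))\<^sup>2"
    by (subst AE_restrict_space_iff) (simp_all add: AE_completion_iff)
  then show ?thesis
    unfolding curve_of_maximal_slope_def using has_speed_imp_AC_loc_2[OF N] bounded by blast
qed

end

section \<open>Assembly of the theorem\<close>

theorem theorem3p6:
  fixes \<sigma> :: "'a::complete_space topology"
    and \<phi> :: "'a \<Rightarrow> ereal"
    and ustar ubar :: 'a
    and A B :: real
    and ub :: "real \<Rightarrow> 'a"
    and ue :: "real \<Rightarrow> real \<Rightarrow> 'a"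
    and eps :: "nat \<Rightarrow> real"
  assumes "compatible \<sigma>"
    and "proper \<phi>"
    and "LSCC \<sigma> \<phi> ustar A B"
    and "\<forall>\<epsilon>\<in>wed_params B. ub \<epsilon> \<in> edom \<phi>"
    and "ubar \<in> edom \<phi>"
    and "limitin \<sigma> ub ubar (at_right 0)"
    and "bdd_above ((\<lambda>\<epsilon>. dist (ub \<epsilon>) ubar) ` wed_params B)"
    and "((\<lambda>\<epsilon>. \<phi> (ub \<epsilon>)) \<longlongrightarrow> \<phi> ubar) (at_right 0)"
    and "\<forall>\<epsilon>\<in>wed_params B. ue \<epsilon> \<in> wed_minimizers \<phi> \<epsilon> (ub \<epsilon>)"
    and "filterlim eps (at_right 0) sequentially"
  shows "\<exists>(r :: nat \<Rightarrow> nat) u.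
           strict_mono r \<and>
           AC_loc 2 {0..} u \<and> u 0 = ubar \<and>
           (\<forall>t\<ge>0. limitin \<sigma> (\<lambda>k. ue (eps (r k)) t) (u t) sequentially) \<and>
           (\<forall>t\<ge>0. enn2ereal (\<integral>\<^sup>+ s\<in>{0..t}.
                     (ennreal ((metric_deriv {0..} u s)\<^sup>2) / 2 +
                      (relaxed_slope \<sigma> \<phi> (u s))\<^sup>2 / 2) \<partial>lebesgue) + \<phi> (u t) \<le> \<phi> ubar) \<and>
           (moderated_upper_gradient \<infinity> \<phi> (relaxed_slope \<sigma> \<phi>) \<longrightarrow>
              curve_of_maximal_slope \<phi> (relaxed_slope \<sigma> \<phi>) u)"
proof -
  interpret lscc_space \<sigma> \<phi> ustar A B
    by unfold_locales (fact assms)+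
  obtain a0 where a0: "\<phi> ubar = ereal a0"
    using assms(5) phi_not_MInf[of ubar] by (cases "\<phi> ubar") (auto simp: edom_def)
  have eps0: "eps \<longlonglongrightarrow> 0" "\<forall>\<^sub>F k in sequentially. 0 < eps k"
    using assms(10) by (auto simp: filterlim_at elim: eventually_mono)
  \<comment> \<open>B + 1 replaces B so that the threshold also makes sense for B = 0.\<close>
  have "\<forall>\<^sub>F k in sequentially. eps k < 1 / (16 * (B + 1))"
    using eps0(1) B_nonneg by (intro order_tendstoD) auto
  with eps0(2) have ev1: "\<forall>\<^sub>F k in sequentially. eps k \<in> wed_params B"
  proof eventually_elim
    case (elim k)
    have "16 * eps k * B \<le> 16 * eps k * (B + 1)"
      using elim by simp
    also have "\<dots> \<le> 1"
      using elim B_nonneg by (simp add: pos_less_divide_eq mult_ac)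
    finally show ?case
      using elim by (simp add: wed_params_def pos_le_divide_eq mult_ac)
  qed
  have phi_lim: "(\<lambda>k. \<phi> (ub (eps k))) \<longlonglongrightarrow> ereal a0"
    using filterlim_compose[OF assms(8,10)] a0 by simp
  then have "\<forall>\<^sub>F k in sequentially. \<phi> (ub (eps k)) < ereal (a0 + 1)"
    by (rule order_tendstoD) simp
  with ev1 have "\<forall>\<^sub>F k in sequentially. eps k \<in> wed_params B \<and> \<phi> (ub (eps k)) < ereal (a0 + 1)"
    by (rule eventually_conj)
  then obtain k0 where k0: "\<And>k. k0 \<le> k \<Longrightarrow> eps k \<in> wed_params B \<and> \<phi> (ub (eps k)) < ereal (a0 + 1)"
    by (auto simp: eventually_sequentially)
  \<comment> \<open>Discarding the first \<open>k0\<close> parameters makes all conditions hold for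
    every index; the shift is added back to the subsequence at the end.\<close>
  define e where "e k = eps (k + k0)" for k
  have e: "e k \<in> wed_params B" "\<phi> (ub (e k)) \<le> ereal (a0 + 1)" for k
    using k0[of "k + k0"] by (auto simp: e_def intro: less_imp_le)
  have min: "ue (e k) \<in> wed_minimizers \<phi> (e k) (ub (e k))" for k
    using assms(9) e by blast
  have "\<forall>k. \<exists>M. has_speed (ue (e k)) M"
  proof
    fix k
    have "AC_loc 2 {0..} (ue (e k))"
      using min[of k] by (simp add: wed_minimizers_def wed_curves_def)
    then show "\<exists>M. has_speed (ue (e k)) M"
      by (rule AC_loc_2_imp_has_speed) blast
  qed
  from choice[OF this] obtain M where M: "\<forall>k. has_speed (ue (e k)) (M k)"
    by (elim exE)
  have wm: "wed_minimizer \<sigma> \<phi> ustar A B (e k) (ub (e k)) (ue (e k)) (M k)" for k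
  proof unfold_locales
    show "\<phi> (ub (e k)) < \<infinity>"
      by (rule le_less_trans[OF e(2)]) simp
  qed (use e min M in auto)
  note u0 = wed_minimizer.u_0[OF wm]
  obtain R where R: "\<And>\<epsilon>. \<epsilon> \<in> wed_params B \<Longrightarrow> dist (ub \<epsilon>) ubar \<le> R"
    using assms(7) by (auto simp: bdd_above_def)
  have shift: "filterlim (\<lambda>k. k + k0) sequentially sequentially"
    by (rule filterlim_add_const_nat_at_top)
  interpret S: wed_sequence \<sigma> \<phi> ustar A B e "\<lambda>k. ue (e k)" M
    "\<lambda>k. wed_minimizer.p \<phi> (ue (e k))" "\<lambda>k. wed_minimizer.W \<phi> (e k) (ue (e k)) (M k)" ubar a0 "a0 + 1" R
  proof unfold_locales
    show "0 < e k" for k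
      by (rule wed_minimizer.eps_pos[OF wm])
    show "e \<longlonglongrightarrow> 0"
      unfolding e_def by (rule filterlim_compose[OF eps0(1) shift])
    show "limitin \<sigma> (\<lambda>k. ue (e k) 0) ubar sequentially"
      unfolding limitin_def
    proof (intro conjI allI impI)
      fix U assume "openin \<sigma> U \<and> ubar \<in> U"
      then have "\<forall>\<^sub>F \<epsilon> in at_right 0. ub \<epsilon> \<in> U"
        using assms(6) by (simp add: limitin_def)
      then have "\<forall>\<^sub>F k in sequentially. ub (eps k) \<in> U"
        by (rule eventually_compose_filterlim[OF _ assms(10)])
      then have "\<forall>\<^sub>F k in sequentially. ub (eps (k + k0)) \<in> U"
        by (rule eventually_compose_filterlim[OF _ shift])
      then show "\<forall>\<^sub>F k in sequentially. ue (e k) 0 \<in> U"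
        by (simp add: u0 e_def[symmetric])
    qed simp
    show "dist (ue (e k) 0) ubar \<le> R" for k
      using R[OF e(1)] by (simp add: u0)
    show "\<phi> (ue (e k) 0) \<le> ereal (a0 + 1)" for k
      using e(2) by (simp add: u0)
    show "(\<lambda>k. \<phi> (ue (e k) 0)) \<longlonglongrightarrow> ereal a0"
      unfolding u0 unfolding e_def by (rule filterlim_compose[OF phi_lim shift])
    show "has_speed (ue (e k)) (M k)" for k
      using M by simp
    show "wed_minimizer.p \<phi> (ue (e k)) \<in> borel_measurable borel" for k
      by (rule wed_minimizer.p_measurable[OF wm])
    show "wed_minimizer.W \<phi> (e k) (ue (e k)) (M k) \<in> borel_measurable borel" for k
      by (rule wed_minimizer.W_measurable[OF wm])
    show "AE t in lborel. 0 \<le> t \<longrightarrow> \<phi> (ue (e k) t) = ereal (wed_minimizer.p \<phi> (ue (e k)) t)" for k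
      by (rule wed_minimizer.phi_u[OF wm])
    show "AE t in lborel. 0 \<le> t \<longrightarrow> wed_minimizer.W \<phi> (e k) (ue (e k)) (M k) t \<le> wed_minimizer.p \<phi> (ue (e k)) t" for k
      by (rule wed_minimizer.W_le_p[OF wm])
    show "wed_minimizer.W \<phi> (e k) (ue (e k)) (M k) t \<le> wed_minimizer.W \<phi> (e k) (ue (e k)) (M k) 0"
      if "0 \<le> t" for k t
      by (rule wed_minimizer.energy_identity(1)[OF wm that])
    show "(\<integral>\<^sup>+r\<in>{0..t}. (ennreal (1 / 2 * (M k r)\<^sup>2)
        + ennreal ((wed_minimizer.p \<phi> (ue (e k)) r - wed_minimizer.W \<phi> (e k) (ue (e k)) (M k) r) / e k)) \<partial>lborel)
        = ennreal (wed_minimizer.W \<phi> (e k) (ue (e k)) (M k) 0 - wed_minimizer.W \<phi> (e k) (ue (e k)) (M k) t)"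
      if "0 \<le> t" for k t
      by (rule wed_minimizer.energy_identity(2)[OF wm that])
    show "- quad_bound A B ustar (ue (e k) t) \<le> wed_minimizer.W \<phi> (e k) (ue (e k)) (M k) t" if "0 \<le> t" for k t
      by (rule wed_minimizer.W_lower_bound[OF wm that])
    show "wed_minimizer.W \<phi> (e k) (ue (e k)) (M k) 0 \<le> b" if "\<phi> (ue (e k) 0) \<le> ereal b" for k b
      by (rule wed_minimizer.W_le_phi[OF wm order_refl that])
    show "1 / 2 * s\<^sup>2 * e k * (1 - exp (- (r / s) / e k)) \<le> a - wed_minimizer.W \<phi> (e k) (ue (e k)) (M k) t"
      if "0 \<le> t" "\<phi> (ue (e k) t) = ereal a" "0 < r" "0 < s"
        "\<And>y. dist (ue (e k) t) y \<le> r \<Longrightarrow> \<phi> y \<le> \<phi> (ue (e k) t) \<Longrightarrow> ennreal s < local_slope \<phi> y" for k t a r s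
      by (rule wed_minimizer.W_slope[OF wm that])
  qed (fact a0)
  obtain r v N \<Lambda> where r: "strict_mono (r :: nat \<Rightarrow> nat)" and N: "has_speed v N" and v0: "v 0 = ubar"
    and lim: "\<And>t. 0 \<le> t \<Longrightarrow> limitin \<sigma> (\<lambda>k. ue (e (r k)) t) (v t) sequentially"
    and \<Lambda>: "\<Lambda> \<in> borel_measurable borel"
    and slope: "AE t in lborel. 0 < t \<longrightarrow> (relaxed_slope \<sigma> \<phi> (v t))\<^sup>2 / 2 \<le> \<Lambda> t"
    and ineq: "\<And>t. 0 \<le> t \<Longrightarrow> enn2ereal (\<integral>\<^sup>+s\<in>{0..t}. (ennreal (1 / 2 * (N s)\<^sup>2) + \<Lambda> s) \<partial>lborel) + \<phi> (v t) \<le> \<phi> ubar"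
    by (rule S.limit_curve) (rule that)
  have half: "ennreal (x\<^sup>2) / 2 = ennreal (1 / 2 * x\<^sup>2)" for x :: real
    using divide_ennreal[of "x\<^sup>2" 2] by simp
  have "enn2ereal (\<integral>\<^sup>+s\<in>{0..t}. (ennreal ((metric_deriv {0..} v s)\<^sup>2) / 2 + (relaxed_slope \<sigma> \<phi> (v s))\<^sup>2 / 2) \<partial>lebesgue)
      + \<phi> (v t) \<le> \<phi> ubar" if t: "0 \<le> t" for t
  proof -
    \<comment> \<open>The left integrand may be nonmeasurable; its integral is then a lower integral
      and still monotone, so the bound by the measurable majorant stands.\<close>
    have "(\<integral>\<^sup>+s\<in>{0..t}. (ennreal ((metric_deriv {0..} v s)\<^sup>2) / 2 + (relaxed_slope \<sigma> \<phi> (v s))\<^sup>2 / 2) \<partial>lebesgue)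
        \<le> (\<integral>\<^sup>+s\<in>{0..t}. (ennreal (1 / 2 * (N s)\<^sup>2) + \<Lambda> s) \<partial>lborel)"
      unfolding nn_integral_completion
    proof (rule nn_integral_mono_AE)
      show "AE s in lborel. (ennreal ((metric_deriv {0..} v s)\<^sup>2) / 2 + (relaxed_slope \<sigma> \<phi> (v s))\<^sup>2 / 2) * indicator {0..t} s
          \<le> (ennreal (1 / 2 * (N s)\<^sup>2) + \<Lambda> s) * indicator {0..t} s"
        using slope has_speed_metric_deriv[OF N] AE_lborel_singleton[of 0]
      proof eventually_elim
        case (elim s)
        show ?case
        proof (cases "s \<in> {0..t}")
          case True
          then have "0 < s" using elim(3) by simp
          then show ?thesis
            using elim True unfolding half by (simp add: add_left_mono)
        qed simp
      qed
    qed
    then have "enn2ereal (\<integral>\<^sup>+s\<in>{0..t}. (ennreal ((metric_deriv {0..} v s)\<^sup>2) / 2 + (relaxed_slope \<sigma> \<phi> (v s))\<^sup>2 / 2) \<partial>lebesgue) + \<phi> (v t)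
        \<le> enn2ereal (\<integral>\<^sup>+s\<in>{0..t}. (ennreal (1 / 2 * (N s)\<^sup>2) + \<Lambda> s) \<partial>lborel) + \<phi> (v t)"
      by (intro add_right_mono) (simp add: less_eq_ennreal.rep_eq)
    then show ?thesis
      using ineq[OF t] by (rule order_trans)
  qed
  moreover have "curve_of_maximal_slope \<phi> (relaxed_slope \<sigma> \<phi>) v"
    if "moderated_upper_gradient \<infinity> \<phi> (relaxed_slope \<sigma> \<phi>)"
    by (rule curve_of_maximal_slopeI[OF N _ \<Lambda> slope _ that]) (use ineq a0 v0 in auto)
  moreover have "strict_mono (\<lambda>k. r k + k0)"
    using r by (simp add: strict_mono_def)
  ultimately show ?thesis
    using has_speed_imp_AC_loc_2[OF N] v0 lim
    by (intro exI[of _ "\<lambda>k. r k + k0"] exI[of _ v]) (simp add: e_def)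
qed

end
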